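(* For a given $\rho\in\mathcal M(\Omega,\mathbb R_+)$, let $\rho^\varepsilon\in\mathcal M(\Omega,\mathbb R_+)$ be its $\varepsilon$-regularization (defined in the context). Then $$\mathrm{WFR}^2(\rho,\rho^\varepsilon)=O(\varepsilon)\qquad\text{as }\varepsilon\to0 .$$ Moreover, there exist $\mu^{\tau,\sigma}=(\rho^{\tau,\sigma},q^{\tau,\sigma},r^{\tau,\sigma})\in\mathcal{CE}_{\tau,\sigma}([0,1];\mathcal S_{\overline X_\sigma}(\rho),\mathcal S_{\overline X_\sigma}(\rho^\varepsilon))$, for $(\tau,\sigma)\in\Sigma_{\mathbb N}$, such that $$\mathcal J_{\tau,\sigma}(\mu^{\tau,\sigma})=O(\varepsilon+\sigma)\qquad\text{as }\varepsilon,\sigma\to0,$$ where the implied constant is independent of $\tau$.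
   Context: **Setting.** $\Omega\subset\mathbb R^d$ is a compact domain with nonempty interior that is star-shaped with respect to a set of points with nonempty interior; $Q=[0,1]\times\Omega$. $\mathcal M(\mathcal X,V)=C(\mathcal X,V)^*$ denotes $V$-valued Radon measures on a compact set $\mathcal X$; $\mathcal M(\Omega,\mathbb R_+)$ the nonnegative finite ones. **WFR metric** (parameters $\alpha=\beta=1$). Let $J(\rho,q,r)=\frac{|q|^2+r^2}{2\rho}$ if $\rho>0$, $J(0,0,0)=0$, $J=+\infty$ otherwise, for $(\rho,q,r)\in\mathbb R\times\mathbb R^d\times\mathbb R$. For $\rho_0,\rho_1\in\mathcal M(\Omega,\mathbb R_+)$, $\mathrm{WFR}^2(\rho_0,\rho_1)$ is the infimum of $\int_QJ\big(\frac{d\mu}{d\lambda}\big)d\lambda$ ($\lambda$ any nonnegative finite Radon measure with $|\mu|\ll\lambda$) over $\mu=(\rho,q,r)\in\mathcal M(Q,\mathbb R\times\mathbb R^d\times\mathbb R)$ satisfying $\partial_t\rho+\mathrm{div}\,q=r$ with end points $\rho_0,\rho_1$, i.e. $\int_Q\partial_t\phi\,d\rho+\nabla\phi\cdot dq+\phi\,dr=\int_\Omega\phi(1,\cdot)\,d\rho_1-\int_\Omega\phi(0,\cdot)\,d\rho_0$ for all $\phi\in C^1(Q)$. **$\varepsilon$-regularization.** Let $x_0$ be an interior point of the set of points with respect to which $\Omega$ is star-shaped, $L$ the Lipschitz constant of $x\mapsto\inf\{\lambda>0:x-x_0\in\lambda(\Omega-x_0)\}$, and $\Omega_r=\{x\in\mathbb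 R^d:\mathrm{dist}(x,\Omega)\le r\}$. Fix a smooth nonnegative function $\bar\rho$ supported in $\Omega_1$ with $\bar\rho\ge1$ on $\Omega_{1/2}$, and a $C^\infty$ radial nonnegative kernel $\theta_d$ on $\mathbb R^d$ supported in the unit ball with integral $1$; $\theta_d^\varepsilon(x)=\varepsilon^{-d}\theta_d(x/\varepsilon)$. With $T^\varepsilon(x)=x_0+(1+L\varepsilon)^{-1}(x-x_0):\Omega_\varepsilon\to\Omega$ and $\rho$ extended by zero, $$\rho^\varepsilon=(1-\varepsilon)\,T^\varepsilon_\#(\theta_d^\varepsilon*\rho)+\varepsilon\,T^\varepsilon_\#\big((\theta_d^\varepsilon*\bar\rho)\,dx|_{\Omega_\varepsilon}\big).$$ **Mesh.** $\{(\mathcal T^\sigma,\mathcal V^\sigma)\}_{\sigma\in\Sigma}$, with $\Sigma\subset(0,\infty)$ having $0$ as accumulation point, is a family of conforming, quasi-uniform simplicial triangulations of $\Omega$ ($\mathcal T^\sigma$ the simplices, $\mathcal V^\sigma$ the vertices) with mesh size $\sigma=\max_{K\in\mathcal T^\sigma}\mathrm{diam}(K)$; quasi-uniform means that for some $c>0$ independent of $\sigma$ every $K\in\mathcal T^\sigma$ contains a ball of diameter at least $c\,\sigma$. $|K|$ is the volume of $K$, $\mathcal V_K^\sigma$ its vertex set, $\hat\phi_v$ the continuous piecewise linear nodal function with $\hat\phi_v(v)=1$ and $\hat\phi_v(v')=0$ for other vertices $v'$; $|T_v|=\int_\Omega\hat\phi_v\,dx$. **Discrete scheme.** $\overline X_\sigma=X_\sigma=\{(\rho_v)_{v\in\mathcal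 V^\sigma}:\rho_v\in\mathbb R\}$, $X_{\sigma,+}$ its subset with all $\rho_v\ge0$, $Y_\sigma=\{(q_K)_{K\in\mathcal T^\sigma}:q_K\in\mathbb R^d\}$. For a measure $\rho$ on $\Omega$, $\mathcal S_{\overline X_\sigma}(\rho)=\big(\frac1{|T_v|}\int_\Omega\hat\phi_v\,d\rho\big)_{v\in\mathcal V^\sigma}$. The discrete divergence $\mathrm{div}_\sigma:Y_\sigma\to X_\sigma$ is defined by $\sum_v|T_v|\,a_v(\mathrm{div}_\sigma q)_v=-\sum_{K\in\mathcal T^\sigma}\sum_{v\in\mathcal V_K^\sigma}a_v\,q_K\cdot\int_K\nabla\hat\phi_v\,dx$ for all $(a_v)\in X_\sigma$. The discrete action is $$\mathcal J_\sigma(\rho,q,r)=\frac12\sum_K|K|\Big(\frac1{d+1}\sum_{v\in\mathcal V_K^\sigma}\rho_v\Big)^\dagger|q_K|^2+\frac12\sum_v|T_v|\,\rho_v^\dagger\,|r_v|^2,$$ where $a^\dagger|b|^2$ means $|b|^2/a$ if $a>0$, $0$ if $a=0$ and $b=0$, and $+\infty$ otherwise. $\Sigma_{\mathbb N}=\{1/N:N\ge2\}\times\Sigma$, $(\tau,\sigma)=(1/N,\sigma)$. For $A,B\in X_{\sigma,+}$, $\mathcal{CE}_{\tau,\sigma}([0,1];A,B)$ is the set of $(\rho,q,r)\in(X_\sigma)^{N+1}\times(Y_\sigma)^N\times(X_\sigma)^N$ with $\tau^{-1}(\rho_j-\rho_{j-1})=-\mathrm{div}_\sigma q_j+r_j$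 for $j=1,\dots,N$, $\rho_0=A$, $\rho_N=B$, all $\rho_j\in X_{\sigma,+}$; and $\mathcal J_{\tau,\sigma}(\rho,q,r)=\tau\sum_{j=1}^N\mathcal J_\sigma\big(\frac{\rho_{j-1}+\rho_j}2,q_j,r_j\big)$. *)

theory Defs
  imports "HOL-Analysis.Analysis"
begin

section \<open>Domain and measures\<close>

definition star_points :: "'a::euclidean_space set \<Rightarrow> 'a set" where
  "star_points \<Omega> = {x \<in> \<Omega>. \<forall>y\<in>\<Omega>. closed_segment x y \<subseteq> \<Omega>}"

definition star_domain :: "'a::euclidean_space set \<Rightarrow> bool" where
  "star_domain \<Omega> \<longleftrightarrow>
     compact \<Omega> \<and> interior \<Omega> \<noteq> {} \<and> interior (star_points \<Omega>) \<noteq> {}"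

text \<open>Nonnegative finite (automatically Radon) measures on a compact set are represented by their
  extension by zero: finite Borel measures on the whole space that vanish off the set.\<close>

definition nonneg_measures :: "'b::euclidean_space set \<Rightarrow> 'b measure set" where
  "nonneg_measures S =
     {M. sets M = sets borel \<and> emeasure M UNIV < \<infinity> \<and> emeasure M (- S) = 0}"

text \<open>The dual of the space of continuous functions from a compact set \<open>S\<close> to \<open>'v\<close>.  A functional
  takes functions on the whole type as arguments; the bound by the supremum over \<open>S\<close>, together
  with linearity, makes it depend on the restriction to \<open>S\<close> only.\<close>

definition vector_measures ::
    "'b::euclidean_space set \<Rightarrow> (('b \<Rightarrow> 'v::euclidean_space) \<Rightarrow> real) set" where
  "vector_measures S = {\<mu>.
     (\<forall>f g. continuous_on S f \<longrightarrow> continuous_on S g \<longrightarrow> \<mu> (\<lambda>x. f x + g x) = \<mu> f + \<mu> g) \<and>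
     (\<forall>c f. continuous_on S f \<longrightarrow> \<mu> (\<lambda>x. c *\<^sub>R f x) = c * \<mu> f) \<and>
     (\<exists>C. \<forall>f. continuous_on S f \<longrightarrow> \<bar>\<mu> f\<bar> \<le> C * (SUP x\<in>S. norm (f x)))}"

text \<open>\<open>is_density S \<mu> \<lambda> h\<close> means \<open>d\<mu>/d\<lambda> = h\<close>. By Radon-Nikodym such an \<open>h\<close> exists if and only
  if \<open>|\<mu>|\<close> is absolutely continuous with respect to \<open>\<lambda>\<close>.\<close>

definition is_density ::
    "'b::euclidean_space set \<Rightarrow> (('b \<Rightarrow> 'v::euclidean_space) \<Rightarrow> real) \<Rightarrow> 'b measure \<Rightarrow> ('b \<Rightarrow> 'v) \<Rightarrow> bool"
  where
  "is_density S \<mu> l h \<longleftrightarrow>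
     integrable l h \<and> (\<forall>f. continuous_on S f \<longrightarrow> \<mu> f = (LINT x:S|l. f x \<bullet> h x))"


section \<open>The Wasserstein-Fisher-Rao metric\<close>

definition space_time :: "'a::euclidean_space set \<Rightarrow> (real \<times> 'a) set" where
  "space_time \<Omega> = {0..1} \<times> \<Omega>"

fun J_density :: "real \<times> 'a::euclidean_space \<times> real \<Rightarrow> ennreal" where
  "J_density (\<rho>, q, r) =
     (if \<rho> > 0 then ennreal (((norm q)\<^sup>2 + r\<^sup>2) / (2 * \<rho>))
      else if \<rho> = 0 \<and> q = 0 \<and> r = 0 then 0 else \<infinity>)"

text \<open>Since \<open>J_density\<close> is positively 1-homogeneous, the integral does not depend on the choice of
  the reference measure and density; the infimum picks the common value.\<close>

definition action ::
    "'a::euclidean_space set \<Rightarrow> ((real \<times> 'a \<Rightarrow> real \<times> 'a \<times> real) \<Rightarrow> real) \<Rightarrow> ennreal" where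
  "action \<Omega> \<mu> =
     (INF (l, h) \<in> {(l, h). l \<in> nonneg_measures (space_time \<Omega>) \<and> is_density (space_time \<Omega>) \<mu> l h}.
        \<integral>\<^sup>+ z. J_density (h z) \<partial>l)"

text \<open>In \<open>C1_on Q \<phi> D\<close>, \<open>D z = (\<partial>\<^sub>t \<phi> z, \<nabla> \<phi> z)\<close> is the space-time gradient, taken within \<open>Q\<close>.\<close>

definition C1_on :: "'b::euclidean_space set \<Rightarrow> ('b \<Rightarrow> real) \<Rightarrow> ('b \<Rightarrow> 'b) \<Rightarrow> bool" where
  "C1_on Q \<phi> D \<longleftrightarrow>
     continuous_on Q D \<and> (\<forall>z\<in>Q. (\<phi> has_derivative (\<lambda>w. D z \<bullet> w)) (at z within Q))"

definition continuity_eq ::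
    "'a::euclidean_space set \<Rightarrow> 'a measure \<Rightarrow> 'a measure \<Rightarrow>
     ((real \<times> 'a \<Rightarrow> real \<times> 'a \<times> real) \<Rightarrow> real) set" where
  "continuity_eq \<Omega> \<rho>0 \<rho>1 = {\<mu> \<in> vector_measures (space_time \<Omega>).
     \<forall>\<phi> D. C1_on (space_time \<Omega>) \<phi> D \<longrightarrow>
       \<mu> (\<lambda>z. (fst (D z), snd (D z), \<phi> z)) =
         (LINT x:\<Omega>|\<rho>1. \<phi> (1, x)) - (LINT x:\<Omega>|\<rho>0. \<phi> (0, x))}"

definition WFR_sq :: "'a::euclidean_space set \<Rightarrow> 'a measure \<Rightarrow> 'a measure \<Rightarrow> ennreal" where
  "WFR_sq \<Omega> \<rho>0 \<rho>1 = (INF \<mu> \<in> continuity_eq \<Omega> \<rho>0 \<rho>1. action \<Omega> \<mu>)"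


section \<open>Regularization\<close>

definition gauge_at :: "'a::euclidean_space set \<Rightarrow> 'a \<Rightarrow> 'a \<Rightarrow> real" where
  "gauge_at \<Omega> x0 x = Inf {l. l > 0 \<and> x - x0 \<in> (\<lambda>y. l *\<^sub>R (y - x0)) ` \<Omega>}"

definition gauge_lip :: "'a::euclidean_space set \<Rightarrow> 'a \<Rightarrow> real" where
  "gauge_lip \<Omega> x0 = Inf {L. L-lipschitz_on UNIV (gauge_at \<Omega> x0)}"

definition thicken :: "'a::euclidean_space set \<Rightarrow> real \<Rightarrow> 'a set" where
  "thicken \<Omega> r = {x. infdist x \<Omega> \<le> r}"

primrec C_order :: "nat \<Rightarrow> ('a::euclidean_space \<Rightarrow> real) \<Rightarrow> bool" where
  "C_order 0 f \<longleftrightarrow> continuous_on UNIV f"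
| "C_order (Suc n) f \<longleftrightarrow>
     (\<forall>x. f differentiable (at x)) \<and> (\<forall>v. C_order n (\<lambda>x. frechet_derivative f (at x) v))"

definition smooth :: "('a::euclidean_space \<Rightarrow> real) \<Rightarrow> bool" where
  "smooth f \<longleftrightarrow> (\<forall>n. C_order n f)"

definition background :: "'a::euclidean_space set \<Rightarrow> ('a \<Rightarrow> real) \<Rightarrow> bool" where
  "background \<Omega> \<rho>b \<longleftrightarrow> smooth \<rho>b \<and> (\<forall>x. 0 \<le> \<rho>b x) \<and>
     (\<forall>x. x \<notin> thicken \<Omega> 1 \<longrightarrow> \<rho>b x = 0) \<and> (\<forall>x\<in>thicken \<Omega> (1/2). 1 \<le> \<rho>b x)"

definition radial_kernel :: "('a::euclidean_space \<Rightarrow> real) \<Rightarrow> bool" where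
  "radial_kernel \<theta> \<longleftrightarrow> smooth \<theta> \<and> (\<forall>x. 0 \<le> \<theta> x) \<and> (\<forall>x y. norm x = norm y \<longrightarrow> \<theta> x = \<theta> y) \<and>
     (\<forall>x. x \<notin> cball 0 1 \<longrightarrow> \<theta> x = 0) \<and> (LINT x|lborel. \<theta> x) = 1"

definition rescale :: "('a::euclidean_space \<Rightarrow> real) \<Rightarrow> real \<Rightarrow> 'a \<Rightarrow> real" where
  "rescale \<theta> \<epsilon> x = \<theta> (x /\<^sub>R \<epsilon>) / \<epsilon> ^ DIM('a)"

definition conv_measure :: "('a::euclidean_space \<Rightarrow> real) \<Rightarrow> 'a measure \<Rightarrow> 'a \<Rightarrow> real" where
  "conv_measure k \<rho> x = (LINT y|\<rho>. k (x - y))"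

definition conv_fun :: "('a::euclidean_space \<Rightarrow> real) \<Rightarrow> ('a \<Rightarrow> real) \<Rightarrow> 'a \<Rightarrow> real" where
  "conv_fun k f x = (LINT y|lborel. k (x - y) * f y)"

definition contraction :: "'a::euclidean_space set \<Rightarrow> 'a \<Rightarrow> real \<Rightarrow> 'a \<Rightarrow> 'a" where
  "contraction \<Omega> x0 \<epsilon> x = x0 + (x - x0) /\<^sub>R (1 + gauge_lip \<Omega> x0 * \<epsilon>)"

definition regularize ::
    "'a::euclidean_space set \<Rightarrow> 'a \<Rightarrow> ('a \<Rightarrow> real) \<Rightarrow> ('a \<Rightarrow> real) \<Rightarrow> real \<Rightarrow> 'a measure \<Rightarrow> 'a measure" where
  "regularize \<Omega> x0 \<theta> \<rho>b \<epsilon> \<rho> =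
     (let k = rescale \<theta> \<epsilon>;
          T = contraction \<Omega> x0 \<epsilon>;
          M1 = distr (density lborel (\<lambda>x. ennreal (conv_measure k \<rho> x))) borel T;
          M2 = distr (density lborel (\<lambda>x. ennreal (conv_fun k \<rho>b x) * indicator (thicken \<Omega> \<epsilon>) x)) borel T
      in measure_of UNIV (sets borel)
           (\<lambda>A. ennreal (1 - \<epsilon>) * emeasure M1 A + ennreal \<epsilon> * emeasure M2 A))"


section \<open>Meshes\<close>

text \<open>\<^const>\<open>triangulation\<close> includes conformity: two simplices meet in a (possibly empty) common
  face.\<close>

definition mesh :: "'a::euclidean_space set \<Rightarrow> real \<Rightarrow> 'a set set \<Rightarrow> bool" where
  "mesh \<Omega> \<sigma> T \<longleftrightarrow> triangulation T \<and> (\<forall>K\<in>T. int DIM('a) simplex K) \<and> \<Union>T = \<Omega> \<and>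
     \<sigma> = Max (diameter ` T)"

definition quasi_uniform :: "real set \<Rightarrow> (real \<Rightarrow> 'a::euclidean_space set set) \<Rightarrow> bool" where
  "quasi_uniform S \<T> \<longleftrightarrow>
     (\<exists>c>0. \<forall>\<sigma>\<in>S. \<forall>K\<in>\<T> \<sigma>. \<exists>x r. c * \<sigma> \<le> 2 * r \<and> ball x r \<subseteq> K)"

definition vertices_of :: "'a::euclidean_space set \<Rightarrow> 'a set" where
  "vertices_of K = {v. v extreme_point_of K}"

definition vertices :: "'a::euclidean_space set set \<Rightarrow> 'a set" where
  "vertices T = (\<Union>K\<in>T. vertices_of K)"

text \<open>The nodal functions are extended by zero off the triangulated domain.\<close>

definition nodal :: "'a::euclidean_space set set \<Rightarrow> 'a \<Rightarrow> 'a \<Rightarrow> real" where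
  "nodal T v = (THE f. continuous_on (\<Union>T) f \<and> (\<forall>K\<in>T. \<exists>a g. \<forall>x\<in>K. f x = a + g \<bullet> x) \<and>
     (\<forall>w\<in>vertices T. f w = (if w = v then 1 else 0)) \<and> (\<forall>x. x \<notin> \<Union>T \<longrightarrow> f x = 0))"

definition grad :: "('a::euclidean_space \<Rightarrow> real) \<Rightarrow> 'a \<Rightarrow> 'a" where
  "grad f x = (THE g. GDERIV f x :> g)"

definition patch_vol :: "'a::euclidean_space set set \<Rightarrow> 'a \<Rightarrow> real" where
  "patch_vol T v = integral (\<Union>T) (nodal T v)"


section \<open>Discrete scheme\<close>

definition X_space :: "'a::euclidean_space set set \<Rightarrow> ('a \<Rightarrow> real) set" where
  "X_space T = vertices T \<rightarrow>\<^sub>E UNIV"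

definition X_pos :: "'a::euclidean_space set set \<Rightarrow> ('a \<Rightarrow> real) set" where
  "X_pos T = {\<rho> \<in> X_space T. \<forall>v\<in>vertices T. 0 \<le> \<rho> v}"

definition Y_space :: "'a::euclidean_space set set \<Rightarrow> ('a set \<Rightarrow> 'a) set" where
  "Y_space T = T \<rightarrow>\<^sub>E UNIV"

definition sample :: "'a::euclidean_space set set \<Rightarrow> 'a measure \<Rightarrow> 'a \<Rightarrow> real" where
  "sample T \<rho> = (\<lambda>v\<in>vertices T. (LINT x:(\<Union>T)|\<rho>. nodal T v x) / patch_vol T v)"

text \<open>The gradient of a nodal function is undefined on the boundaries of the simplices; these are
  negligible for the (Henstock-Kurzweil) integral.\<close>

definition disc_div :: "'a::euclidean_space set set \<Rightarrow> ('a set \<Rightarrow> 'a) \<Rightarrow> 'a \<Rightarrow> real" where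
  "disc_div T q = (THE d. d \<in> X_space T \<and> (\<forall>a\<in>X_space T.
     (\<Sum>v\<in>vertices T. patch_vol T v * a v * d v) =
     - (\<Sum>K\<in>T. \<Sum>v\<in>vertices_of K. a v * (q K \<bullet> integral K (grad (nodal T v))))))"

definition dagger_sq :: "real \<Rightarrow> 'v::real_normed_vector \<Rightarrow> ennreal" where
  "dagger_sq a b = (if a > 0 then ennreal ((norm b)\<^sup>2 / a) else if a = 0 \<and> b = 0 then 0 else \<infinity>)"

definition J_disc ::
    "'a::euclidean_space set set \<Rightarrow> ('a \<Rightarrow> real) \<Rightarrow> ('a set \<Rightarrow> 'a) \<Rightarrow> ('a \<Rightarrow> real) \<Rightarrow> ennreal" where
  "J_disc T \<rho> q r =
     ennreal (1/2) * (\<Sum>K\<in>T. ennreal (measure lborel K) *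
       dagger_sq (1 / (real DIM('a) + 1) * (\<Sum>v\<in>vertices_of K. \<rho> v)) (q K)) +
     ennreal (1/2) * (\<Sum>v\<in>vertices T. ennreal (patch_vol T v) * dagger_sq (\<rho> v) (r v))"

text \<open>The time step is \<open>\<tau> = 1 / N\<close>.\<close>

definition CE_disc ::
    "nat \<Rightarrow> 'a::euclidean_space set set \<Rightarrow> ('a \<Rightarrow> real) \<Rightarrow> ('a \<Rightarrow> real) \<Rightarrow>
     ((nat \<Rightarrow> 'a \<Rightarrow> real) \<times> (nat \<Rightarrow> 'a set \<Rightarrow> 'a) \<times> (nat \<Rightarrow> 'a \<Rightarrow> real)) set" where
  "CE_disc N T A B = {(\<rho>, q, r).
     \<rho> \<in> {0..N} \<rightarrow>\<^sub>E X_pos T \<and> q \<in> {1..N} \<rightarrow>\<^sub>E Y_space T \<and> r \<in> {1..N} \<rightarrow>\<^sub>E X_space T \<and>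
     (\<forall>j\<in>{1..N}. \<forall>v\<in>vertices T.
        (\<rho> j v - \<rho> (j - 1) v) / (1 / real N) = - disc_div T (q j) v + r j v) \<and>
     \<rho> 0 = A \<and> \<rho> N = B}"

fun J_time ::
    "nat \<Rightarrow> 'a::euclidean_space set set \<Rightarrow>
     (nat \<Rightarrow> 'a \<Rightarrow> real) \<times> (nat \<Rightarrow> 'a set \<Rightarrow> 'a) \<times> (nat \<Rightarrow> 'a \<Rightarrow> real) \<Rightarrow> ennreal" where
  "J_time N T (\<rho>, q, r) =
     ennreal (1 / real N) * (\<Sum>j\<in>{1..N}. J_disc T (\<lambda>v. (\<rho> (j - 1) v + \<rho> j v) / 2) (q j) (r j))"

end

theory Submission
  imports Defs
begin

text \<open>
  Both estimates rest on one coupling of \<open>\<rho>\<close> with a measure close to it. Let \<open>T\<close> be the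
  contraction \<open>T\<^sup>\<epsilon>\<close> and \<open>k\<close> the rescaled kernel. The image \<open>\<gamma>\<close> of \<open>k(x - y) \<rho>(dy) dx\<close> under \<open>(y, x) \<mapsto> (y, T x)\<close> has marginals \<open>\<rho>\<close> and \<open>\<rho>' = T\<^sub>#(k * \<rho>)\<close>,
  and it is concentrated on pairs with \<open>|y' - y| \<le> C \<epsilon>\<close>. As the gauge of \<open>\<Omega>\<close> is Lipschitz, the
  segment from \<open>y\<close> to \<open>y'\<close> stays in \<open>\<Omega>\<close> (\<open>contraction_segment\<close>). The regularized measure is
  \<open>(1 - \<epsilon>) \<rho>' + \<epsilon> \<nu>\<close> with \<open>\<nu>\<close> of bounded mass (\<open>regularize_coupling\<close>).

  For the Wasserstein-Fisher-Rao distance, every pair carries its mass along its segment, at a cost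
  of order \<open>\<epsilon>\<^sup>2\<close>. At the same time the moving mass is reduced by the factor \<open>1 - \<epsilon> t\<^sup>2\<close> and the mass
  \<open>\<epsilon> t\<^sup>2\<close> of \<open>\<nu>\<close> is created. Creating mass with a quadratic profile costs
  \<open>(2 \<epsilon> t)\<^sup>2 / (\<epsilon> t\<^sup>2) = 4 \<epsilon>\<close> per unit mass of \<open>\<nu>\<close>, up to constants, so the total action is \<open>O(\<epsilon>)\<close>
  (\<open>WFR_sq_le_of_coupling\<close>).

  In the discrete problem, momentum and density have to be compared at the nodes and only at the
  given times, however coarse. This is achieved by fluxes that do not depend on time. Let \<open>M\<close> be the
  sampled time average of the interpolation along the segments. The difference of \<open>M\<close> to either end
  point is a discrete divergence of a flux \<open>q\<close> with \<open>|q| \<le> C \<epsilon> M\<close> on each simplex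
  (\<open>discrete_fluxes_of_coupling\<close>); here quasi-uniformity enters. The path moves linearly from the
  initial sample to \<open>M\<close>, increased by an \<open>O(\<epsilon>)\<close> amount that dominates the growth terms, and from there
  to the final sample. With quadratic weights the squared speed is at most a constant times the
  fraction of \<open>M\<close> present at the same step. Hence the cost of every step is \<open>O(\<epsilon>)\<close>, whatever the
  number of steps (\<open>discrete_path_from_fluxes\<close>). The path thus obeys the bound \<open>C \<epsilon>\<close>, which is
  stronger than \<open>C (\<epsilon> + \<sigma>)\<close>.
\<close>

section \<open>Sums and densities of measures\<close>

text \<open>The combination \<open>a M + b N\<close> of two Borel measures, in the form in which
  \<^const>\<open>regularize\<close> is defined.\<close>

definition mix_measure :: "ennreal \<Rightarrow> 'b::euclidean_space measure \<Rightarrow> ennreal \<Rightarrow> 'b measure \<Rightarrow> 'b measure" where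
  "mix_measure a M b N =
     measure_of UNIV (sets borel) (\<lambda>A. a * emeasure M A + b * emeasure N A)"

lemma sets_mix_measure [simp]: "sets (mix_measure a M b N) = sets borel"
  and space_mix_measure [simp]: "space (mix_measure a M b N) = UNIV"
  unfolding mix_measure_def
  using sets.sigma_sets_eq[of "borel :: 'a measure"] by (simp_all add: sets_measure_of_conv space_measure_of_conv)

lemma emeasure_mix_measure:
  assumes "sets M = sets borel" "sets N = sets borel" "A \<in> sets borel"
  shows "emeasure (mix_measure a M b N) A = a * emeasure M A + b * emeasure N A"
  unfolding mix_measure_def
proof (rule emeasure_measure_of_sigma)
  show "sigma_algebra UNIV (sets (borel :: 'a measure))"
    using sets.sigma_algebra_axioms[of "borel :: 'a measure"] by simp
  show "positive (sets borel) (\<lambda>A. a * emeasure M A + b * emeasure N A)"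
    by (simp add: positive_def)
  show "countably_additive (sets borel) (\<lambda>A. a * emeasure M A + b * emeasure N A)"
  proof (rule countably_additiveI)
    fix F :: "nat \<Rightarrow> 'a set"
    assume F: "range F \<subseteq> sets borel" "disjoint_family F" "\<Union>(range F) \<in> sets borel"
    have "(\<Sum>i. a * emeasure M (F i) + b * emeasure N (F i)) =
        a * (\<Sum>i. emeasure M (F i)) + b * (\<Sum>i. emeasure N (F i))"
      by (simp flip: suminf_add ennreal_suminf_cmult)
    also have "\<dots> = a * emeasure M (\<Union>(range F)) + b * emeasure N (\<Union>(range F))"
      using F assms by (simp add: suminf_emeasure)
    finally show "(\<Sum>i. a * emeasure M (F i) + b * emeasure N (F i)) =
        a * emeasure M (\<Union>(range F)) + b * emeasure N (\<Union>(range F))" .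
  qed
qed (use assms in auto)

lemma nn_integral_mix_measure:
  assumes [measurable_cong]: "sets M = sets borel" "sets N = sets borel"
    and f: "f \<in> borel_measurable borel"
  shows "(\<integral>\<^sup>+x. f x \<partial>mix_measure a M b N) = a * (\<integral>\<^sup>+x. f x \<partial>M) + b * (\<integral>\<^sup>+x. f x \<partial>N)"
  using f
proof (induction rule: borel_measurable_induct)
  case (cong f g)
  then show ?case by (metis (no_types, lifting) UNIV_I ext space_borel)
next
  case (set A)
  then show ?case by (simp add: nn_integral_indicator emeasure_mix_measure assms)
next
  case (mult u c)
  have [measurable]: "u \<in> borel_measurable (mix_measure a M b N)"
    using mult(2) by (simp cong: measurable_cong_sets)
  show ?case using mult by (simp add: nn_integral_cmult distrib_left mult.left_commute)
next
  case (add u v)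
  have [measurable]: "u \<in> borel_measurable (mix_measure a M b N)"
    "v \<in> borel_measurable (mix_measure a M b N)"
    using add by (simp_all cong: measurable_cong_sets)
  show ?case using add by (simp add: nn_integral_add distrib_left ac_simps)
next
  case (seq U)
  have [measurable]: "U i \<in> borel_measurable (mix_measure a M b N)" for i
    using seq(1) by (simp cong: measurable_cong_sets)
  have [measurable]: "U i \<in> borel_measurable M" "U i \<in> borel_measurable N" for i
    using seq(1) assms by (simp_all cong: measurable_cong_sets)
  have inc: "incseq (\<lambda>i. \<integral>\<^sup>+x. U i x \<partial>M)" "incseq (\<lambda>i. \<integral>\<^sup>+x. U i x \<partial>N)"
    using \<open>incseq U\<close> by (auto simp: mono_def le_fun_def intro!: nn_integral_mono)
  have "(\<integral>\<^sup>+x. (SUP i. U i x) \<partial>mix_measure a M b N) = (SUP i. \<integral>\<^sup>+x. U i x \<partial>mix_measure a M b N)"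
    using \<open>incseq U\<close> by (intro nn_integral_monotone_convergence_SUP) auto
  also have "\<dots> = (SUP i. a * (\<integral>\<^sup>+x. U i x \<partial>M) + b * (\<integral>\<^sup>+x. U i x \<partial>N))"
    using seq by simp
  also have "\<dots> = (SUP i. a * (\<integral>\<^sup>+x. U i x \<partial>M)) + (SUP i. b * (\<integral>\<^sup>+x. U i x \<partial>N))"
    using inc by (intro ennreal_SUP_add) (auto simp: mono_def mult_left_mono)
  also have "\<dots> = a * (\<integral>\<^sup>+x. (SUP i. U i x) \<partial>M) + b * (\<integral>\<^sup>+x. (SUP i. U i x) \<partial>N)"
    using \<open>incseq U\<close> by (simp add: nn_integral_monotone_convergence_SUP SUP_mult_left_ennreal)
  finally show ?case by (simp add: image_comp SUP_apply)
qed

lemma integrable_bounded_finite: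
  fixes f :: "'l \<Rightarrow> 'v::{banach, second_countable_topology}"
  assumes "emeasure M (space M) < \<infinity>" "f \<in> borel_measurable M" "\<And>x. x \<in> space M \<Longrightarrow> norm (f x) \<le> C"
  shows "integrable M f"
proof -
  interpret finite_measure M using assms(1) by (intro finite_measureI) auto
  show ?thesis using assms by (intro integrable_const_bound[where B = C] AE_I2) auto
qed

lemma integral_mix_measure:
  fixes f :: "'b::euclidean_space \<Rightarrow> real"
  assumes [measurable_cong]: "sets M = sets borel" "sets N = sets borel"
    and fin: "emeasure M UNIV < \<infinity>" "emeasure N UNIV < \<infinity>" and ab: "0 \<le> a" "0 \<le> b"
    and f[measurable]: "f \<in> borel_measurable borel" and bd: "\<And>x. \<bar>f x\<bar> \<le> C"
  shows "(LINT x|mix_measure (ennreal a) M (ennreal b) N. f x) = a * (LINT x|M. f x) + b * (LINT x|N. f x)"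
proof -
  let ?X = "mix_measure (ennreal a) M (ennreal b) N"
  have sp: "space M = UNIV" "space N = UNIV" using assms(1,2) by (metis sets_eq_imp_space_eq space_borel)+
  have finX: "emeasure ?X UNIV < \<infinity>"
    using fin by (simp add: emeasure_mix_measure assms(1,2) ennreal_mult_less_top)
  have nonneg: "(LINT x|?X. g x) = a * (LINT x|M. g x) + b * (LINT x|N. g x)"
    if g[measurable]: "g \<in> borel_measurable borel" and pos: "\<And>x. 0 \<le> g x" and bd: "\<And>x. g x \<le> K"
    for g :: "'b \<Rightarrow> real" and K
  proof -
    have [measurable]: "g \<in> borel_measurable ?X" using g by (simp cong: measurable_cong_sets)
    have I: "integrable M g" "integrable N g" "integrable ?X g"
      using pos bd fin finX sp by (auto intro!: integrable_bounded_finite[where C = K])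
    have "ennreal (LINT x|?X. g x) = (\<integral>\<^sup>+x. g x \<partial>?X)"
      using I pos by (simp add: nn_integral_eq_integral)
    also have "\<dots> = ennreal a * (\<integral>\<^sup>+x. g x \<partial>M) + ennreal b * (\<integral>\<^sup>+x. g x \<partial>N)"
      by (subst nn_integral_mix_measure) (auto simp: assms(1,2))
    also have "\<dots> = ennreal (a * (LINT x|M. g x) + b * (LINT x|N. g x))"
      using I pos ab by (simp add: nn_integral_eq_integral ennreal_mult' ennreal_plus)
    finally show ?thesis using I pos ab
      by (subst (asm) ennreal_inj) (auto intro!: add_nonneg_nonneg mult_nonneg_nonneg integral_nonneg)
  qed
  have fX[measurable]: "f \<in> borel_measurable ?X" using f by (simp cong: measurable_cong_sets)
  have I: "integrable M f" "integrable N f" "integrable ?X f"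
    and IC: "integrable M (\<lambda>x. C)" "integrable N (\<lambda>x. C)" "integrable ?X (\<lambda>x. C)"
    using order.trans[OF bd abs_ge_self] fin finX sp by (auto intro!: integrable_bounded_finite[where C = "\<bar>C\<bar>"])
  have C: "0 \<le> C" using bd[of 0] by linarith
  have "(LINT x|?X. f x + C) = a * (LINT x|M. f x + C) + b * (LINT x|N. f x + C)"
  proof (rule nonneg[where K = "2 * C"])
    fix x show "0 \<le> f x + C" "f x + C \<le> 2 * C" using bd[of x] by linarith+
  qed measurable
  moreover have "(LINT x|?X. C) = a * (LINT x|M. C) + b * (LINT x|N. C)"
    by (rule nonneg[where K = C]) (use C in auto)
  moreover have "(LINT x|?X. f x + C) = (LINT x|?X. f x) + (LINT x|?X. C)"
     "(LINT x|M. f x + C) = (LINT x|M. f x) + (LINT x|M. C)"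
     "(LINT x|N. f x + C) = (LINT x|N. f x) + (LINT x|N. C)"
    using I IC by (auto intro: Bochner_Integration.integral_add)
  ultimately show ?thesis by (simp add: algebra_simps)
qed

text \<open>A Radon-Nikodym density of a measure that is bounded by \<open>c\<close> times another one can be chosen
  with values in \<open>[0, c]\<close> everywhere.\<close>

lemma dominated_density:
  fixes D N :: "'b::euclidean_space measure"
  assumes sD: "sets D = sets borel" and sN: "sets N = sets borel"
    and fin: "emeasure D UNIV < \<infinity>" and c: "0 \<le> c"
    and le: "\<And>A. A \<in> sets borel \<Longrightarrow> emeasure N A \<le> ennreal c * emeasure D A"
  obtains f :: "'b \<Rightarrow> real" where "f \<in> borel_measurable borel" "\<And>z. 0 \<le> f z" "\<And>z. f z \<le> c"
    "N = density D (\<lambda>z. ennreal (f z))"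
proof -
  have spD: "space D = UNIV" using sD by (metis sets_eq_imp_space_eq space_borel)
  interpret D: finite_measure D using fin spD by (intro finite_measureI) auto
  have "absolutely_continuous D N"
    unfolding absolutely_continuous_def
  proof
    fix A assume "A \<in> null_sets D"
    then have A: "A \<in> sets borel" "emeasure D A = 0" by (auto simp: sD)
    with le[of A] show "A \<in> null_sets N" by (auto simp: sN)
  qed
  then obtain f where f[measurable]: "f \<in> borel_measurable D" and fN: "density D f = N"
    using D.Radon_Nikodym[of N] by (auto simp: sN sD)
  define A where "A = {z \<in> space D. \<not> f z \<le> ennreal c}"
  have A[measurable]: "A \<in> sets D" unfolding A_def by measurable
  have A': "A \<in> sets borel" using A sD by simp
  have "(\<integral>\<^sup>+z. ennreal c * indicator A z \<partial>D) + (\<integral>\<^sup>+z. (f z - ennreal c) * indicator A z \<partial>D)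
      = (\<integral>\<^sup>+z. f z * indicator A z \<partial>D)"
    by (subst nn_integral_add[symmetric])
       (auto intro!: nn_integral_cong simp: A_def add_diff_eq_ennreal add_diff_inverse_ennreal split: split_indicator)
  also have "\<dots> = emeasure N A" by (simp flip: fN add: emeasure_density)
  also have "\<dots> \<le> (\<integral>\<^sup>+z. ennreal c * indicator A z \<partial>D)"
    using le[OF A'] by (simp add: nn_integral_cmult)
  finally have "(\<integral>\<^sup>+z. (f z - ennreal c) * indicator A z \<partial>D) \<le> 0"
    using ennreal_add_left_cancel_le[of "\<integral>\<^sup>+z. ennreal c * indicator A z \<partial>D" _ 0] D.emeasure_finite[of A]
    by (auto simp: nn_integral_cmult ennreal_mult_eq_top_iff)
  then have "AE z in D. (f z - ennreal c) * indicator A z = 0"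
    by (subst (asm) le_zero_eq, subst (asm) nn_integral_0_iff_AE) auto
  then have AEf: "AE z in D. f z \<le> ennreal c"
    by eventually_elim (auto simp: A_def spD indicator_def diff_eq_0_iff_ennreal split: if_splits)
  define h where "h z = min c (enn2real (f z))" for z
  have fb[measurable]: "f \<in> borel_measurable borel" using f sD by (simp cong: measurable_cong_sets)
  have h[measurable]: "h \<in> borel_measurable borel" unfolding h_def by measurable
  have "AE z in D. f z = ennreal (h z)"
    using AEf
  proof eventually_elim
    case (elim z)
    have "f z < top" using elim by (rule le_less_trans) simp
    then have "ennreal (enn2real (f z)) = f z" by simp
    moreover have "enn2real (f z) \<le> c" using elim c by (auto intro: enn2real_leI)
    ultimately show ?case by (simp add: h_def)
  qed
  then have "N = density D (\<lambda>z. ennreal (h z))"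
    unfolding fN[symmetric] using h sD by (intro density_cong) (auto cong: measurable_cong_sets)
  moreover have "0 \<le> h z" "h z \<le> c" for z using c by (auto simp: h_def)
  ultimately show ?thesis using that[of h] h by blast
qed

text \<open>The conditional expectation of a bounded \<open>w\<close> given \<open>Z\<close>: the signed measure \<open>Z\<^sub># (w P)\<close> has a
  density with respect to \<open>Z\<^sub># P\<close> that obeys the same bound as \<open>w\<close>.\<close>

lemma bounded_pushforward_density:
  fixes Z :: "'l \<Rightarrow> 'b::euclidean_space" and w :: "'l \<Rightarrow> real"
  assumes fin: "emeasure P (space P) < \<infinity>"
    and Z[measurable]: "Z \<in> borel_measurable P" and w[measurable]: "w \<in> borel_measurable P"
    and bd: "\<And>l. \<bar>w l\<bar> \<le> B"
  obtains h :: "'b \<Rightarrow> real" where "h \<in> borel_measurable borel" "\<And>z. \<bar>h z\<bar> \<le> B"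
    "\<forall>f C. f \<in> borel_measurable borel \<longrightarrow> (\<forall>z. \<bar>f z\<bar> \<le> C) \<longrightarrow>
       (LINT l|P. f (Z l) * w l) = (LINT z|distr P borel Z. f z * h z)"
proof -
  interpret P: finite_measure P using fin by (intro finite_measureI) auto
  define D where "D = distr P borel Z"
  interpret D: finite_measure D unfolding D_def by (rule P.finite_measure_distr) measurable
  \<comment> \<open>Shifting by \<open>B\<close> turns \<open>w\<close> into a nonnegative weight.\<close>
  define N where "N = distr (density P (\<lambda>l. ennreal (w l + B))) borel Z"
  have B: "0 \<le> B" and wB: "0 \<le> w l + B" "w l + B \<le> 2 * B" for l
    using bd[of l] by linarith+
  have le: "emeasure N A \<le> ennreal (2 * B) * emeasure D A" if [measurable]: "A \<in> sets borel" for A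
  proof -
    have "emeasure N A = (\<integral>\<^sup>+l. ennreal (w l + B) * indicator A (Z l) \<partial>P)"
      unfolding N_def by (subst emeasure_distr) (auto simp: emeasure_density intro!: nn_integral_cong split: split_indicator)
    also have "\<dots> \<le> (\<integral>\<^sup>+l. ennreal (2 * B) * indicator A (Z l) \<partial>P)"
      using wB by (intro nn_integral_mono mult_right_mono ennreal_leI) auto
    also have "\<dots> = ennreal (2 * B) * (\<integral>\<^sup>+l. indicator (Z -` A \<inter> space P) l \<partial>P)"
      by (subst nn_integral_cmult[symmetric]) (auto intro!: nn_integral_cong split: split_indicator)
    also have "\<dots> = ennreal (2 * B) * emeasure D A"
      unfolding D_def by (simp add: emeasure_distr)
    finally show ?thesis .
  qed
  obtain f where f[measurable]: "f \<in> borel_measurable borel" and f0: "\<And>z. 0 \<le> f z" and fB: "\<And>z. f z \<le> 2 * B"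
    and fN: "N = density D (\<lambda>z. ennreal (f z))"
    using dominated_density[of D N "2 * B"] le B D.emeasure_finite[of UNIV]
    by (auto simp: N_def D_def top.not_eq_extremum)
  define h where "h z = f z - B" for z
  have h[measurable]: "h \<in> borel_measurable borel" unfolding h_def by measurable
  have hB: "\<bar>h z\<bar> \<le> B" for z using f0[of z] fB[of z] by (auto simp: h_def)
  show ?thesis
  proof (rule that[of h], goal_cases)
    case 1 show ?case by (rule h)
  next
    case (2 z) show ?case by (rule hB)
  next
    case 3 show ?case
    proof (intro allI impI)
      fix g :: "'b \<Rightarrow> real" and C
      assume g[measurable]: "g \<in> borel_measurable borel" and gC': "\<forall>z. \<bar>g z\<bar> \<le> C"
      have gC: "\<bar>g z\<bar> \<le> C" for z using gC' by blast
      have C: "0 \<le> C" using gC[of 0] by linarith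
      have "(LINT z|N. g z) = (LINT l|P. (w l + B) * g (Z l))"
        unfolding N_def using wB by (subst integral_distr) (auto simp: integral_density)
      moreover have "(LINT z|N. g z) = (LINT z|D. (h z + B) * g z)"
        unfolding fN using f0 by (subst integral_density) (auto simp: D_def h_def)
      moreover have "(LINT l|P. (w l + B) * g (Z l)) = (LINT l|P. g (Z l) * w l) + B * (LINT l|P. g (Z l))"
      proof -
        have "integrable P (\<lambda>l. g (Z l) * w l)"
          using gC bd C B fin by (intro integrable_bounded_finite[where C = "C * B"]) (auto intro!: mult_mono simp: abs_mult)
        moreover have "integrable P (\<lambda>l. g (Z l))"
          using gC fin by (intro integrable_bounded_finite[where C = C]) auto
        ultimately show ?thesis
          by (subst integral_mult_right_zero[symmetric], subst Bochner_Integration.integral_add[symmetric]) (auto simp: algebra_simps)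
      qed
      moreover have "(LINT z|D. (h z + B) * g z) = (LINT z|D. g z * h z) + B * (LINT z|D. g z)"
      proof -
        have "integrable D (\<lambda>z. g z * h z)"
          using gC hB C B D.emeasure_finite by (intro integrable_bounded_finite[where C = "C * B"])
            (auto intro!: mult_mono simp: abs_mult top.not_eq_extremum D_def)
        moreover have "integrable D g"
          using gC D.emeasure_finite by (intro integrable_bounded_finite[where C = C]) (auto simp: top.not_eq_extremum D_def)
        ultimately show ?thesis
          by (subst integral_mult_right_zero[symmetric], subst Bochner_Integration.integral_add[symmetric]) (auto simp: algebra_simps)
      qed
      moreover have "(LINT z|D. g z) = (LINT l|P. g (Z l))"
        unfolding D_def by (subst integral_distr) auto
      ultimately show "(LINT l|P. g (Z l) * w l) = (LINT z|distr P borel Z. g z * h z)"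
        by (simp add: D_def)
    qed
  qed
qed

text \<open>The same for vector-valued \<open>w\<close>, component by component, which enlarges the bound by the dimension.\<close>

lemma bounded_vector_pushforward_density:
  fixes Z :: "'l \<Rightarrow> 'b::euclidean_space" and w :: "'l \<Rightarrow> 'a::euclidean_space" and B :: real
  assumes fin: "emeasure P (space P) < \<infinity>"
    and Z[measurable]: "Z \<in> borel_measurable P" and w[measurable]: "w \<in> borel_measurable P"
    and bd: "\<And>l. norm (w l) \<le> B"
  obtains V :: "'b \<Rightarrow> 'a" where "V \<in> borel_measurable borel" "\<And>z. norm (V z) \<le> DIM('a) * B"
    "\<forall>F C. F \<in> borel_measurable borel \<longrightarrow> (\<forall>z. norm (F z) \<le> C) \<longrightarrow>
       (LINT l|P. F (Z l) \<bullet> w l) = (LINT z|distr P borel Z. F z \<bullet> V z)"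
proof -
  let ?D = "distr P borel Z"
  let ?P = "\<lambda>i (h :: 'b \<Rightarrow> real). h \<in> borel_measurable borel \<and> (\<forall>z. \<bar>h z\<bar> \<le> B) \<and>
    (\<forall>f C. f \<in> borel_measurable borel \<longrightarrow> (\<forall>z. \<bar>f z\<bar> \<le> C) \<longrightarrow>
      (LINT l|P. f (Z l) * (w l \<bullet> i)) = (LINT z|?D. f z * h z))"
  have "\<forall>i\<in>Basis. \<exists>h. ?P i h"
  proof
    fix i :: 'a assume i: "i \<in> Basis"
    have wb: "\<bar>w l \<bullet> i\<bar> \<le> B" for l using Basis_le_norm[OF i, of "w l"] bd[of l] by simp
    have wm: "(\<lambda>l. w l \<bullet> i) \<in> borel_measurable P"
      by (rule borel_measurable_inner[OF w borel_measurable_const])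
    show "\<exists>h. ?P i h"
      by (rule bounded_pushforward_density[OF fin Z wm wb]) blast
  qed
  from bchoice[OF this] obtain u where u: "\<forall>i\<in>Basis. ?P i (u i)" ..
  have um: "u i \<in> borel_measurable borel" and ub: "\<bar>u i z\<bar> \<le> B"
    and uI: "f \<in> borel_measurable borel \<Longrightarrow> (\<forall>z. \<bar>f z\<bar> \<le> C) \<Longrightarrow>
      (LINT l|P. f (Z l) * (w l \<bullet> i)) = (LINT z|?D. f z * u i z)" if "i \<in> Basis" for i z f C
    using bspec[OF u that] by blast+
  have "emeasure ?D (space ?D) = emeasure P (space P)" by (simp add: emeasure_distr)
  with fin have finD: "emeasure ?D (space ?D) < \<infinity>" by simp
  define V where "V z = (\<Sum>i\<in>Basis. u i z *\<^sub>R i)" for z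
  have Vm: "V \<in> borel_measurable borel"
    unfolding V_def using um by (intro borel_measurable_sum borel_measurable_scaleR) auto
  have Vb: "norm (V z) \<le> DIM('a) * B" for z
    unfolding V_def by (rule sum_norm_bound) (use ub in auto)
  have "(LINT l|P. F (Z l) \<bullet> w l) = (LINT z|?D. F z \<bullet> V z)"
    if Fm[measurable]: "F \<in> borel_measurable borel" and FC: "\<And>z. norm (F z) \<le> C" for F :: "'b \<Rightarrow> 'a" and C
  proof -
    have B0: "0 \<le> B" and C0: "0 \<le> C" using bd order.trans[OF norm_ge_zero] FC by blast+
    have Fb: "\<bar>F z \<bullet> i\<bar> \<le> C" if "i \<in> Basis" for z i
      using Basis_le_norm[OF that, of "F z"] FC[of z] by simp
    have wb: "\<bar>w l \<bullet> i\<bar> \<le> B" if "i \<in> Basis" for l i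
      using Basis_le_norm[OF that, of "w l"] bd[of l] by simp
    have iP: "integrable P (\<lambda>l. (F (Z l) \<bullet> i) * (w l \<bullet> i))" if "i \<in> Basis" for i
      by (rule integrable_bounded_finite[where C = "C * B", OF fin])
         (use Fb[OF that] wb[OF that] C0 in \<open>auto simp: abs_mult intro!: mult_mono\<close>)
    have iD: "integrable ?D (\<lambda>z. (F z \<bullet> i) * u i z)" if i: "i \<in> Basis" for i
      by (rule integrable_bounded_finite[where C = "C * B", OF finD])
         (use Fb[OF i] ub[OF i] um[OF i] C0 in \<open>auto simp: abs_mult intro!: mult_mono\<close>)
    have "(LINT l|P. F (Z l) \<bullet> w l) = (\<Sum>i\<in>Basis. LINT l|P. (F (Z l) \<bullet> i) * (w l \<bullet> i))"
      using iP by (simp add: euclidean_inner[of "F _" "w _"])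
    also have "\<dots> = (\<Sum>i\<in>Basis. LINT z|?D. (F z \<bullet> i) * u i z)"
    proof (rule sum.cong)
      fix i :: 'a assume i: "i \<in> Basis"
      have "(\<lambda>z. F z \<bullet> i) \<in> borel_measurable borel" by measurable
      then show "(LINT l|P. (F (Z l) \<bullet> i) * (w l \<bullet> i)) = (LINT z|?D. (F z \<bullet> i) * u i z)"
        by (rule uI[OF i, where C = C]) (use Fb[OF i] in blast)
    qed simp
    also have "\<dots> = (LINT z|?D. F z \<bullet> V z)"
      using iD by (simp add: V_def inner_sum_right mult.commute)
    finally show ?thesis .
  qed
  then show ?thesis by (intro that[OF Vm Vb]) blast
qed

section \<open>Curves of measures built from couplings\<close>

text \<open>A transport plan whose pairs are joined by segments of length at most \<open>\<delta>\<close> inside \<open>\<Omega>\<close>.\<close>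

definition displacement_plan :: "'a::euclidean_space set \<Rightarrow> real \<Rightarrow> ('a \<times> 'a) measure \<Rightarrow> bool" where
  "displacement_plan \<Omega> \<delta> \<gamma> \<longleftrightarrow> sets \<gamma> = sets borel \<and> emeasure \<gamma> UNIV < \<infinity> \<and>
     (AE p in \<gamma>. closed_segment (fst p) (snd p) \<subseteq> \<Omega> \<and> norm (snd p - fst p) \<le> \<delta>)"

text \<open>The first marginal of the plan \<open>\<gamma>\<close> is \<open>\<rho>0\<close>, and its second marginal \<open>\<rho>'\<close> satisfies
  \<open>\<rho>1 = (1 - \<epsilon>) \<rho>' + \<epsilon> \<nu>\<close>; both identities are tested with bounded Borel functions.\<close>

definition joins_by ::
    "('a::euclidean_space \<times> 'a) measure \<Rightarrow> 'a measure \<Rightarrow> real \<Rightarrow> 'a measure \<Rightarrow> 'a measure \<Rightarrow> bool" where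
  "joins_by \<gamma> \<nu> \<epsilon> \<rho>0 \<rho>1 \<longleftrightarrow>
     (\<forall>f B. f \<in> borel_measurable borel \<longrightarrow> (\<forall>x. \<bar>f x :: real\<bar> \<le> B) \<longrightarrow>
        (LINT x|\<rho>0. f x) = (LINT p|\<gamma>. f (fst p)) \<and>
        (LINT x|\<rho>1. f x) = (1 - \<epsilon>) * (LINT p|\<gamma>. f (snd p)) + \<epsilon> * (LINT x|\<nu>. f x))"

text \<open>The action density of the curve that carries mass \<open>1 - \<epsilon> s\<^sup>2\<close> of a moving population with
  density \<open>b1\<close> and mass \<open>\<epsilon> s\<^sup>2\<close> of a resting one with density \<open>b2\<close>. The growth rate of the latter is
  \<open>2 \<epsilon> s b2\<close>, and its square divided by \<open>\<epsilon> s\<^sup>2 b2\<close> is bounded uniformly in \<open>s\<close>; a linear weight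
  \<open>\<epsilon> s\<close> would produce a non-integrable \<open>1 / s\<close>.\<close>

lemma J_density_bound:
  fixes q :: "'a::euclidean_space"
  assumes b: "0 \<le> b1" "0 \<le> b2" and s: "0 \<le> s" "s \<le> 1" and e: "0 < \<epsilon>" "\<epsilon> \<le> 1/2"
    and q: "norm q \<le> (1 - \<epsilon> * s\<^sup>2) * b1 * \<beta>" and \<beta>: "0 \<le> \<beta>"
  shows "J_density ((1 - \<epsilon> * s\<^sup>2) * b1 + \<epsilon> * s\<^sup>2 * b2, q, - 2 * \<epsilon> * s * b1 + 2 * \<epsilon> * s * b2)
         \<le> ennreal (b1 * (\<beta>\<^sup>2 / 2 + 4 * \<epsilon>\<^sup>2) + b2 * (2 * \<epsilon>))"
proof -
  define a where "a = 1 - \<epsilon> * s\<^sup>2"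
  have "s\<^sup>2 \<le> 1" using s by (simp add: abs_square_le_1)
  then have "\<epsilon> * s\<^sup>2 \<le> 1/2" using mult_mono[of \<epsilon> "1/2" "s\<^sup>2" 1] e by auto
  moreover have "0 \<le> \<epsilon> * s\<^sup>2" using e by simp
  ultimately have a: "1/2 \<le> a" "a \<le> 1" by (auto simp: a_def)
  define R where "R = a * b1 + \<epsilon> * s\<^sup>2 * b2"
  define r where "r = - 2 * \<epsilon> * s * b1 + 2 * \<epsilon> * s * b2"
  define E where "E = b1 * (\<beta>\<^sup>2 / 2 + 4 * \<epsilon>\<^sup>2) + b2 * (2 * \<epsilon>)"
  have q': "norm q \<le> a * b1 * \<beta>" using q by (simp add: a_def)
  have R0: "0 \<le> R" using a b e by (simp add: R_def)
  have "J_density (R, q, r) \<le> ennreal E"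
  proof (cases "R > 0")
    case True
    have "(norm q)\<^sup>2 \<le> (a * b1 * \<beta>)\<^sup>2" using q' by (intro power_mono) auto
    also have "\<dots> = a * (a * (b1 * \<beta>)\<^sup>2)" by (simp add: power2_eq_square)
    also have "\<dots> \<le> 1 * (a * (b1 * \<beta>)\<^sup>2)" using a by (intro mult_right_mono) auto
    finally have 1: "(norm q)\<^sup>2 \<le> 2 * (a * b1) * (b1 * (\<beta>\<^sup>2 / 2))" by (simp add: power2_eq_square ac_simps)
    have "r\<^sup>2 = 4 * \<epsilon>\<^sup>2 * s\<^sup>2 * (b2 - b1)\<^sup>2" by (simp add: r_def power2_eq_square algebra_simps)
    also have "\<dots> \<le> 4 * \<epsilon>\<^sup>2 * s\<^sup>2 * (b1\<^sup>2 + b2\<^sup>2)"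
      using b by (intro mult_left_mono) (auto simp: power2_diff)
    also have "\<dots> \<le> 4 * \<epsilon>\<^sup>2 * b1\<^sup>2 + 4 * \<epsilon>\<^sup>2 * s\<^sup>2 * b2\<^sup>2"
      using \<open>s\<^sup>2 \<le> 1\<close> mult_left_mono[of "s\<^sup>2" 1 "4 * \<epsilon>\<^sup>2 * b1\<^sup>2"] by (simp add: algebra_simps)
    also have "4 * \<epsilon>\<^sup>2 * b1\<^sup>2 \<le> 8 * a * \<epsilon>\<^sup>2 * b1\<^sup>2"
      using a mult_right_mono[of "1/2" a "8 * \<epsilon>\<^sup>2 * b1\<^sup>2"] by (simp add: algebra_simps)
    finally have 2: "r\<^sup>2 \<le> 2 * (a * b1) * (b1 * (4 * \<epsilon>\<^sup>2)) + 2 * (\<epsilon> * s\<^sup>2 * b2) * (b2 * (2 * \<epsilon>))"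
      by (simp add: power2_eq_square algebra_simps)
    have "(norm q)\<^sup>2 + r\<^sup>2 \<le> 2 * (a * b1) * (b1 * (\<beta>\<^sup>2 / 2 + 4 * \<epsilon>\<^sup>2)) + 2 * (\<epsilon> * s\<^sup>2 * b2) * (b2 * (2 * \<epsilon>))"
      using 1 2 by (simp add: algebra_simps)
    also have "\<dots> \<le> 2 * (a * b1) * E + 2 * (\<epsilon> * s\<^sup>2 * b2) * E"
      using a b e by (intro add_mono mult_left_mono) (auto simp: E_def)
    also have "\<dots> = 2 * R * E" by (simp add: R_def algebra_simps)
    finally have "((norm q)\<^sup>2 + r\<^sup>2) / (2 * R) \<le> E" using True by (simp add: field_simps)
    then show ?thesis using True by (simp add: ennreal_leI)
  next
    case False
    then have "R = 0" using R0 by simp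
    moreover have "0 \<le> a * b1" "0 \<le> \<epsilon> * s\<^sup>2 * b2" using a b e by simp_all
    ultimately have z: "a * b1 = 0" "\<epsilon> * s\<^sup>2 * b2 = 0" unfolding R_def by linarith+
    then have "b1 = 0" "s = 0 \<or> b2 = 0" "q = 0" using a e q' by auto
    then have "r = 0" by (auto simp: r_def)
    then show ?thesis using \<open>R = 0\<close> \<open>q = 0\<close> by simp
  qed
  then show ?thesis by (simp only: R_def r_def E_def a_def)
qed

text \<open>Lebesgue measure on \<open>[0, 1]\<close>, extended by zero to the real line.\<close>

definition unit_time :: "real measure" where
  "unit_time = density lborel (indicator {0..1})"

lemma sets_unit_time [simp, measurable_cong]: "sets unit_time = sets borel"
  and space_unit_time [simp]: "space unit_time = UNIV"
  by (simp_all add: unit_time_def)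

lemma emeasure_unit_time [simp]: "emeasure unit_time UNIV = 1"
  by (simp add: unit_time_def emeasure_density)

lemma finite_unit_time: "finite_measure unit_time"
  by (intro finite_measureI) simp

lemma AE_unit_time: "AE t in unit_time. t \<in> {0..1}"
  unfolding unit_time_def by (subst AE_density) (auto simp: indicator_def split: if_splits)

lemma integral_unit_time:
  fixes g :: "real \<Rightarrow> real"
  assumes [measurable]: "g \<in> borel_measurable borel"
  shows "(LINT t|unit_time. g t) = (LINT t|lborel. indicator {0..1} t *\<^sub>R g t)"
proof -
  have *: "unit_time = density lborel (\<lambda>t. ennreal (indicat_real {0..1} t))"
    by (simp add: unit_time_def ennreal_indicator)
  show ?thesis by (subst *, subst integral_density) auto
qed

lemma unit_time_pair:
  fixes M :: "'b::euclidean_space measure"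
  assumes s: "sets M = sets borel"
  shows "sets (unit_time \<Otimes>\<^sub>M M) = sets borel" "space (unit_time \<Otimes>\<^sub>M M) = UNIV"
    and "emeasure M UNIV < \<infinity> \<Longrightarrow> emeasure (unit_time \<Otimes>\<^sub>M M) UNIV = emeasure M UNIV"
proof -
  have sp: "space M = UNIV" using s by (metis sets_eq_imp_space_eq space_borel)
  show "sets (unit_time \<Otimes>\<^sub>M M) = sets borel" by (metis borel_prod s sets_pair_measure_cong sets_unit_time)
  show "space (unit_time \<Otimes>\<^sub>M M) = UNIV" by (simp add: space_pair_measure sp)
  assume "emeasure M UNIV < \<infinity>"
  then interpret finite_measure M using sp by (intro finite_measureI) auto
  show "emeasure (unit_time \<Otimes>\<^sub>M M) UNIV = emeasure M UNIV"
    using emeasure_pair_measure_Times[of UNIV unit_time UNIV] by (simp add: s)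
qed

lemma AE_unit_time_pair:
  fixes M :: "'b::euclidean_space measure"
  assumes s: "sets M = sets borel" and f: "emeasure M UNIV < \<infinity>"
    and P: "{z. P z} \<in> sets borel" and AE: "AE p in M. \<forall>t\<in>{0..1}. P (t, p)"
  shows "AE z in unit_time \<Otimes>\<^sub>M M. P z"
proof -
  have "space M = UNIV" using s by (metis sets_eq_imp_space_eq space_borel)
  then interpret M: finite_measure M using f by (intro finite_measureI) auto
  interpret U: finite_measure unit_time by (rule finite_unit_time)
  interpret UM: pair_sigma_finite unit_time M ..
  show ?thesis
  proof (rule UM.AE_pair_measure)
    show "{z \<in> space (unit_time \<Otimes>\<^sub>M M). P z} \<in> sets (unit_time \<Otimes>\<^sub>M M)"
      using P unit_time_pair(1,2)[OF s] by simp
    show "AE t in unit_time. AE p in M. P (t, p)"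
      using AE_unit_time
    proof eventually_elim
      case (elim t)
      show ?case using AE by eventually_elim (use elim in auto)
    qed
  qed
qed

lemma integral_unit_time_pair:
  fixes M :: "'b::euclidean_space measure" and H :: "real \<times> 'b \<Rightarrow> real"
  assumes s: "sets M = sets borel" and f: "emeasure M UNIV < \<infinity>"
    and H: "H \<in> borel_measurable borel" and K: "\<And>z. \<bar>H z\<bar> \<le> K"
    and g: "g \<in> borel_measurable M" and eq: "AE p in M. (LINT t|unit_time. H (t, p)) = g p"
  shows "(LINT z|(unit_time \<Otimes>\<^sub>M M). H z) = (LINT p|M. g p)"
proof -
  have sp: "space M = UNIV" using s by (metis sets_eq_imp_space_eq space_borel)
  interpret U: finite_measure unit_time by (rule finite_unit_time)
  interpret M: finite_measure M using f sp by (intro finite_measureI) auto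
  interpret UM: pair_sigma_finite unit_time M ..
  note up = unit_time_pair[OF s]
  have Hm: "H \<in> borel_measurable (unit_time \<Otimes>\<^sub>M M)"
    unfolding measurable_cong_sets[OF up(1) refl] by (rule H)
  have "integrable (unit_time \<Otimes>\<^sub>M M) H"
    by (rule integrable_bounded_finite[where C = K]) (use up(2,3) f Hm K in auto)
  then have "(LINT z|(unit_time \<Otimes>\<^sub>M M). H z) = (LINT p|M. LINT t|unit_time. H (t, p))"
    using UM.integral_snd[of "\<lambda>t p. H (t, p)"] unfolding split_beta' prod.collapse by simp
  also have "\<dots> = (LINT p|M. g p)"
  proof (rule integral_cong_AE[OF _ g eq])
    show "(\<lambda>p. LINT t|unit_time. H (t, p)) \<in> borel_measurable M"
    proof (rule U.borel_measurable_lebesgue_integral)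
      have "H \<circ> (\<lambda>(x, y). (y, x)) \<in> borel_measurable (M \<Otimes>\<^sub>M unit_time)"
        by (rule measurable_comp[OF measurable_pair_swap' Hm])
      then show "(\<lambda>(p, t). H (t, p)) \<in> borel_measurable (M \<Otimes>\<^sub>M unit_time)"
        by (simp add: comp_def case_prod_beta)
    qed
  qed
  finally show ?thesis .
qed

text \<open>The point reached at time \<open>t\<close> on the segment of a pair, for the argument \<open>(t, y, y')\<close>.\<close>

definition displaced :: "real \<times> 'a \<times> 'a \<Rightarrow> 'a::euclidean_space" where
  "displaced z = fst (snd z) + fst z *\<^sub>R (snd (snd z) - fst (snd z))"

text \<open>The velocity on that segment. It is cut off where it exceeds \<open>\<delta>\<close>, which happens for a null set
  of pairs only under a displacement plan, to make it bounded everywhere.\<close>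

definition velocity :: "real \<Rightarrow> real \<times> 'a \<times> 'a \<Rightarrow> 'a::euclidean_space" where
  "velocity \<delta> z = (if norm (snd (snd z) - fst (snd z)) \<le> \<delta> then snd (snd z) - fst (snd z) else 0)"

lemma displaced_measurable: "displaced \<in> borel_measurable borel"
  unfolding displaced_def[abs_def] by (intro borel_measurable_continuous_onI continuous_intros)

lemma velocity_measurable: "velocity \<delta> \<in> borel_measurable borel"
proof -
  have [measurable]: "(\<lambda>z :: real \<times> 'a \<times> 'a. snd (snd z) - fst (snd z)) \<in> borel_measurable borel"
    by (intro borel_measurable_continuous_onI continuous_intros)
  show ?thesis unfolding velocity_def[abs_def] by measurable
qed

lemma velocity_bound: "0 \<le> \<delta> \<Longrightarrow> norm (velocity \<delta> z) \<le> \<delta>"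
  by (simp add: velocity_def)

lemma marginals_measurable:
  fixes \<gamma> :: "('a::euclidean_space \<times> 'a) measure"
  assumes "sets \<gamma> = sets borel"
  shows "fst \<in> borel_measurable \<gamma>" "snd \<in> borel_measurable \<gamma>"
  unfolding measurable_cong_sets[OF assms refl] by (intro borel_measurable_continuous_onI continuous_intros)+

lemma space_time_path_deriv:
  fixes y y' :: "'a::euclidean_space"
  assumes C1: "C1_on (space_time \<Omega>) \<phi> D" and seg: "closed_segment y y' \<subseteq> \<Omega>" and t: "t \<in> {0..1}"
  shows "((\<lambda>t. \<phi> (t, y + t *\<^sub>R (y' - y))) has_real_derivative
     (fst (D (t, y + t *\<^sub>R (y' - y))) + snd (D (t, y + t *\<^sub>R (y' - y))) \<bullet> (y' - y))) (at t within {0..1})"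
proof -
  define c where "c t = (t, y + t *\<^sub>R (y' - y))" for t :: real
  have cQ: "c ` {0..1} \<subseteq> space_time \<Omega>"
    using seg by (force simp: c_def space_time_def closed_segment_def algebra_simps)
  have dc: "(c has_derivative (\<lambda>h. (h, h *\<^sub>R (y' - y)))) (at t within {0..1})"
    unfolding c_def by (auto intro!: derivative_eq_intros)
  have "(\<phi> has_derivative (\<lambda>w. D (c t) \<bullet> w)) (at (c t) within c ` {0..1})"
  proof (rule has_derivative_subset[OF _ cQ])
    have "c t \<in> space_time \<Omega>" using t cQ by auto
    then show "(\<phi> has_derivative (\<lambda>w. D (c t) \<bullet> w)) (at (c t) within space_time \<Omega>)"
      using C1 by (simp add: C1_on_def)
  qed
  from has_derivative_in_compose[OF dc this]
  have "((\<lambda>t. \<phi> (c t)) has_derivative (\<lambda>h. D (c t) \<bullet> (h, h *\<^sub>R (y' - y)))) (at t within {0..1})" .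
  moreover have "(\<lambda>h. D (c t) \<bullet> (h, h *\<^sub>R (y' - y))) = (*) (fst (D (c t)) + snd (D (c t)) \<bullet> (y' - y))"
    by (auto simp: inner_prod_def algebra_simps)
  ultimately show ?thesis by (simp add: has_field_derivative_def c_def)
qed

lemma space_time_path_FTC:
  fixes y y' :: "'a::euclidean_space" and a a' :: "real \<Rightarrow> real"
  assumes C1: "C1_on (space_time \<Omega>) \<phi> D" and seg: "closed_segment y y' \<subseteq> \<Omega>"
    and a: "\<And>t. (a has_real_derivative a' t) (at t)" and a': "continuous_on UNIV a'"
  shows "(LINT t|lborel. indicator {0..1} t *\<^sub>R (a t * (fst (D (t, y + t *\<^sub>R (y' - y))) +
            snd (D (t, y + t *\<^sub>R (y' - y))) \<bullet> (y' - y)) + a' t * \<phi> (t, y + t *\<^sub>R (y' - y))))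
     = a 1 * \<phi> (1, y') - a 0 * \<phi> (0, y)"
proof -
  define c where "c t = (t, y + t *\<^sub>R (y' - y))" for t :: real
  define f where "f t = a t * (fst (D (c t)) + snd (D (c t)) \<bullet> (y' - y)) + a' t * \<phi> (c t)" for t
  define F where "F t = a t * \<phi> (c t)" for t
  have cQ: "c ` {0..1} \<subseteq> space_time \<Omega>"
    using seg by (force simp: c_def space_time_def closed_segment_def algebra_simps)
  have d: "((\<lambda>t. \<phi> (c t)) has_real_derivative (fst (D (c t)) + snd (D (c t)) \<bullet> (y' - y))) (at t within {0..1})"
    if "t \<in> {0..1}" for t
    using space_time_path_deriv[OF C1 seg that] by (simp add: c_def)
  have F: "(F has_vector_derivative f t) (at t within {0..1})" if "0 \<le> t" "t \<le> 1" for t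
    unfolding F_def f_def has_real_derivative_iff_has_vector_derivative[symmetric]
    using that by (auto intro!: derivative_eq_intros d DERIV_subset[OF a])
  have cc: "continuous_on {0..1} c" unfolding c_def by (intro continuous_intros)
  have cD: "continuous_on {0..1} (\<lambda>t. D (c t))"
    using C1 by (intro continuous_on_compose2[OF _ cc cQ]) (simp add: C1_on_def)
  have c\<phi>: "continuous_on {0..1} (\<lambda>t. \<phi> (c t))"
    by (rule DERIV_continuous_on) (rule d)
  have ca: "continuous_on {0..1} a"
    by (rule DERIV_continuous_on) (rule DERIV_subset[OF a], simp)
  have "continuous_on {0..1} f"
    unfolding f_def by (intro continuous_intros cD c\<phi> ca continuous_on_subset[OF a'] ) auto
  then have "(LINT t|lborel. indicator {0..1} t *\<^sub>R f t) = F 1 - F 0"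
    by (intro integral_FTC_atLeastAtMost F) auto
  then show ?thesis by (simp add: f_def F_def c_def)
qed

text \<open>The extension by zero of a continuous function on a compact set is a bounded Borel function.
  The case \<open>Q = {}\<close> is separate because the supremum over the empty set is unspecified.\<close>

lemma compact_restriction:
  fixes f :: "'b::euclidean_space \<Rightarrow> 'v::euclidean_space"
  assumes Q: "compact Q" and f: "continuous_on Q f"
  shows "(\<lambda>z. indicator Q z *\<^sub>R f z) \<in> borel_measurable borel"
    and "norm (indicator Q z *\<^sub>R f z) \<le> (SUP x\<in>Q. norm (f x)) \<or> Q = {}"
    and "\<exists>C. \<forall>z. norm (indicator Q z *\<^sub>R f z) \<le> C"
proof -
  show "(\<lambda>z. indicator Q z *\<^sub>R f z) \<in> borel_measurable borel"
    using assms by (intro borel_measurable_continuous_on_indicator) (auto intro: borel_closed compact_imp_closed)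
  have "compact ((\<lambda>x. norm (f x)) ` Q)" by (intro compact_continuous_image continuous_intros assms)
  then have bd: "bdd_above ((\<lambda>x. norm (f x)) ` Q)" by (intro bounded_imp_bdd_above compact_imp_bounded)
  then have 1: "norm (indicator Q z *\<^sub>R f z) \<le> (SUP x\<in>Q. norm (f x))" if "Q \<noteq> {}" for z
  proof -
    obtain x where "x \<in> Q" using \<open>Q \<noteq> {}\<close> by auto
    then have "0 \<le> (SUP x\<in>Q. norm (f x))" using cSUP_upper[OF _ bd, of x] norm_ge_zero[of "f x"] by linarith
    then show ?thesis using cSUP_upper[OF _ bd, of z] by (cases "z \<in> Q") auto
  qed
  show "norm (indicator Q z *\<^sub>R f z) \<le> (SUP x\<in>Q. norm (f x)) \<or> Q = {}" using 1 by auto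
  show "\<exists>C. \<forall>z. norm (indicator Q z *\<^sub>R f z) \<le> C"
    by (cases "Q = {}") (use 1 in auto)
qed

lemma density_functional_vector_measure:
  fixes h :: "'b::euclidean_space \<Rightarrow> 'v::euclidean_space"
  assumes Q: "compact Q" "Q \<noteq> {}" and l: "sets l = sets borel" and h: "integrable l h"
  shows "(\<lambda>f. LINT z:Q|l. f z \<bullet> h z) \<in> vector_measures Q"
proof -
  have int: "integrable l (\<lambda>z. indicator Q z *\<^sub>R (f z \<bullet> h z))"
    and le: "\<bar>LINT z|l. indicator Q z *\<^sub>R (f z \<bullet> h z)\<bar> \<le> (LINT z|l. norm (h z)) * (SUP x\<in>Q. norm (f x))"
    if f: "continuous_on Q f" for f
  proof -
    let ?S = "SUP x\<in>Q. norm (f x)"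
    note [measurable] = borel_measurable_integrable[OF h]
    have m: "(\<lambda>z. indicator Q z *\<^sub>R f z) \<in> borel_measurable l"
      using compact_restriction(1)[OF Q(1) f] l by (simp cong: measurable_cong_sets)
    have eq: "indicator Q z *\<^sub>R (f z \<bullet> h z) = (indicator Q z *\<^sub>R f z) \<bullet> h z" for z by simp
    have b: "norm ((indicator Q z *\<^sub>R f z) \<bullet> h z) \<le> norm (h z) * ?S" for z
    proof -
      have "norm ((indicator Q z *\<^sub>R f z) \<bullet> h z) \<le> norm (indicator Q z *\<^sub>R f z) * norm (h z)"
        using Cauchy_Schwarz_ineq2[of "indicator Q z *\<^sub>R f z" "h z"] by (simp only: real_norm_def)
      also have "\<dots> \<le> ?S * norm (h z)"
        using compact_restriction(2)[OF Q(1) f, of z] Q(2) by (intro mult_right_mono) auto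
      finally show ?thesis by (simp only: mult.commute)
    qed
    have i: "integrable l (\<lambda>z. norm (h z) * ?S)" using h by auto
    show I: "integrable l (\<lambda>z. indicator Q z *\<^sub>R (f z \<bullet> h z))"
      unfolding eq
    proof (rule Bochner_Integration.integrable_bound[OF i])
      show "(\<lambda>z. (indicator Q z *\<^sub>R f z) \<bullet> h z) \<in> borel_measurable l" using m by measurable
      show "AE z in l. norm ((indicator Q z *\<^sub>R f z) \<bullet> h z) \<le> norm (norm (h z) * ?S)"
        using b by (intro AE_I2) (metis abs_ge_self order.trans real_norm_def)
    qed
    have "\<bar>LINT z|l. indicator Q z *\<^sub>R (f z \<bullet> h z)\<bar> \<le> (LINT z|l. norm (indicator Q z *\<^sub>R (f z \<bullet> h z)))"
      using integral_norm_bound[of l "\<lambda>z. indicator Q z *\<^sub>R (f z \<bullet> h z)"] by simp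
    also have "\<dots> \<le> (LINT z|l. norm (h z) * ?S)"
      using I i b unfolding eq by (intro integral_mono) auto
    finally show "\<bar>LINT z|l. indicator Q z *\<^sub>R (f z \<bullet> h z)\<bar> \<le> (LINT z|l. norm (h z)) * ?S" by simp
  qed
  show ?thesis
    unfolding vector_measures_def set_lebesgue_integral_def
  proof (intro CollectI conjI allI impI)
    fix f g :: "'b \<Rightarrow> 'v" assume "continuous_on Q f" "continuous_on Q g"
    then show "(LINT z|l. indicator Q z *\<^sub>R ((f z + g z) \<bullet> h z)) =
        (LINT z|l. indicator Q z *\<^sub>R (f z \<bullet> h z)) + (LINT z|l. indicator Q z *\<^sub>R (g z \<bullet> h z))"
      using Bochner_Integration.integral_add[OF int int, of f g] by (simp add: inner_add_left distrib_left)
  next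
    fix c and f :: "'b \<Rightarrow> 'v"
    have "(LINT z|l. indicator Q z *\<^sub>R (c *\<^sub>R f z \<bullet> h z)) = (LINT z|l. c * (indicator Q z *\<^sub>R (f z \<bullet> h z)))"
      by (intro Bochner_Integration.integral_cong) auto
    then show "(LINT z|l. indicator Q z *\<^sub>R (c *\<^sub>R f z \<bullet> h z)) = c * (LINT z|l. indicator Q z *\<^sub>R (f z \<bullet> h z))"
      by simp
  next
    show "\<exists>C. \<forall>f. continuous_on Q f \<longrightarrow>
        \<bar>LINT z|l. indicator Q z *\<^sub>R (f z \<bullet> h z)\<bar> \<le> C * (SUP x\<in>Q. norm (f x))"
      using le by blast
  qed
qed

text \<open>The first marginal of \<open>\<gamma>\<close> is joined to the mixture of the second one with \<open>\<nu>\<close>. Each pair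
  \<open>(y, y')\<close> carries mass \<open>1 - \<epsilon> t\<^sup>2\<close> along the segment from \<open>y\<close> to \<open>y'\<close>, while mass \<open>\<epsilon> t\<^sup>2\<close> of \<open>\<nu>\<close>
  is created at rest. The continuity equation is the fundamental theorem of calculus along every
  segment, integrated over \<open>\<gamma>\<close>.\<close>

lemma WFR_sq_le_of_coupling:
  fixes \<Omega> :: "'a::euclidean_space set" and \<gamma> :: "('a \<times> 'a) measure" and \<nu> \<rho>0 \<rho>1 :: "'a measure"
    and \<delta> \<epsilon> :: real
  assumes \<Omega>: "compact \<Omega>" "\<Omega> \<noteq> {}"
    and plan: "displacement_plan \<Omega> \<delta> \<gamma>" and \<delta>: "0 \<le> \<delta>"
    and \<nu>: "\<nu> \<in> nonneg_measures \<Omega>" and e: "0 < \<epsilon>" "\<epsilon> \<le> 1/2"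
    and joins: "joins_by \<gamma> \<nu> \<epsilon> \<rho>0 \<rho>1"
  shows "WFR_sq \<Omega> \<rho>0 \<rho>1 \<le>
     ennreal (measure \<gamma> UNIV * ((DIM('a) * \<delta>)\<^sup>2 / 2 + 4 * \<epsilon>\<^sup>2) + measure \<nu> UNIV * (2 * \<epsilon>))"
proof -
  have s\<gamma>[measurable_cong]: "sets \<gamma> = sets borel" and f\<gamma>: "emeasure \<gamma> UNIV < \<infinity>"
    and good: "AE p in \<gamma>. closed_segment (fst p) (snd p) \<subseteq> \<Omega> \<and> norm (snd p - fst p) \<le> \<delta>"
    using plan unfolding displacement_plan_def by blast+
  have \<rho>0: "(LINT x|\<rho>0. f x) = (LINT p|\<gamma>. f (fst p))"
    and \<rho>1: "(LINT x|\<rho>1. f x) = (1 - \<epsilon>) * (LINT p|\<gamma>. f (snd p)) + \<epsilon> * (LINT x|\<nu>. f x)"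
    if "f \<in> borel_measurable borel" "\<And>x. \<bar>f x\<bar> \<le> C" for f :: "'a \<Rightarrow> real" and C
    using joins that unfolding joins_by_def by blast+
  let ?Q = "space_time \<Omega>"
  have Q: "compact ?Q" "?Q \<noteq> {}" using \<Omega> by (auto simp: space_time_def intro: compact_Times)
  have Qb[measurable]: "?Q \<in> sets borel" "\<Omega> \<in> sets borel"
    using Q \<Omega> by (auto intro: borel_compact)
  have s\<nu>[measurable_cong]: "sets \<nu> = sets borel" and f\<nu>: "emeasure \<nu> UNIV < \<infinity>" and \<nu>\<Omega>: "emeasure \<nu> (- \<Omega>) = 0"
    using \<nu> by (auto simp: nonneg_measures_def)
  have sp[simp]: "space \<gamma> = UNIV" "space \<nu> = UNIV"
    using s\<gamma> s\<nu> by (metis sets_eq_imp_space_eq space_borel)+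
  interpret \<gamma>: finite_measure \<gamma> using f\<gamma> by (intro finite_measureI) auto
  interpret \<nu>: finite_measure \<nu> using f\<nu> by (intro finite_measureI) auto
  have \<nu>AE: "AE x in \<nu>. x \<in> \<Omega>"
    using \<nu>\<Omega> by (intro AE_I[where N = "- \<Omega>"]) (auto simp: s\<nu>)

  define P where "P = unit_time \<Otimes>\<^sub>M \<gamma>"
  note uP = unit_time_pair[OF s\<gamma>, folded P_def] and u\<nu> = unit_time_pair[OF s\<nu>]
  note [measurable_cong] = uP(1) u\<nu>(1)
  define X where "X z = (fst z, displaced z)" for z :: "real \<times> 'a \<times> 'a"
  have Xm[measurable]: "X \<in> borel_measurable borel"
    unfolding X_def displaced_def by (intro borel_measurable_continuous_onI continuous_intros)
  note Wm[measurable] = velocity_measurable[of \<delta>]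
  have XPm: "X \<in> borel_measurable P" and WPm: "velocity \<delta> \<in> borel_measurable P" by measurable
  \<comment> \<open>The space-time measures of the moving and of the resting population, without their mass weights.\<close>
  define L1 where "L1 = distr P borel X"
  define L2 where "L2 = distr (unit_time \<Otimes>\<^sub>M \<nu>) borel (\<lambda>z. z)"
  have sL[simp, measurable_cong]: "sets L1 = sets borel" "sets L2 = sets borel" by (auto simp: L1_def L2_def)
  have mL: "emeasure L1 UNIV = emeasure \<gamma> UNIV" "emeasure L2 UNIV = emeasure \<nu> UNIV"
    using f\<gamma> f\<nu> by (simp_all add: L1_def L2_def emeasure_distr uP u\<nu>)
  define l where "l = mix_measure 1 L1 1 L2"
  have sl[simp, measurable_cong]: "sets l = sets borel" and spl[simp]: "space l = UNIV" by (simp_all add: l_def)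
  have eml: "emeasure l A = emeasure L1 A + emeasure L2 A" if "A \<in> sets borel" for A
    using that by (simp add: l_def emeasure_mix_measure)
  have fl: "emeasure l UNIV < \<infinity>" using f\<gamma> f\<nu> by (simp add: eml mL)
  interpret l: finite_measure l using fl by (intro finite_measureI) auto

  obtain b1 where b1[measurable]: "b1 \<in> borel_measurable borel" and b1_0: "\<And>z. 0 \<le> b1 z" and b1_1: "\<And>z. b1 z \<le> 1"
    and L1: "L1 = density l (\<lambda>z. ennreal (b1 z))"
    using dominated_density[of l L1 1] fl eml by auto
  obtain b2 where b2[measurable]: "b2 \<in> borel_measurable borel" and b2_0: "\<And>z. 0 \<le> b2 z" and b2_1: "\<And>z. b2 z \<le> 1"
    and L2: "L2 = density l (\<lambda>z. ennreal (b2 z))"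
    using dominated_density[of l L2 1] fl eml by auto
  have fP: "emeasure P (space P) < \<infinity>" using f\<gamma> by (simp add: uP)
  \<comment> \<open>\<open>V\<close> is the mean velocity of the moving population at a space-time point.\<close>
  obtain V :: "real \<times> 'a \<Rightarrow> 'a" where Vm[measurable]: "V \<in> borel_measurable borel"
    and Vb: "\<And>z. norm (V z) \<le> DIM('a) * \<delta>"
    and VP: "\<forall>F C. F \<in> borel_measurable borel \<longrightarrow> (\<forall>z. norm (F z) \<le> C) \<longrightarrow>
       (LINT l|P. F (X l) \<bullet> velocity \<delta> l) = (LINT z|L1. F z \<bullet> V z)"
    by (rule bounded_vector_pushforward_density[OF fP XPm WPm velocity_bound[OF \<delta>], folded L1_def], rule that)

  \<comment> \<open>Time, clipped so that all weights are bounded off the space-time cylinder as well.\<close>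
  define s where "s z = max 0 (min 1 (fst z))" for z :: "real \<times> 'a"
  define a where "a z = 1 - \<epsilon> * (s z)\<^sup>2" for z
  have s01: "0 \<le> s z" "s z \<le> 1" for z by (auto simp: s_def)
  have sm[measurable]: "s \<in> borel_measurable borel"
    unfolding s_def by (intro borel_measurable_continuous_onI continuous_intros)
  have am[measurable]: "a \<in> borel_measurable borel" unfolding a_def by measurable
  have a01: "0 \<le> a z" "a z \<le> 1" for z
  proof -
    have "(s z)\<^sup>2 \<le> 1" using s01[of z] by (simp add: abs_square_le_1)
    then have "\<epsilon> * (s z)\<^sup>2 \<le> 1 * 1" using e by (intro mult_mono) auto
    then show "0 \<le> a z" "a z \<le> 1" using e by (auto simp: a_def)
  qed
  define h1 where "h1 z = a z * b1 z + \<epsilon> * (s z)\<^sup>2 * b2 z" for z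
  define h2 where "h2 z = (a z * b1 z) *\<^sub>R V z" for z
  define h3 where "h3 z = - 2 * \<epsilon> * s z * b1 z + 2 * \<epsilon> * s z * b2 z" for z
  define h where "h z = (h1 z, h2 z, h3 z)" for z
  have [measurable]: "h1 \<in> borel_measurable borel" "h2 \<in> borel_measurable borel" "h3 \<in> borel_measurable borel"
    unfolding h1_def h2_def h3_def by measurable
  have hm[measurable]: "h \<in> borel_measurable borel" unfolding h_def by measurable
  have Jh: "J_density (h z) \<le> ennreal (b1 z * ((DIM('a) * \<delta>)\<^sup>2 / 2 + 4 * \<epsilon>\<^sup>2) + b2 z * (2 * \<epsilon>))" for z
  proof -
    have "norm (h2 z) = a z * b1 z * norm (V z)" using a01[of z] b1_0[of z] by (simp add: h2_def)
    also have "\<dots> \<le> a z * b1 z * (DIM('a) * \<delta>)" using a01[of z] b1_0[of z] Vb[of z] by (intro mult_left_mono) auto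
    finally show ?thesis
      unfolding h_def h1_def h3_def a_def using b1_0 b2_0 s01 e \<delta> by (intro J_density_bound) auto
  qed
  have hb: "norm (h z) \<le> 2 + DIM('a) * \<delta> + 1" for z
  proof -
    have "norm (h z) \<le> norm (h1 z) + (norm (h2 z) + norm (h3 z))"
      unfolding h_def by (intro order.trans[OF norm_Pair_le] add_left_mono norm_Pair_le)
    moreover have "s z * s z \<le> 1" using s01[of z] by (intro mult_le_one) auto
    have "a z * b1 z \<le> 1 * 1" using a01 b1_0 b1_1 by (intro mult_mono) auto
    moreover have "0 \<le> a z * b1 z" using a01 b1_0 by simp
    moreover have "\<epsilon> * (s z)\<^sup>2 * b2 z \<le> (1 * 1) * 1" using \<open>s z * s z \<le> 1\<close> b2_1 b2_0 e
      by (intro mult_mono) (auto simp: power2_eq_square)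
    moreover have "0 \<le> \<epsilon> * (s z)\<^sup>2 * b2 z" using b2_0 e by simp
    moreover have "norm (h2 z) \<le> 1 * (DIM('a) * \<delta>)"
      unfolding h2_def norm_scaleR using \<open>a z * b1 z \<le> 1 * 1\<close> \<open>0 \<le> a z * b1 z\<close> Vb[of z] \<delta>
      by (intro mult_mono) auto
    moreover have "0 \<le> (2 * \<epsilon>) * (s z * b1 z)" "(2 * \<epsilon>) * (s z * b1 z) \<le> 1 * 1"
      using mult_le_one[of "s z" "b1 z"] s01[of z] b1_0[of z] b1_1[of z] e mult_mono[of "2 * \<epsilon>" 1 "s z * b1 z" 1] by simp_all
    moreover have "0 \<le> (2 * \<epsilon>) * (s z * b2 z)" "(2 * \<epsilon>) * (s z * b2 z) \<le> 1 * 1"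
      using mult_le_one[of "s z" "b2 z"] s01[of z] b2_0[of z] b2_1[of z] e mult_mono[of "2 * \<epsilon>" 1 "s z * b2 z" 1] by simp_all
    ultimately show ?thesis unfolding h1_def h3_def by (simp add: algebra_simps)
  qed
  have hi: "integrable l h"
    using fl hb by (intro integrable_bounded_finite[where C = "2 + DIM('a) * \<delta> + 1"]) auto
  define \<mu> where "\<mu> f = (LINT z:?Q|l. f z \<bullet> h z)" for f :: "real \<times> 'a \<Rightarrow> real \<times> 'a \<times> real"
  have \<mu>: "\<mu> \<in> vector_measures ?Q"
    unfolding \<mu>_def by (rule density_functional_vector_measure[OF Q sl hi])

  have L1Q: "emeasure L1 (- ?Q) = 0"
  proof -
    have "AE z in P. X z \<in> ?Q"
      unfolding P_def
    proof (rule AE_unit_time_pair[OF s\<gamma> f\<gamma>])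
      show "{z. X z \<in> ?Q} \<in> sets borel" using measurable_sets[OF Xm Qb(1)] by (simp add: vimage_def)
      show "AE p in \<gamma>. \<forall>t\<in>{0..1}. X (t, p) \<in> ?Q"
        using good by eventually_elim (force simp: X_def displaced_def space_time_def closed_segment_def algebra_simps)
    qed
    then have "AE z in L1. z \<in> ?Q" unfolding L1_def by (subst AE_distr_iff) auto
    then show ?thesis by (subst (asm) AE_iff_measurable[of "- ?Q"]) (auto simp: sets_eq_imp_space_eq[OF sL(1)])
  qed
  have L2Q: "emeasure L2 (- ?Q) = 0"
  proof -
    have "AE z in unit_time \<Otimes>\<^sub>M \<nu>. z \<in> ?Q"
    proof (rule AE_unit_time_pair[OF s\<nu> f\<nu>])
      show "AE x in \<nu>. \<forall>t\<in>{0..1}. (t, x) \<in> ?Q" using \<nu>AE by eventually_elim (auto simp: space_time_def)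
    qed (use Qb in simp)
    then have "AE z in L2. z \<in> ?Q" unfolding L2_def by (subst AE_distr_iff) auto
    then show ?thesis by (subst (asm) AE_iff_measurable[of "- ?Q"]) (auto simp: sets_eq_imp_space_eq[OF sL(2)])
  qed
  have lQ: "l \<in> nonneg_measures ?Q"
    using fl L1Q L2Q Qb by (auto simp: nonneg_measures_def eml)
  have dens: "is_density ?Q \<mu> l h"
    using hi by (auto simp: is_density_def \<mu>_def)

  have cost: "(\<integral>\<^sup>+ z. J_density (h z) \<partial>l) \<le>
     ennreal (measure \<gamma> UNIV * ((DIM('a) * \<delta>)\<^sup>2 / 2 + 4 * \<epsilon>\<^sup>2) + measure \<nu> UNIV * (2 * \<epsilon>))"
  proof -
    let ?c = "(DIM('a) * \<delta>)\<^sup>2 / 2 + 4 * \<epsilon>\<^sup>2"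
    have c: "0 \<le> ?c" by simp
    have I1: "(\<integral>\<^sup>+ z. ennreal (b1 z) \<partial>l) = ennreal (measure \<gamma> UNIV)"
      using mL(1) unfolding L1 by (simp add: emeasure_density \<gamma>.emeasure_eq_measure)
    have I2: "(\<integral>\<^sup>+ z. ennreal (b2 z) \<partial>l) = ennreal (measure \<nu> UNIV)"
      using mL(2) unfolding L2 by (simp add: emeasure_density \<nu>.emeasure_eq_measure)
    have "(\<integral>\<^sup>+ z. J_density (h z) \<partial>l) \<le> (\<integral>\<^sup>+ z. ennreal (b1 z) * ennreal ?c + ennreal (b2 z) * ennreal (2 * \<epsilon>) \<partial>l)"
      using Jh b1_0 b2_0 e c by (intro nn_integral_mono) (simp add: ennreal_mult' ennreal_plus)
    also have "\<dots> = ennreal (measure \<gamma> UNIV) * ennreal ?c + ennreal (measure \<nu> UNIV) * ennreal (2 * \<epsilon>)"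
      by (subst nn_integral_add) (auto simp: nn_integral_multc I1 I2)
    also have "\<dots> = ennreal (measure \<gamma> UNIV * ?c + measure \<nu> UNIV * (2 * \<epsilon>))"
      using e c by (simp add: ennreal_mult' ennreal_plus)
    finally show ?thesis .
  qed

  have CE: "\<mu> \<in> continuity_eq \<Omega> \<rho>0 \<rho>1"
    unfolding continuity_eq_def
  proof (intro CollectI conjI \<mu> allI impI)
    fix \<phi> D assume C1: "C1_on ?Q \<phi> D"
    have cD: "continuous_on ?Q D" using C1 by (simp add: C1_on_def)
    have c\<phi>: "continuous_on ?Q \<phi>" using C1
      by (auto simp: C1_on_def continuous_on_eq_continuous_within intro: has_derivative_continuous)
    define Dt where "Dt z = indicator ?Q z *\<^sub>R fst (D z)" for z
    define Dx where "Dx z = indicator ?Q z *\<^sub>R snd (D z)" for z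
    define \<Phi> where "\<Phi> z = indicator ?Q z *\<^sub>R \<phi> z" for z
    have c1: "continuous_on ?Q (\<lambda>z. fst (D z))" "continuous_on ?Q (\<lambda>z. snd (D z))"
      by (rule continuous_on_fst[OF cD], rule continuous_on_snd[OF cD])
    have [measurable]: "Dt \<in> borel_measurable borel" "Dx \<in> borel_measurable borel" "\<Phi> \<in> borel_measurable borel"
      unfolding Dt_def Dx_def \<Phi>_def using compact_restriction(1)[OF Q(1)] c1 c\<phi> by blast+
    obtain K1 K2 K3 where K: "\<And>z. \<bar>Dt z\<bar> \<le> K1" "\<And>z. norm (Dx z) \<le> K2" "\<And>z. \<bar>\<Phi> z\<bar> \<le> K3"
      using compact_restriction(3)[OF Q(1) c1(1)] compact_restriction(3)[OF Q(1) c1(2)]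
        compact_restriction(3)[OF Q(1) c\<phi>] unfolding Dt_def Dx_def \<Phi>_def real_norm_def by metis
    have K0: "0 \<le> K1" "0 \<le> K2" "0 \<le> K3"
      using K(1)[of undefined] K(2)[of undefined] K(3)[of undefined] norm_ge_zero order.trans abs_ge_zero by metis+
    have ec: "(\<lambda>x. indicator \<Omega> x *\<^sub>R \<phi> (c, x)) = (\<lambda>x. \<Phi> (c, x))" if "c \<in> {0..1}" for c
      using that by (auto simp: \<Phi>_def indicator_def space_time_def)
    have Em[measurable]: "(\<lambda>x. indicator \<Omega> x *\<^sub>R \<phi> (1, x)) \<in> borel_measurable borel"
       "(\<lambda>x. indicator \<Omega> x *\<^sub>R \<phi> (0, x)) \<in> borel_measurable borel"
      using ec[of 0] ec[of 1] by simp_all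
    note fm = marginals_measurable[OF s\<gamma>]
    have EG[measurable]: "(\<lambda>p. indicator \<Omega> (snd p) *\<^sub>R \<phi> (1, snd p)) \<in> borel_measurable \<gamma>"
       "(\<lambda>p. indicator \<Omega> (fst p) *\<^sub>R \<phi> (0, fst p)) \<in> borel_measurable \<gamma>"
      by (rule measurable_compose[OF fm(2) Em(1)], rule measurable_compose[OF fm(1) Em(2)])
    have Eb: "\<bar>indicator \<Omega> x *\<^sub>R \<phi> (1, x)\<bar> \<le> K3" "\<bar>indicator \<Omega> x *\<^sub>R \<phi> (0, x)\<bar> \<le> K3" for x
      using fun_cong[OF ec[of 0], of x] fun_cong[OF ec[of 1], of x] K(3) by simp_all
    define A where "A z = a z * Dt z - 2 * \<epsilon> * s z * \<Phi> z" for z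
    define B where "B z = \<epsilon> * (s z)\<^sup>2 * Dt z + 2 * \<epsilon> * s z * \<Phi> z" for z
    have [measurable]: "A \<in> borel_measurable borel" "B \<in> borel_measurable borel"
      unfolding A_def B_def by measurable
    have aux: "\<bar>c * x\<bar> \<le> K" if "0 \<le> c" "c \<le> 1" "\<bar>x\<bar> \<le> K" for c x K :: real
      using that mult_mono[of c 1 "\<bar>x\<bar>" K] by (auto simp: abs_mult)
    have s2: "0 \<le> \<epsilon> * (s z)\<^sup>2" "\<epsilon> * (s z)\<^sup>2 \<le> 1" "0 \<le> 2 * \<epsilon> * s z" "2 * \<epsilon> * s z \<le> 1" for z
      using e s01[of z] a01[of z] mult_mono[of "2 * \<epsilon>" 1 "s z" 1] by (auto simp: a_def)
    have Ab: "\<bar>A z\<bar> \<le> K1 + K3" and Bb: "\<bar>B z\<bar> \<le> K1 + K3" for z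
      using aux[OF a01 K(1), of z z] aux[OF s2(1,2) K(1), of z z] aux[OF s2(3,4) K(3), of z z]
      unfolding A_def B_def by linarith+
    have aDb: "norm (a z *\<^sub>R Dx z) \<le> K2" for z
      using aux[OF a01, of "norm (Dx z)" K2 z] K(2)[of z] by (simp add: abs_mult)
    have dot: "\<bar>(a z *\<^sub>R Dx z) \<bullet> w\<bar> \<le> K2 * K" if "norm w \<le> K" for z w K
      using Cauchy_Schwarz_ineq2[of "a z *\<^sub>R Dx z" w] mult_mono[OF aDb that K0(2) norm_ge_zero] by (rule order.trans)
    define R where "R z = A z + (a z *\<^sub>R Dx z) \<bullet> V z" for z
    have Rm[measurable]: "R \<in> borel_measurable borel" unfolding R_def by measurable
    have Rb: "\<bar>R z\<bar> \<le> K1 + K3 + K2 * (DIM('a) * \<delta>)" for z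
      using Ab[of z] dot[OF Vb, of z z] unfolding R_def by linarith
    define G where "G z = A (X z) + (a (X z) *\<^sub>R Dx (X z)) \<bullet> velocity \<delta> z" for z
    have Gm[measurable]: "G \<in> borel_measurable borel" unfolding G_def by measurable
    have Gb: "\<bar>G z\<bar> \<le> K1 + K3 + K2 * \<delta>" for z
      using Ab[of "X z"] dot[OF velocity_bound[OF \<delta>], of "X z" z] unfolding G_def by linarith
    have "\<mu> (\<lambda>z. (fst (D z), snd (D z), \<phi> z)) = (LINT z|l. b1 z * R z + b2 z * B z)"
      unfolding \<mu>_def set_lebesgue_integral_def
      by (intro Bochner_Integration.integral_cong)
         (auto simp: h_def h1_def h2_def h3_def A_def B_def Dt_def Dx_def \<Phi>_def R_def indicator_def algebra_simps)
    also have "\<dots> = (LINT z|l. b1 z * R z) + (LINT z|l. b2 z * B z)"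
    proof (rule Bochner_Integration.integral_add)
      show "integrable l (\<lambda>z. b1 z * R z)"
        by (rule integrable_bounded_finite[where C = "K1 + K3 + K2 * (DIM('a) * \<delta>)"])
           (use fl aux[OF b1_0 b1_1 Rb] in auto)
      show "integrable l (\<lambda>z. b2 z * B z)"
        by (rule integrable_bounded_finite[where C = "K1 + K3"]) (use fl aux[OF b2_0 b2_1 Bb] in auto)
    qed
    also have "(LINT z|l. b1 z * R z) = (LINT z|L1. R z)"
      unfolding L1 using b1_0 by (subst integral_density) auto
    also have "\<dots> = (LINT z|L1. A z) + (LINT z|L1. (a z *\<^sub>R Dx z) \<bullet> V z)"
      unfolding R_def
    proof (rule Bochner_Integration.integral_add)
      have sp1: "emeasure L1 (space L1) < \<infinity>"
        using f\<gamma> mL(1) sets_eq_imp_space_eq[OF sL(1)] by simp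
      show "integrable L1 A" by (rule integrable_bounded_finite[where C = "K1 + K3"]) (use sp1 Ab in auto)
      show "integrable L1 (\<lambda>z. (a z *\<^sub>R Dx z) \<bullet> V z)"
        by (rule integrable_bounded_finite[where C = "K2 * (DIM('a) * \<delta>)"])
           (use sp1 dot[OF Vb] in \<open>auto simp del: inner_scaleR_left\<close>)
    qed
    also have "\<dots> = (LINT z|P. A (X z)) + (LINT z|P. (a (X z) *\<^sub>R Dx (X z)) \<bullet> velocity \<delta> z)"
    proof -
      have "(LINT z|L1. A z) = (LINT z|P. A (X z))" unfolding L1_def using XPm by (subst integral_distr) auto
      moreover have m: "(\<lambda>z. a z *\<^sub>R Dx z) \<in> borel_measurable borel" by measurable
      have "(LINT z|P. (a (X z) *\<^sub>R Dx (X z)) \<bullet> velocity \<delta> z) = (LINT z|L1. (a z *\<^sub>R Dx z) \<bullet> V z)"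
        using mp[OF mp[OF spec[OF spec[OF VP, of "\<lambda>z. a z *\<^sub>R Dx z"], of K2] m]] aDb by blast
      ultimately show ?thesis by simp
    qed
    also have "\<dots> = (LINT z|P. G z)"
      unfolding G_def
    proof (rule Bochner_Integration.integral_add[symmetric])
      show "integrable P (\<lambda>z. A (X z))"
        by (rule integrable_bounded_finite[where C = "K1 + K3"]) (use fP Ab in auto)
      show "integrable P (\<lambda>z. (a (X z) *\<^sub>R Dx (X z)) \<bullet> velocity \<delta> z)"
        by (rule integrable_bounded_finite[where C = "K2 * \<delta>"])
           (use fP dot[OF velocity_bound[OF \<delta>]] in \<open>auto simp del: inner_scaleR_left\<close>)
    qed
    also have "\<dots> = (LINT p|\<gamma>. (1 - \<epsilon>) * (indicator \<Omega> (snd p) *\<^sub>R \<phi> (1, snd p)) - indicator \<Omega> (fst p) *\<^sub>R \<phi> (0, fst p))"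
      unfolding P_def
    proof (rule integral_unit_time_pair[OF s\<gamma> f\<gamma> Gm Gb])
      show "(\<lambda>p. (1 - \<epsilon>) * (indicator \<Omega> (snd p) *\<^sub>R \<phi> (1, snd p)) - indicator \<Omega> (fst p) *\<^sub>R \<phi> (0, fst p)) \<in> borel_measurable \<gamma>"
        by (intro borel_measurable_diff borel_measurable_times borel_measurable_const EG)
      show "AE p in \<gamma>. (LINT t|unit_time. G (t, p))
          = (1 - \<epsilon>) * (indicator \<Omega> (snd p) *\<^sub>R \<phi> (1, snd p)) - indicator \<Omega> (fst p) *\<^sub>R \<phi> (0, fst p)"
        using good
      proof eventually_elim
        case (elim p)
        define y where "y = fst p" define y' where "y' = snd p"
        have yy: "closed_segment y y' \<subseteq> \<Omega>" "norm (y' - y) \<le> \<delta>" "y \<in> \<Omega>" "y' \<in> \<Omega>" using elim by (auto simp: y_def y'_def)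
        have [measurable]: "(\<lambda>t. (t, p)) \<in> borel_measurable borel"
          by (intro borel_measurable_continuous_onI continuous_intros)
        have "(LINT t|unit_time. G (t, p)) = (LINT t|lborel. indicator {0..1} t *\<^sub>R G (t, p))"
          by (rule integral_unit_time) measurable
        also have "\<dots> = (LINT t|lborel. indicator {0..1} t *\<^sub>R ((1 - \<epsilon> * t\<^sup>2) * (fst (D (t, y + t *\<^sub>R (y' - y))) +
            snd (D (t, y + t *\<^sub>R (y' - y))) \<bullet> (y' - y)) + (- 2 * \<epsilon> * t) * \<phi> (t, y + t *\<^sub>R (y' - y))))"
        proof (rule Bochner_Integration.integral_cong)
          fix t :: real
          show "indicator {0..1} t *\<^sub>R G (t, p) =
            indicator {0..1} t *\<^sub>R ((1 - \<epsilon> * t\<^sup>2) * (fst (D (t, y + t *\<^sub>R (y' - y))) +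
            snd (D (t, y + t *\<^sub>R (y' - y))) \<bullet> (y' - y)) + (- 2 * \<epsilon> * t) * \<phi> (t, y + t *\<^sub>R (y' - y)))"
          proof (cases "t \<in> {0..1}")
            case True
            have st: "s (X (t, p)) = t" using True by (simp add: s_def X_def)
            have Xt: "X (t, p) = (t, y + t *\<^sub>R (y' - y))" by (simp add: X_def displaced_def y_def y'_def)
            have "X (t, p) \<in> ?Q"
              using True yy(1) unfolding Xt by (force simp: space_time_def closed_segment_def algebra_simps)
            then have ind: "indicator ?Q (X (t, p)) = (1::real)" by simp
            define c where "c = snd (D (X (t, p))) \<bullet> (y' - y)"
            have "velocity \<delta> (t, p) = y' - y" using yy(2) by (simp add: velocity_def y_def y'_def)
            then have "(a (X (t, p)) *\<^sub>R Dx (X (t, p))) \<bullet> velocity \<delta> (t, p) = a (X (t, p)) * c"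
              by (simp add: Dx_def ind c_def)
            moreover have "A (X (t, p)) = a (X (t, p)) * fst (D (X (t, p))) - 2 * \<epsilon> * t * \<phi> (X (t, p))"
              by (simp add: A_def st Dt_def \<Phi>_def ind)
            ultimately have "G (t, p) = (1 - \<epsilon> * t\<^sup>2) * (fst (D (X (t, p))) + c) + (- 2 * \<epsilon> * t) * \<phi> (X (t, p))"
              unfolding G_def by (simp add: a_def st distrib_left)
            then show ?thesis by (simp only: c_def Xt)
          qed simp
        qed simp
        also have "\<dots> = (1 - \<epsilon> * 1\<^sup>2) * \<phi> (1, y') - (1 - \<epsilon> * 0\<^sup>2) * \<phi> (0, y)"
          by (rule space_time_path_FTC[OF C1 yy(1)]) (auto intro!: derivative_eq_intros continuous_intros)
        finally show ?case using yy by (simp add: y_def y'_def)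
      qed
    qed
    also have "\<dots> = (1 - \<epsilon>) * (LINT p|\<gamma>. indicator \<Omega> (snd p) *\<^sub>R \<phi> (1, snd p)) - (LINT p|\<gamma>. indicator \<Omega> (fst p) *\<^sub>R \<phi> (0, fst p))"
    proof -
      have i1: "integrable \<gamma> (\<lambda>p. indicator \<Omega> (snd p) *\<^sub>R \<phi> (1, snd p))"
        by (rule integrable_bounded_finite[where C = K3]) (use f\<gamma> Eb EG in \<open>simp_all del: real_scaleR_def\<close>)
      have i2: "integrable \<gamma> (\<lambda>p. indicator \<Omega> (fst p) *\<^sub>R \<phi> (0, fst p))"
        by (rule integrable_bounded_finite[where C = K3]) (use f\<gamma> Eb EG in \<open>simp_all del: real_scaleR_def\<close>)
      show ?thesis
        using Bochner_Integration.integral_diff[OF integrable_mult_right[OF i1, of "1 - \<epsilon>"] i2]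
        by (simp only: integral_mult_right_zero)
    qed
    also have "(LINT z|l. b2 z * B z) = (LINT z|L2. B z)"
      unfolding L2 using b2_0 by (subst integral_density) auto
    also have "\<dots> = (LINT z|(unit_time \<Otimes>\<^sub>M \<nu>). B z)"
      unfolding L2_def by (subst integral_distr) auto
    also have "\<dots> = (LINT x|\<nu>. \<epsilon> * (indicator \<Omega> x *\<^sub>R \<phi> (1, x)))"
    proof (rule integral_unit_time_pair[OF s\<nu> f\<nu> _ Bb])
      show "B \<in> borel_measurable borel" by measurable
      show "(\<lambda>x. \<epsilon> * (indicator \<Omega> x *\<^sub>R \<phi> (1, x))) \<in> borel_measurable \<nu>" by measurable
      show "AE x in \<nu>. (LINT t|unit_time. B (t, x)) = \<epsilon> * (indicator \<Omega> x *\<^sub>R \<phi> (1, x))"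
        using \<nu>AE
      proof eventually_elim
        case (elim x)
        have [measurable]: "(\<lambda>t. (t, x)) \<in> borel_measurable borel"
          by (intro borel_measurable_continuous_onI continuous_intros)
        have "(LINT t|unit_time. B (t, x)) = (LINT t|lborel. indicator {0..1} t *\<^sub>R B (t, x))"
          by (rule integral_unit_time) measurable
        also have "\<dots> = (LINT t|lborel. indicator {0..1} t *\<^sub>R (\<epsilon> * t\<^sup>2 * (fst (D (t, x + t *\<^sub>R (x - x))) +
            snd (D (t, x + t *\<^sub>R (x - x))) \<bullet> (x - x)) + 2 * \<epsilon> * t * \<phi> (t, x + t *\<^sub>R (x - x))))"
          by (rule Bochner_Integration.integral_cong)
             (use elim in \<open>auto simp: B_def s_def Dt_def \<Phi>_def space_time_def indicator_def\<close>)
        also have "\<dots> = \<epsilon> * 1\<^sup>2 * \<phi> (1, x) - \<epsilon> * 0\<^sup>2 * \<phi> (0, x)"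
          using elim by (intro space_time_path_FTC[OF C1]) (auto intro!: derivative_eq_intros continuous_intros)
        finally show ?case using elim by simp
      qed
    qed
    finally show "\<mu> (\<lambda>z. (fst (D z), snd (D z), \<phi> z)) = (LINT x:\<Omega>|\<rho>1. \<phi> (1, x)) - (LINT x:\<Omega>|\<rho>0. \<phi> (0, x))"
      unfolding set_lebesgue_integral_def \<rho>0[OF Em(2) Eb(2)] \<rho>1[OF Em(1) Eb(1)]
      by (simp only: integral_mult_right_zero)
  qed
  have "WFR_sq \<Omega> \<rho>0 \<rho>1 \<le> action \<Omega> \<mu>"
    unfolding WFR_sq_def by (rule INF_lower[OF CE])
  also have "\<dots> \<le> (\<integral>\<^sup>+ z. J_density (h z) \<partial>l)"
    unfolding action_def by (rule INF_lower2[of "(l, h)"]) (use lQ dens in auto)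
  finally show ?thesis using cost by simp
qed

section \<open>Barycentric coordinates and nodal functions\<close>

lemma affine_interpolation:
  fixes V :: "'a::euclidean_space set" and f :: "'a \<Rightarrow> real"
  assumes "\<not> affine_dependent V"
  shows "\<exists>a g. \<forall>w\<in>V. a + g \<bullet> w = f w"
proof (cases "V = {}")
  case False
  then obtain w0 where w0: "w0 \<in> V" by auto
  let ?B = "(\<lambda>x. - w0 + x) ` (V - {w0})"
  have "independent ?B" using assms affine_dependent_iff_dependent2[OF w0] by simp
  from linear_independent_extend[OF this, of "\<lambda>x. f (w0 + x) - f w0"]
  obtain l where l: "linear l" "\<And>x. x \<in> ?B \<Longrightarrow> l x = f (w0 + x) - f w0" by blast
  define g where "g = adjoint l 1"
  have g: "l x = g \<bullet> x" for x
    using adjoint_works[OF l(1), of x 1] by (simp add: g_def inner_commute)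
  have "(f w0 - g \<bullet> w0) + g \<bullet> w = f w" if "w \<in> V" for w
  proof (cases "w = w0")
    case False
    then have "l (- w0 + w) = f (w0 + (- w0 + w)) - f w0" using that by (intro l(2)) auto
    then show ?thesis by (simp add: g inner_diff_right)
  qed simp
  then show ?thesis by blast
qed simp

text \<open>\<open>bary K v\<close> is the affine function that is 1 at \<open>v\<close> and 0 at the other vertices of \<open>K\<close>
  (the barycentric coordinate of \<open>v\<close> if \<open>v\<close> is a vertex, and zero on \<open>K\<close> otherwise), encoded by
  its constant term and its gradient \<open>bary_grad K v\<close>.\<close>

definition bary_coeffs :: "'a::euclidean_space set \<Rightarrow> 'a \<Rightarrow> real \<times> 'a" where
  "bary_coeffs K v = (SOME p. \<forall>w\<in>vertices_of K. fst p + snd p \<bullet> w = (if w = v then 1 else 0))"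

definition bary :: "'a::euclidean_space set \<Rightarrow> 'a \<Rightarrow> 'a \<Rightarrow> real" where
  "bary K v x = fst (bary_coeffs K v) + snd (bary_coeffs K v) \<bullet> x"

abbreviation bary_grad :: "'a::euclidean_space set \<Rightarrow> 'a \<Rightarrow> 'a" where
  "bary_grad K v \<equiv> snd (bary_coeffs K v)"

context
  fixes K :: "'a::euclidean_space set"
  assumes K: "int DIM('a) simplex K"
begin

lemma simplex_vertices: "\<not> affine_dependent (vertices_of K)" "finite (vertices_of K)"
    "card (vertices_of K) = DIM('a) + 1" "K = convex hull (vertices_of K)"
proof -
  obtain C where C: "\<not> affine_dependent C" "int (card C) = int DIM('a) + 1" "K = convex hull C"
    using K by (auto simp: simplex_def)
  then have "vertices_of K = C"
    by (auto simp: vertices_of_def extreme_point_of_convex_hull_affine_independent)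
  then show "\<not> affine_dependent (vertices_of K)" "finite (vertices_of K)"
    "card (vertices_of K) = DIM('a) + 1" "K = convex hull (vertices_of K)"
    using C aff_independent_finite by auto
qed

lemma simplex_compact_convex: "compact K" "convex K" "vertices_of K \<subseteq> K"
  using simplex_vertices(2,4) finite_imp_compact_convex_hull convex_convex_hull hull_subset by metis+

lemma simplex_interior: "interior K \<noteq> {}" "K = closure (interior K)"
proof -
  have "affine hull K = UNIV" using aff_dim_simplex[OF K] by (simp add: aff_dim_eq_full)
  moreover have "K \<noteq> {}" using simplex_vertices by (metis card.empty convex_hull_eq_empty Suc_eq_plus1 nat.simps(3))
  ultimately show ne: "interior K \<noteq> {}"
    using rel_interior_eq_empty[of K] rel_interior_interior[of K] simplex_compact_convex by auto
  show "K = closure (interior K)"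
    using convex_closure_interior[OF simplex_compact_convex(2) ne] simplex_compact_convex(1)
    by (simp add: compact_imp_closed)
qed

lemma bary_vertex: "w \<in> vertices_of K \<Longrightarrow> bary K v w = (if w = v then 1 else 0)"
proof -
  let ?P = "\<lambda>p. \<forall>w\<in>vertices_of K. fst p + snd p \<bullet> w = (if w = v then 1 else 0 :: real)"
  obtain a g where "?P (a, g)"
    using affine_interpolation[OF simplex_vertices(1), of "\<lambda>w. if w = v then 1 else 0"] by (simp only: fst_conv snd_conv) blast
  then have "?P (bary_coeffs K v)" unfolding bary_coeffs_def by (rule someI[of ?P])
  then show "w \<in> vertices_of K \<Longrightarrow> bary K v w = (if w = v then 1 else 0)"
    unfolding bary_def by blast
qed

lemma affine_eq_on_simplex:
  assumes "\<And>w. w \<in> vertices_of K \<Longrightarrow> a + g \<bullet> w = 0" "x \<in> K"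
  shows "a + g \<bullet> x = (0::real)"
proof -
  have "convex {x. g \<bullet> x = - a}" by (rule convex_hyperplane)
  moreover have "vertices_of K \<subseteq> {x. g \<bullet> x = - a}" using assms(1) by force
  ultimately have "K \<subseteq> {x. g \<bullet> x = - a}" using simplex_vertices(4) hull_minimal by metis
  then show ?thesis using assms(2) by auto
qed

lemma bary_nonneg: "x \<in> K \<Longrightarrow> 0 \<le> bary K v x"
proof -
  have "vertices_of K \<subseteq> {x. bary_grad K v \<bullet> x \<ge> - fst (bary_coeffs K v)}"
    using bary_vertex[of _ v] unfolding bary_def
    by (smt (verit) mem_Collect_eq subsetI)
  moreover have "convex {x. bary_grad K v \<bullet> x \<ge> - fst (bary_coeffs K v)}" by (rule convex_halfspace_ge)
  ultimately have "K \<subseteq> {x. bary_grad K v \<bullet> x \<ge> - fst (bary_coeffs K v)}"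
    using simplex_vertices(4) hull_minimal by metis
  then show "x \<in> K \<Longrightarrow> 0 \<le> bary K v x" by (auto simp: bary_def)
qed

lemma bary_sum: "x \<in> K \<Longrightarrow> (\<Sum>v\<in>vertices_of K. bary K v x) = 1"
proof -
  assume x: "x \<in> K"
  let ?a = "(\<Sum>v\<in>vertices_of K. fst (bary_coeffs K v)) - 1" and ?g = "\<Sum>v\<in>vertices_of K. bary_grad K v"
  have eq: "?a + ?g \<bullet> x = (\<Sum>v\<in>vertices_of K. bary K v x) - 1" for x
    by (simp add: bary_def inner_sum_left sum.distrib)
  have "?a + ?g \<bullet> x = 0"
  proof (rule affine_eq_on_simplex[OF _ x])
    fix w assume "w \<in> vertices_of K"
    then show "?a + ?g \<bullet> w = 0"
      unfolding eq by (simp add: bary_vertex simplex_vertices(2) sum.delta)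
  qed
  then show ?thesis unfolding eq by simp
qed

lemma bary_off_vertex:
  assumes "v \<notin> vertices_of K" "x \<in> K"
  shows "bary K v x = 0"
  unfolding bary_def
  by (rule affine_eq_on_simplex[OF _ assms(2)]) (use bary_vertex[of _ v] assms(1) in \<open>auto simp: bary_def\<close>)

lemma bary_grad_off_vertex:
  assumes "v \<notin> vertices_of K"
  shows "bary_grad K v = 0"
proof -
  obtain x e where e: "0 < e" "ball x e \<subseteq> K" using simplex_interior(1) by (force simp: mem_interior)
  define g where "g = bary_grad K v"
  have "g = 0"
  proof (rule ccontr)
    assume g: "g \<noteq> 0"
    define y where "y = x + (e / 2 / norm g) *\<^sub>R g"
    have "dist x y < e" using e g by (simp add: y_def dist_norm)
    then have "x \<in> K" "y \<in> K" using e by (auto intro: subsetD[OF e(2)])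
    then have "g \<bullet> (y - x) = 0" using bary_off_vertex[OF assms] unfolding bary_def g_def[symmetric]
      by (smt (verit) inner_diff_right)
    then show False using e g by (simp add: y_def)
  qed
  then show ?thesis by (simp add: g_def)
qed

end

lemma bary_le_1:
  assumes "int DIM('a) simplex (K :: 'a::euclidean_space set)" "x \<in> K"
  shows "bary K v x \<le> 1"
proof (cases "v \<in> vertices_of K")
  case True
  have "bary K v x \<le> (\<Sum>v\<in>vertices_of K. bary K v x)"
    using bary_nonneg[OF assms] simplex_vertices(2)[OF assms(1)] True by (intro member_le_sum) auto
  then show ?thesis using bary_sum[OF assms] by simp
qed (use bary_off_vertex[OF assms(1) _ assms(2)] in auto)

context
  fixes \<Omega> :: "'a::euclidean_space set" and \<sigma> :: real and T :: "'a set set"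
  assumes mesh: "mesh \<Omega> \<sigma> T"
begin

lemma mesh_simplex: "K \<in> T \<Longrightarrow> int DIM('a) simplex K"
  and mesh_finite: "finite T" and mesh_Union: "\<Union>T = \<Omega>"
  using mesh by (auto simp: mesh_def triangulation_def)

lemma mesh_face:
  assumes "K \<in> T" "K' \<in> T"
  shows "(K \<inter> K') face_of K" "(K \<inter> K') face_of K'"
proof -
  have *: "\<And>K K'. K \<in> T \<Longrightarrow> K' \<in> T \<Longrightarrow> (K \<inter> K') face_of K"
    using mesh by (auto simp: mesh_def triangulation_def)
  show "(K \<inter> K') face_of K" using * assms by blast
  show "(K \<inter> K') face_of K'" using *[OF assms(2,1)] by (simp add: Int_commute)
qed

lemma finite_vertices: "finite (vertices T)"
  using mesh_finite simplex_vertices(2) mesh_simplex by (auto simp: vertices_def)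

lemma compact_mesh: "compact (\<Union>T)"
  using mesh_finite simplex_compact_convex(1) mesh_simplex by (intro compact_Union) auto

text \<open>The barycentric coordinates of adjacent simplices glue: the common face is the convex hull of its
  extreme points, which are vertices of both simplices.\<close>

lemma bary_agree:
  assumes "K \<in> T" "K' \<in> T" "x \<in> K" "x \<in> K'"
  shows "bary K v x = bary K' v x"
proof -
  let ?F = "K \<inter> K'" and ?E = "{w. w extreme_point_of (K \<inter> K')}"
  have hull: "?F = convex hull ?E"
    using simplex_compact_convex[OF mesh_simplex] assms
    by (intro Krein_Milman_Minkowski) (auto intro: compact_Int convex_Int)
  have "?E \<subseteq> vertices_of K" "?E \<subseteq> vertices_of K'"
    using extreme_point_of_face[OF mesh_face(1)[OF assms(1,2)]] extreme_point_of_face[OF mesh_face(2)[OF assms(1,2)]]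
    by (auto simp: vertices_of_def)
  then have eq: "bary K v w = bary K' v w" if "w \<in> ?E" for w
    using bary_vertex[OF mesh_simplex[OF assms(1)], of w v] bary_vertex[OF mesh_simplex[OF assms(2)], of w v] that
    by (simp add: subset_iff)
  let ?g = "bary_grad K v - bary_grad K' v" and ?a = "fst (bary_coeffs K v) - fst (bary_coeffs K' v)"
  have "?E \<subseteq> {x. ?g \<bullet> x = - ?a}"
    using eq unfolding bary_def by (auto simp: inner_diff_left) (smt (verit))
  then have "?F \<subseteq> {x. ?g \<bullet> x = - ?a}"
    using hull hull_minimal convex_hyperplane by metis
  then have "?g \<bullet> x = - ?a" using assms by blast
  then show ?thesis by (simp add: bary_def inner_diff_left)
qed

text \<open>Existence and uniqueness of the nodal function, which its definition by a description operator
  presupposes.\<close>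

lemma nodal_properties:
  shows nodal_eq_bary: "\<And>K x. K \<in> T \<Longrightarrow> x \<in> K \<Longrightarrow> nodal T v x = bary K v x"
    and nodal_outside: "\<And>x. x \<notin> \<Omega> \<Longrightarrow> nodal T v x = 0"
    and nodal_continuous: "continuous_on \<Omega> (nodal T v)"
proof -
  let ?P = "\<lambda>f. continuous_on (\<Union>T) f \<and> (\<forall>K\<in>T. \<exists>a g. \<forall>x\<in>K. f x = a + g \<bullet> x) \<and>
     (\<forall>w\<in>vertices T. f w = (if w = v then 1 else 0)) \<and> (\<forall>x. x \<notin> \<Union>T \<longrightarrow> f x = (0::real))"
  define f where "f x = (if x \<in> \<Union>T then bary (SOME K. K \<in> T \<and> x \<in> K) v x else 0)" for x
  have f: "f x = bary K v x" if "K \<in> T" "x \<in> K" for K x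
  proof -
    have "(SOME K. K \<in> T \<and> x \<in> K) \<in> T \<and> x \<in> (SOME K. K \<in> T \<and> x \<in> K)"
      by (rule someI[where P = "\<lambda>K. K \<in> T \<and> x \<in> K"]) (use that in simp)
    then have "bary (SOME K. K \<in> T \<and> x \<in> K) v x = bary K v x"
      using that by (intro bary_agree) auto
    then show ?thesis using that unfolding f_def by (subst if_P) auto
  qed
  have cont: "continuous_on (\<Union>T) f"
  proof (rule continuous_on_closed_Union[of T "\<lambda>K. K", simplified])
    fix K assume K: "K \<in> T"
    show "closed K" using simplex_compact_convex(1)[OF mesh_simplex[OF K]] by (rule compact_imp_closed)
    have "continuous_on K (bary K v)" unfolding bary_def by (intro continuous_intros)
    then show "continuous_on K f" using f K by (simp cong: continuous_on_cong)
  qed (rule mesh_finite)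
  have fP: "?P f"
  proof (intro conjI cont ballI allI impI)
    fix K assume "K \<in> T"
    then show "\<exists>a g. \<forall>x\<in>K. f x = a + g \<bullet> x" using f unfolding bary_def by blast
  next
    fix w assume "w \<in> vertices T"
    then obtain K where K: "K \<in> T" "w \<in> vertices_of K" by (auto simp: vertices_def)
    then have "w \<in> K" using simplex_compact_convex(3)[OF mesh_simplex[OF K(1)]] by blast
    then show "f w = (if w = v then 1 else 0)"
      using f[OF K(1), of w] bary_vertex[OF mesh_simplex[OF K(1)] K(2), of v] by simp
  qed (simp add: f_def)
  have uniq: "g = f" if gP: "?P g" for g
  proof
    note g1 = gP[THEN conjunct2, THEN conjunct1]
      and g2 = gP[THEN conjunct2, THEN conjunct2, THEN conjunct1]
      and g3 = gP[THEN conjunct2, THEN conjunct2, THEN conjunct2]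
    fix x
    show "g x = f x"
    proof (cases "x \<in> \<Union>T")
      case True
      then obtain K where K: "K \<in> T" "x \<in> K" by auto
      obtain a h where ah': "\<forall>x\<in>K. g x = a + h \<bullet> x" using bspec[OF g1 K(1)] by (elim exE)
      then have ah: "g x = a + h \<bullet> x" if "x \<in> K" for x using that by (rule bspec)
      let ?a = "a - fst (bary_coeffs K v)" and ?h = "h - bary_grad K v"
      have "?a + ?h \<bullet> x = 0"
      proof (rule affine_eq_on_simplex[OF mesh_simplex[OF K(1)] _ K(2)])
        fix w assume w: "w \<in> vertices_of K"
        then have "w \<in> K" using simplex_compact_convex(3)[OF mesh_simplex[OF K(1)]] by blast
        moreover have "w \<in> vertices T" using w K by (auto simp: vertices_def)
        ultimately have "a + h \<bullet> w = bary K v w"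
          using ah[of w] bspec[OF g2, of w] bary_vertex[OF mesh_simplex[OF K(1)] w] by simp
        then show "?a + ?h \<bullet> w = 0" by (simp add: bary_def inner_diff_left)
      qed
      then show ?thesis using ah[OF K(2)] f[OF K] by (simp add: bary_def inner_diff_left)
    next
      case False
      then show ?thesis using g3 by (simp add: f_def)
    qed
  qed
  have "nodal T v = f" unfolding nodal_def by (rule the_equality[of ?P, OF fP uniq])
  then have eq: "nodal T v = f" .
  show "\<And>K x. K \<in> T \<Longrightarrow> x \<in> K \<Longrightarrow> nodal T v x = bary K v x"
    unfolding eq by (rule f)
  show "\<And>x. x \<notin> \<Omega> \<Longrightarrow> nodal T v x = 0" unfolding eq f_def mesh_Union by simp
  show "continuous_on \<Omega> (nodal T v)" unfolding eq using cont mesh_Union by simp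
qed

lemma nodal_bounds: "0 \<le> nodal T v x" "nodal T v x \<le> 1"
proof -
  have "0 \<le> nodal T v x \<and> nodal T v x \<le> 1"
  proof (cases "x \<in> \<Omega>")
    case True
    then obtain K where K: "K \<in> T" "x \<in> K" using mesh_Union by auto
    then show ?thesis using bary_nonneg bary_le_1 mesh_simplex nodal_eq_bary by metis
  qed (simp add: nodal_outside)
  then show "0 \<le> nodal T v x" "nodal T v x \<le> 1" by auto
qed

lemma nodal_sum: "K \<in> T \<Longrightarrow> x \<in> K \<Longrightarrow> (\<Sum>v\<in>vertices_of K. nodal T v x) = 1"
  using bary_sum[OF mesh_simplex] nodal_eq_bary by simp

lemma nodal_sum_le: "(\<Sum>v\<in>vertices T. nodal T v x) \<le> 1"
proof (cases "x \<in> \<Omega>")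
  case True
  then obtain K where K: "K \<in> T" "x \<in> K" using mesh_Union by auto
  have "(\<Sum>v\<in>vertices T. nodal T v x) = (\<Sum>v\<in>vertices_of K. nodal T v x)"
    using K finite_vertices bary_off_vertex[OF mesh_simplex] nodal_eq_bary
    by (intro sum.mono_neutral_right) (auto simp: vertices_def)
  then show ?thesis using nodal_sum[OF K] by simp
qed (simp add: nodal_outside)

lemma nodal_indicator: "(\<lambda>x. indicator \<Omega> x *\<^sub>R nodal T v x) = nodal T v"
proof
  show "indicator \<Omega> x *\<^sub>R nodal T v x = nodal T v x" for x
    by (cases "x \<in> \<Omega>") (simp_all add: nodal_outside)
qed

lemma nodal_measurable [measurable]: "nodal T v \<in> borel_measurable borel"
proof -
  have "(\<lambda>x. indicator \<Omega> x *\<^sub>R nodal T v x) \<in> borel_measurable borel"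
    using compact_mesh mesh_Union nodal_continuous
    by (intro borel_measurable_continuous_on_indicator) (auto intro: borel_compact)
  then show ?thesis by (simp only: nodal_indicator)
qed

lemma nodal_integrable: "integrable lborel (nodal T v)"
proof -
  have "set_integrable lborel \<Omega> (nodal T v)"
    unfolding set_integrable_def using compact_mesh mesh_Union nodal_continuous
    by (intro borel_integrable_compact) auto
  then show ?thesis unfolding set_integrable_def by (simp only: nodal_indicator)
qed

lemma patch_vol_eq: "patch_vol T v = (LINT x|lborel. nodal T v x)"
proof -
  have "(nodal T v has_integral (LINT x|lborel. nodal T v x)) UNIV"
    by (rule has_integral_integral_lborel[OF nodal_integrable])
  then have "(nodal T v has_integral (LINT x|lborel. nodal T v x)) \<Omega>"
  proof -
    have "(\<lambda>x. if x \<in> \<Omega> then nodal T v x else 0) = nodal T v" by (auto simp: nodal_outside)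
    then show "(nodal T v has_integral i) UNIV \<Longrightarrow> (nodal T v has_integral i) \<Omega>" for i
      using has_integral_restrict_UNIV[of \<Omega> "nodal T v" i] by simp
  qed
  then show ?thesis unfolding patch_vol_def mesh_Union by (rule integral_unique)
qed

lemma patch_vol_pos:
  assumes "v \<in> vertices T"
  shows "0 < patch_vol T v"
proof -
  obtain K where K: "K \<in> T" "v \<in> vertices_of K" using assms by (auto simp: vertices_def)
  note sK = mesh_simplex[OF K(1)]
  define H where "H = {x. bary K v x > 1/2}"
  have "open H" unfolding H_def bary_def by (intro open_Collect_less continuous_intros)
  moreover have "v \<in> H" using bary_vertex[OF sK K(2), of v] by (simp add: H_def)
  moreover have "v \<in> closure (interior K)"
    using simplex_interior(2)[OF sK] simplex_compact_convex(3)[OF sK] K(2) by auto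
  ultimately obtain x where x: "x \<in> H" "x \<in> interior K"
    using open_Int_closure_eq_empty[of H "interior K"] by blast
  have "open (H \<inter> interior K)" using \<open>open H\<close> by auto
  then obtain e where e: "0 < e" "ball x e \<subseteq> H \<inter> interior K" using x by (meson IntI openE)
  have "1/2 * indicator (ball x e) y \<le> nodal T v y" for y
  proof (cases "y \<in> ball x e")
    case True
    then have "y \<in> K" "y \<in> H" using e interior_subset[of K] by blast+
    then show ?thesis using nodal_eq_bary[OF K(1), of y v] True by (simp add: H_def)
  qed (use nodal_bounds(1)[of v y] in simp)
  moreover have "integrable lborel (\<lambda>y. 1/2 * indicator (ball x e) y :: real)"
    by (intro integrable_mult_right integrable_real_indicator) (auto simp: emeasure_bounded_finite[unfolded infinity_ennreal_def])
  ultimately have "(LINT y|lborel. 1/2 * indicator (ball x e) y) \<le> (LINT y|lborel. nodal T v y)"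
    by (intro integral_mono nodal_integrable) auto
  moreover have "(LINT y|lborel. 1/2 * indicator (ball x e) y) = 1/2 * measure lborel (ball x e)" by simp
  moreover have "0 < measure lborel (ball x e)" using e(1) by (rule content_ball_pos)
  ultimately show ?thesis unfolding patch_vol_eq by linarith
qed

text \<open>The only consequence of quasi-uniformity that is needed: the support of a nodal function lies in a
  ball of radius \<open>\<sigma>\<close>, and the simplex contains a ball of comparable size.\<close>

lemma patch_vol_le:
  assumes K: "K \<in> T" "v \<in> vertices_of K" and r: "0 < c" "c * \<sigma> \<le> 2 * r" "ball x r \<subseteq> K" and \<sigma>: "0 < \<sigma>"
  shows "patch_vol T v \<le> (2 / c) ^ DIM('a) * measure lborel K"
proof -
  have "nodal T v y \<le> indicator (cball v \<sigma>) y" for y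
  proof (cases "y \<in> \<Omega> \<and> nodal T v y \<noteq> 0")
    case True
    then obtain K' where K': "K' \<in> T" "y \<in> K'" using mesh_Union by auto
    note sK = mesh_simplex[OF K'(1)]
    have "v \<in> vertices_of K'" using True bary_off_vertex[OF sK _ K'(2), of v] nodal_eq_bary[OF K', of v] by auto
    then have "v \<in> K'" using simplex_compact_convex(3)[OF sK] by auto
    then have "dist v y \<le> diameter K'"
      using diameter_bounded_bound[OF compact_imp_bounded[OF simplex_compact_convex(1)[OF sK]]] K'(2) by blast
    also have "\<dots> \<le> \<sigma>" using mesh mesh_finite K'(1) by (auto simp: mesh_def)
    finally show ?thesis using nodal_bounds(2)[of v y] by simp
  qed (auto simp: nodal_outside)
  then have "patch_vol T v \<le> (LINT y|lborel. indicator (cball v \<sigma>) y)"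
    unfolding patch_vol_eq
    by (intro integral_mono nodal_integrable integrable_real_indicator) (auto simp: emeasure_bounded_finite[unfolded infinity_ennreal_def])
  also have "\<dots> = measure lborel (ball (0 :: 'a) 1) * \<sigma> ^ DIM('a)"
    using \<sigma> content_ball_conv_unit_ball[of \<sigma> v] by (simp add: content_cball_conv_ball)
  also have "\<dots> \<le> measure lborel (ball (0 :: 'a) 1) * (2 / c * r) ^ DIM('a)"
    using r \<sigma> by (intro mult_left_mono power_mono) (auto simp: field_simps)
  also have "\<dots> = (2 / c) ^ DIM('a) * measure lborel (ball x r)"
  proof -
    have "0 < c * \<sigma>" using r(1) \<sigma> by simp
    then have "0 \<le> r" using r(2) by linarith
    then show ?thesis using content_ball_conv_unit_ball[of r x] by (simp add: power_mult_distrib power_divide)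
  qed
  also have "\<dots> \<le> (2 / c) ^ DIM('a) * measure lborel K"
    using r simplex_compact_convex(1)[OF mesh_simplex[OF K(1)]]
    by (intro mult_left_mono measure_mono_fmeasurable) (auto simp: fmeasurable_compact)
  finally show ?thesis .
qed

lemma integral_grad_nodal:
  assumes K: "K \<in> T"
  shows "integral K (grad (nodal T v)) = measure lborel K *\<^sub>R bary_grad K v"
proof -
  note cK = simplex_compact_convex(1,2)[OF mesh_simplex[OF K]]
  have g: "grad (nodal T v) x = bary_grad K v" if "x \<in> interior K" for x
  proof -
    have "(bary K v has_derivative (\<lambda>h. bary_grad K v \<bullet> h)) (at x)"
      unfolding bary_def by (auto intro!: derivative_eq_intros)
    then have "(nodal T v has_derivative (\<lambda>h. bary_grad K v \<bullet> h)) (at x)"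
    proof (rule has_derivative_transform_within_open[of _ _ _ _ "interior K"])
      show "bary K v y = nodal T v y" if "y \<in> interior K" for y
        using that nodal_eq_bary[OF K, of y v] interior_subset by fastforce
    qed (use that in auto)
    then have "GDERIV (nodal T v) x :> bary_grad K v" by (simp add: gderiv_def inner_commute)
    moreover have "g = bary_grad K v" if "GDERIV (nodal T v) x :> g" for g
    proof -
      have "(\<lambda>h. h \<bullet> g) = (\<lambda>h. h \<bullet> bary_grad K v)"
        using that calculation unfolding gderiv_def by (rule has_derivative_unique)
      then show ?thesis by (metis vector_eq_ldot)
    qed
    ultimately show ?thesis unfolding grad_def by (rule the_equality)
  qed
  have "integral K (grad (nodal T v)) = integral K (\<lambda>x. bary_grad K v)"
  proof (rule integral_spike[of "frontier K"])
    show "negligible (frontier K)" using cK(2) by (rule negligible_convex_frontier)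
    show "bary_grad K v = grad (nodal T v) x" if "x \<in> K - frontier K" for x
      using that g[of x] cK(1) by (auto simp: frontier_def compact_imp_closed)
  qed
  also have "\<dots> = measure lborel K *\<^sub>R bary_grad K v"
  proof -
    have "((\<lambda>x. 1) has_integral measure lborel K) K"
      using cK(1) by (intro has_integral_measure_lborel emeasure_compact_finite borel_compact)
    then have "((\<lambda>x. 1 *\<^sub>R bary_grad K v) has_integral measure lborel K *\<^sub>R bary_grad K v) K"
      by (rule has_integral_scaleR_left)
    then show ?thesis by (simp add: integral_unique)
  qed
  finally show ?thesis .
qed

text \<open>The defining relation of \<^const>\<open>disc_div\<close> tested with the indicator of a vertex.\<close>

lemma disc_div_formula:
  assumes v: "v \<in> vertices T"
  shows "patch_vol T v * disc_div T q v = - (\<Sum>K\<in>T. measure lborel K * (q K \<bullet> bary_grad K v))"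
proof -
  define G where "G w = (\<Sum>K\<in>T. measure lborel K * (q K \<bullet> bary_grad K w))" for w
  define d where "d = (\<lambda>w\<in>vertices T. - G w / patch_vol T w)"
  let ?P = "\<lambda>d. d \<in> X_space T \<and> (\<forall>a\<in>X_space T.
     (\<Sum>v\<in>vertices T. patch_vol T v * a v * d v) =
     - (\<Sum>K\<in>T. \<Sum>v\<in>vertices_of K. a v * (q K \<bullet> integral K (grad (nodal T v)))))"
  have R: "(\<Sum>K\<in>T. \<Sum>v\<in>vertices_of K. a v * (q K \<bullet> integral K (grad (nodal T v)))) = (\<Sum>v\<in>vertices T. a v * G v)" for a
  proof -
    have "(\<Sum>v\<in>vertices_of K. a v * (q K \<bullet> integral K (grad (nodal T v)))) =
        (\<Sum>v\<in>vertices T. a v * (measure lborel K * (q K \<bullet> bary_grad K v)))" if K: "K \<in> T" for K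
    proof -
      have "(\<Sum>v\<in>vertices_of K. a v * (q K \<bullet> integral K (grad (nodal T v)))) =
          (\<Sum>v\<in>vertices_of K. a v * (measure lborel K * (q K \<bullet> bary_grad K v)))"
        by (simp add: integral_grad_nodal[OF K])
      also have "\<dots> = (\<Sum>v\<in>vertices T. a v * (measure lborel K * (q K \<bullet> bary_grad K v)))"
        using finite_vertices K bary_grad_off_vertex[OF mesh_simplex[OF K]]
        by (intro sum.mono_neutral_left) (auto simp: vertices_def)
      finally show ?thesis .
    qed
    then have "(\<Sum>K\<in>T. \<Sum>v\<in>vertices_of K. a v * (q K \<bullet> integral K (grad (nodal T v)))) =
        (\<Sum>K\<in>T. \<Sum>v\<in>vertices T. a v * (measure lborel K * (q K \<bullet> bary_grad K v)))" by simp
    also have "\<dots> = (\<Sum>v\<in>vertices T. a v * G v)"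
      unfolding G_def by (subst sum.swap) (simp add: sum_distrib_left)
    finally show ?thesis .
  qed
  have dP: "?P d"
  proof (intro conjI ballI)
    show "d \<in> X_space T" by (simp add: d_def X_space_def)
    fix a
    have "patch_vol T v * a v * d v = - (a v * G v)" if "v \<in> vertices T" for v
      using patch_vol_pos[OF that] that by (simp add: d_def)
    then have "(\<Sum>v\<in>vertices T. patch_vol T v * a v * d v) = - (\<Sum>v\<in>vertices T. a v * G v)"
      by (simp add: sum_negf)
    then show "(\<Sum>v\<in>vertices T. patch_vol T v * a v * d v) =
      - (\<Sum>K\<in>T. \<Sum>v\<in>vertices_of K. a v * (q K \<bullet> integral K (grad (nodal T v))))"
      by (simp only: R)
  qed
  have uniq: "e = d" if e: "?P e" for e
  proof
    fix w
    show "e w = d w"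
    proof (cases "w \<in> vertices T")
      case True
      let ?a = "\<lambda>v\<in>vertices T. if v = w then 1 else (0::real)"
      have pick: "(\<Sum>v\<in>vertices T. patch_vol T v * ?a v * x v) = patch_vol T w * x w" for x
      proof -
        have "(\<Sum>v\<in>vertices T. patch_vol T v * ?a v * x v) = (\<Sum>v\<in>vertices T. if v = w then patch_vol T v * x v else 0)"
          by (intro sum.cong) auto
        then show ?thesis using True finite_vertices by simp
      qed
      have a: "?a \<in> X_space T" by (simp add: X_space_def)
      have "patch_vol T w * e w = patch_vol T w * d w"
        using bspec[OF conjunct2[OF e] a] bspec[OF conjunct2[OF dP] a] unfolding pick by simp
      then show ?thesis using patch_vol_pos[OF True] by simp
    next
      case False
      then show ?thesis using e dP by (auto simp: X_space_def PiE_def extensional_def)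
    qed
  qed
  have "disc_div T q = d" unfolding disc_div_def by (rule the_equality[of ?P, OF dP uniq])
  then show ?thesis using v patch_vol_pos[OF v] by (simp add: d_def G_def)
qed

end

section \<open>Discrete fluxes from couplings\<close>

lemma segment_in_convex_interval:
  fixes K :: "'a::euclidean_space set"
  assumes "compact K" "convex K"
  shows "\<exists>l u::real. {s \<in> {0..1}. y + s *\<^sub>R d \<in> K} = {l..u}"
proof -
  let ?I = "{s \<in> {0..1}. y + s *\<^sub>R d \<in> K}"
  have "closed ((\<lambda>s. y + s *\<^sub>R d) -` K \<inter> {0..1})"
    by (intro continuous_closed_preimage continuous_intros compact_imp_closed assms(1)) auto
  moreover have "(\<lambda>s. y + s *\<^sub>R d) -` K \<inter> {0..1} = ?I" by auto
  ultimately have cI: "compact ?I" by (auto intro: bounded_subset[of "{0..1}"] simp: compact_eq_bounded_closed)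
  have "convex ?I"
  proof (rule convexI)
    fix s t u v :: real
    assume *: "s \<in> ?I" "t \<in> ?I" "0 \<le> u" "0 \<le> v" "u + v = 1"
    have "u *\<^sub>R (y + s *\<^sub>R d) + v *\<^sub>R (y + t *\<^sub>R d) \<in> K"
      using * assms(2) by (intro convexD) auto
    moreover have "u *\<^sub>R (y + s *\<^sub>R d) + v *\<^sub>R (y + t *\<^sub>R d) = (u + v) *\<^sub>R y + (u * s + v * t) *\<^sub>R d"
      by (simp add: algebra_simps)
    ultimately have "y + (u * s + v * t) *\<^sub>R d \<in> K" using * by simp
    moreover have "u * s + v * t \<in> {0..1}"
      using * convexD[of "{0..1::real}" s t u v] by simp
    ultimately show "u *\<^sub>R s + v *\<^sub>R t \<in> ?I" by simp
  qed
  then have "connected ?I" by (rule convex_connected)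
  then show ?thesis using cI connected_compact_interval_1[of ?I] by auto
qed

context
  fixes \<Omega> :: "'a::euclidean_space set" and \<sigma> :: real and T :: "'a set set"
  assumes mesh: "mesh \<Omega> \<sigma> T"
begin

text \<open>The simplices overlap in faces; assigning every point to the first simplex that contains it gives a
  Borel partition of \<open>\<Omega>\<close>.\<close>

lemma mesh_cells:
  obtains C :: "'a set \<Rightarrow> 'a set" where "\<And>K. K \<in> T \<Longrightarrow> C K \<subseteq> K" "\<And>K. K \<in> T \<Longrightarrow> C K \<in> sets borel"
    "\<And>x. x \<in> \<Omega> \<Longrightarrow> \<exists>!K. K \<in> T \<and> x \<in> C K"
proof -
  obtain n and f :: "nat \<Rightarrow> 'a set" where f: "T = f ` {i. i < n}" "inj_on f {i. i < n}"
    using finite_imp_nat_seg_image_inj_on[OF mesh_finite[OF mesh]] by blast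
  define ix where "ix K = (THE i. i < n \<and> f i = K)" for K
  have ix: "ix (f i) = i" if "i < n" for i
    unfolding ix_def using f(2) that by (intro the_equality) (auto dest: inj_onD)
  define C where "C K = K - (\<Union>i<ix K. f i)" for K
  have bT: "K \<in> sets borel" if "K \<in> T" for K
    using simplex_compact_convex(1)[OF mesh_simplex[OF mesh that]] by (rule borel_compact)
  show ?thesis
  proof (rule that[of C])
    fix K assume K: "K \<in> T"
    show "C K \<subseteq> K" by (auto simp: C_def)
    obtain i where i: "i < n" "K = f i" using K f by auto
    have "f j \<in> sets borel" if "j < i" for j using that i f by (intro bT) auto
    then show "C K \<in> sets borel" unfolding C_def using bT[OF K] i by (auto simp: ix intro!: sets.Diff)
  next
    fix x assume "x \<in> \<Omega>"
    then have "\<exists>i. i < n \<and> x \<in> f i" using mesh_Union[OF mesh] f by auto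
    define i where "i = (LEAST i. i < n \<and> x \<in> f i)"
    have i: "i < n" "x \<in> f i" using LeastI_ex[OF \<open>\<exists>i. i < n \<and> x \<in> f i\<close>] by (auto simp: i_def)
    have low: "x \<notin> f j" if "j < i" for j
      using not_less_Least[of j "\<lambda>i. i < n \<and> x \<in> f i"] that i by (auto simp: i_def)
    show "\<exists>!K. K \<in> T \<and> x \<in> C K"
    proof (rule ex1I[of _ "f i"])
      show "f i \<in> T \<and> x \<in> C (f i)" using i low f by (auto simp: C_def ix)
      fix K assume K: "K \<in> T \<and> x \<in> C K"
      then obtain j where j: "j < n" "K = f j" using f by auto
      then have "x \<in> f j" "\<forall>k<j. x \<notin> f k" using K by (auto simp: C_def ix)
      then have "j = i" using low i by (meson linorder_neqE_nat)
      then show "K = f i" using j by simp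
    qed
  qed
qed

text \<open>Along a segment a nodal function is piecewise affine. Outside the finitely many endpoints of the
  parameter intervals in which the segment visits the simplices, its derivative is the directional
  derivative in any simplex that contains the point. This stays true if the segment runs inside a
  common face, so that no exceptional segments have to be discarded.\<close>

lemma nodal_along_segment:
  fixes y y' :: 'a and \<alpha> \<beta> :: real
  assumes seg: "closed_segment y y' \<subseteq> \<Omega>"
    and C: "\<And>K. K \<in> T \<Longrightarrow> C K \<subseteq> K" "\<And>K. K \<in> T \<Longrightarrow> C K \<in> sets borel"
    "\<And>x. x \<in> \<Omega> \<Longrightarrow> \<exists>!K. K \<in> T \<and> x \<in> C K"
  shows "(LINT s|unit_time. (\<alpha> + \<beta> * s) * (\<Sum>K\<in>T. indicator (C K) (y + s *\<^sub>R (y' - y)) * (bary_grad K v \<bullet> (y' - y)))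
            + \<beta> * nodal T v (y + s *\<^sub>R (y' - y)))
    = (\<alpha> + \<beta>) * nodal T v y' - \<alpha> * nodal T v y"
proof -
  define d where "d = y' - y"
  define x where "x s = y + s *\<^sub>R d" for s :: real
  define S where "S s = (\<Sum>K\<in>T. indicator (C K) (x s) * (bary_grad K v \<bullet> d))" for s
  define F where "F s = (\<alpha> + \<beta> * s) * nodal T v (x s)" for s
  define f where "f s = (\<alpha> + \<beta> * s) * S s + \<beta> * nodal T v (x s)" for s
  have x\<Omega>: "x s \<in> \<Omega>" if "s \<in> {0..1}" for s
    using seg that by (force simp: x_def d_def closed_segment_def algebra_simps)
  have "\<forall>K\<in>T. \<exists>l u. {s \<in> {0..1}. x s \<in> K} = {l..u}"
    unfolding x_def using segment_in_convex_interval simplex_compact_convex(1,2)[OF mesh_simplex[OF mesh]] by blast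
  then obtain l u where lu: "\<And>K. K \<in> T \<Longrightarrow> {s \<in> {0..1}. x s \<in> K} = {l K..u K}" by metis
  define X where "X = l ` T \<union> u ` T"
  have finX: "finite X" using mesh_finite[OF mesh] by (simp add: X_def)
  have der: "(F has_vector_derivative f s) (at s)" if s: "s \<in> {0<..<1} - X" for s
  proof -
    have s01: "s \<in> {0..1}" using s by auto
    obtain K where K: "K \<in> T" "x s \<in> C K" and uq: "\<And>K'. K' \<in> T \<Longrightarrow> x s \<in> C K' \<Longrightarrow> K' = K"
      using C(3)[OF x\<Omega>[OF s01]] by blast
    have "S s = (\<Sum>K'\<in>T. if K' = K then bary_grad K' v \<bullet> d else 0)"
      unfolding S_def
    proof (intro sum.cong refl)
      fix K' assume K': "K' \<in> T"
      show "indicator (C K') (x s) * (bary_grad K' v \<bullet> d) = (if K' = K then bary_grad K' v \<bullet> d else 0)"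
        using uq[OF K'] K(2) by (cases "x s \<in> C K'") auto
    qed
    then have Ss: "S s = bary_grad K v \<bullet> d" using K mesh_finite[OF mesh] by simp
    have "s \<in> {l K..u K}" using lu[OF K(1)] K C(1) s01 by blast
    then have sI: "s \<in> {l K<..<u K}" using s K by (auto simp: X_def less_le)
    have xK: "x t \<in> K" if "t \<in> {l K<..<u K}" for t
    proof -
      have "t \<in> {l K..u K}" using that by auto
      then show ?thesis using lu[OF K(1)] by blast
    qed
    have nx: "nodal T v (x t) = bary K v (x t)" if "t \<in> {l K<..<u K}" for t
      using nodal_eq_bary[OF mesh K(1) xK[OF that]] .
    have "((\<lambda>t. bary K v (x t)) has_real_derivative bary_grad K v \<bullet> d) (at s)"
    proof -
      have "(\<lambda>t. bary K v (x t)) = (\<lambda>t. bary K v y + t * (bary_grad K v \<bullet> d))"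
        by (auto simp: bary_def x_def inner_add_right)
      then show ?thesis by (auto intro!: derivative_eq_intros)
    qed
    then have "((\<lambda>t. (\<alpha> + \<beta> * t) * bary K v (x t)) has_real_derivative
        (\<alpha> + \<beta> * s) * (bary_grad K v \<bullet> d) + \<beta> * bary K v (x s)) (at s)"
      by (auto intro!: derivative_eq_intros)
    then have "((\<lambda>t. (\<alpha> + \<beta> * t) * bary K v (x t)) has_vector_derivative f s) (at s)"
      using nx[OF sI] by (simp add: f_def Ss has_real_derivative_iff_has_vector_derivative)
    then show ?thesis
      by (rule has_vector_derivative_transform_within_open[where S = "{l K<..<u K}"])
         (use sI nx in \<open>auto simp: F_def\<close>)
  qed
  have contF: "continuous_on {0..1} F"
    unfolding F_def x_def
    by (intro continuous_intros continuous_on_compose2[OF nodal_continuous[OF mesh]])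
       (use x\<Omega> in \<open>auto simp: x_def\<close>)
  have "(f has_integral F 1 - F 0) {0..1}"
    by (rule fundamental_theorem_of_calculus_interior_strong[OF finX _ _ contF]) (use der in auto)
  then have I: "integral {0..1} f = F 1 - F 0" by (rule integral_unique)
  have xm[measurable]: "x \<in> borel_measurable borel"
    unfolding x_def by (intro borel_measurable_continuous_onI continuous_intros)
  have Sm[measurable]: "S \<in> borel_measurable borel"
  proof -
    have "(\<lambda>s. indicator (C K) (x s) * (bary_grad K v \<bullet> d)) \<in> borel_measurable borel" if "K \<in> T" for K
      using C(2)[OF that] by measurable
    then show ?thesis unfolding S_def by (intro borel_measurable_sum) auto
  qed
  note nodal_measurable[OF mesh, measurable]
  have fm[measurable]: "f \<in> borel_measurable borel" unfolding f_def by measurable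
  have Sb: "\<bar>S s\<bar> \<le> (\<Sum>K\<in>T. \<bar>bary_grad K v \<bullet> d\<bar>)" for s
    unfolding S_def by (rule sum_abs[THEN order.trans], intro sum_mono) (auto simp: indicator_def)
  have fb: "\<bar>indicator {0..1} s *\<^sub>R f s\<bar> \<le> (\<bar>\<alpha>\<bar> + \<bar>\<beta>\<bar>) * (\<Sum>K\<in>T. \<bar>bary_grad K v \<bullet> d\<bar>) + \<bar>\<beta>\<bar>" for s
  proof (cases "s \<in> {0..1}")
    case True
    have "\<bar>\<beta> * s\<bar> \<le> \<bar>\<beta>\<bar> * 1" using True unfolding abs_mult by (intro mult_left_mono) auto
    then have "\<bar>\<alpha> + \<beta> * s\<bar> \<le> \<bar>\<alpha>\<bar> + \<bar>\<beta>\<bar>" by linarith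
    then have "\<bar>(\<alpha> + \<beta> * s) * S s\<bar> \<le> (\<bar>\<alpha>\<bar> + \<bar>\<beta>\<bar>) * (\<Sum>K\<in>T. \<bar>bary_grad K v \<bullet> d\<bar>)"
      unfolding abs_mult using Sb by (intro mult_mono) auto
    moreover have "\<bar>\<beta> * nodal T v (x s)\<bar> \<le> \<bar>\<beta>\<bar> * 1"
      unfolding abs_mult using nodal_bounds[OF mesh, of v "x s"] by (intro mult_left_mono) auto
    ultimately show ?thesis using True unfolding f_def by simp
  qed (auto intro!: add_nonneg_nonneg mult_nonneg_nonneg sum_nonneg)
  have "set_integrable lborel {0..1} f"
    unfolding set_integrable_def
  proof (rule Bochner_Integration.integrable_bound)
    let ?B = "(\<bar>\<alpha>\<bar> + \<bar>\<beta>\<bar>) * (\<Sum>K\<in>T. \<bar>bary_grad K v \<bullet> d\<bar>) + \<bar>\<beta>\<bar>"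
    show "integrable lborel (\<lambda>s::real. indicator {0..1} s * ?B)" by simp
    show "AE s in lborel. norm (indicator {0..1} s *\<^sub>R f s) \<le> norm (indicator {0..1} s * ?B)"
    proof (rule AE_I2)
      fix s show "norm (indicator {0..1} s *\<^sub>R f s) \<le> norm (indicator {0..1} s * ?B)"
        using fb[of s] by (cases "s \<in> {0..1}") auto
    qed
  qed measurable
  then have "(LINT s|unit_time. f s) = integral {0..1} f"
    by (simp add: integral_unit_time set_borel_integral_eq_integral(2)[symmetric] set_lebesgue_integral_def)
  then show ?thesis unfolding I by (simp add: f_def S_def F_def x_def d_def)
qed

text \<open>Let a pair \<open>(y, y')\<close> be drawn from \<open>\<gamma>\<close> and a time \<open>t\<close> from \<open>[0, 1]\<close>. Then \<open>M\<close> samples the law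
  of \<open>x = y + t (y' - y)\<close>, and \<open>q0\<close>, \<open>q1\<close> are the cell averages of \<open>(1 - t) (y' - y)\<close> and
  \<open>t (y' - y)\<close> at \<open>x\<close>. They transport the first marginal to \<open>M\<close> and \<open>M\<close> to the second marginal,
  and on each simplex they are bounded by the vertex values of \<open>M\<close>.\<close>

lemma discrete_fluxes_of_coupling:
  fixes \<gamma> :: "('a \<times> 'a) measure" and \<delta> \<kappa> :: real
  assumes plan: "displacement_plan \<Omega> \<delta> \<gamma>" and \<delta>: "0 \<le> \<delta>"
    and \<kappa>: "\<And>K v. K \<in> T \<Longrightarrow> v \<in> vertices_of K \<Longrightarrow> patch_vol T v \<le> \<kappa> * measure lborel K"
  obtains M :: "'a \<Rightarrow> real" and q0 q1 :: "'a set \<Rightarrow> 'a" where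
    "\<And>v. v \<in> vertices T \<Longrightarrow> 0 \<le> M v"
    "\<And>v. v \<in> vertices T \<Longrightarrow> patch_vol T v * M v - (LINT p|\<gamma>. nodal T v (fst p)) =
        (\<Sum>K\<in>T. measure lborel K * (q0 K \<bullet> bary_grad K v))"
    "\<And>v. v \<in> vertices T \<Longrightarrow> (LINT p|\<gamma>. nodal T v (snd p)) - patch_vol T v * M v =
        (\<Sum>K\<in>T. measure lborel K * (q1 K \<bullet> bary_grad K v))"
    "\<And>K. K \<in> T \<Longrightarrow> norm (q0 K) \<le> \<delta> * \<kappa> * (\<Sum>v\<in>vertices_of K. M v)"
    "\<And>K. K \<in> T \<Longrightarrow> norm (q1 K) \<le> \<delta> * \<kappa> * (\<Sum>v\<in>vertices_of K. M v)"
    "(\<Sum>K\<in>T. measure lborel K * norm (q0 K)) \<le> \<delta> * measure \<gamma> UNIV"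
    "(\<Sum>K\<in>T. measure lborel K * norm (q1 K)) \<le> \<delta> * measure \<gamma> UNIV"
proof -
  have s\<gamma>[measurable_cong]: "sets \<gamma> = sets borel" and f\<gamma>: "emeasure \<gamma> UNIV < \<infinity>"
    and good: "AE p in \<gamma>. closed_segment (fst p) (snd p) \<subseteq> \<Omega> \<and> norm (snd p - fst p) \<le> \<delta>"
    using plan unfolding displacement_plan_def by blast+
  obtain C :: "'a set \<Rightarrow> 'a set" where C: "\<And>K. K \<in> T \<Longrightarrow> C K \<subseteq> K" and Cb: "\<And>K. K \<in> T \<Longrightarrow> C K \<in> sets borel"
    and Cu: "\<And>x. x \<in> \<Omega> \<Longrightarrow> \<exists>!K. K \<in> T \<and> x \<in> C K"
    using mesh_cells by blast
  note nodal_measurable[OF mesh, measurable]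
  have sp[simp]: "space \<gamma> = UNIV" using s\<gamma> by (metis sets_eq_imp_space_eq space_borel)
  interpret \<gamma>: finite_measure \<gamma> using f\<gamma> by (intro finite_measureI) auto
  define P where "P = unit_time \<Otimes>\<^sub>M \<gamma>"
  note uP = unit_time_pair[OF s\<gamma>, folded P_def]
  note [measurable_cong] = uP(1)
  have fP: "emeasure P (space P) < \<infinity>" and mP: "emeasure P UNIV = emeasure \<gamma> UNIV" using f\<gamma> by (simp_all add: uP)
  define c where "c z = max 0 (min 1 (fst z))" for z :: "real \<times> 'a \<times> 'a"
  note [measurable] = displaced_measurable velocity_measurable[of \<delta>]
  have cm[measurable]: "c \<in> borel_measurable borel"
    unfolding c_def by (intro borel_measurable_continuous_onI continuous_intros)
  note Wb = velocity_bound[OF \<delta>]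
  have c01: "0 \<le> c z" "c z \<le> 1" for z by (auto simp: c_def)
  define J where "J \<alpha> \<beta> K z = ((\<alpha> + \<beta> * c z) * indicator (C K) (displaced z)) *\<^sub>R velocity \<delta> z" for \<alpha> \<beta> :: real and K z
  \<comment> \<open>The weights \<open>(\<alpha>, \<beta>) = (1, -1)\<close> and \<open>(0, 1)\<close> give \<open>q0\<close> and \<open>q1\<close>.\<close>
  define Q where "Q \<alpha> \<beta> K = (LINT z|P. J \<alpha> \<beta> K z) /\<^sub>R measure lborel K" for \<alpha> \<beta> :: real and K
  define M where "M v = (LINT z|P. nodal T v (displaced z)) / patch_vol T v" for v
  define mK where "mK K = (LINT z|P. indicator (C K) (displaced z) :: real)" for K
  have Kpos: "0 < measure lborel K" if "K \<in> T" for K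
  proof -
    note sK = mesh_simplex[OF mesh that]
    obtain a e where "0 < e" "ball a e \<subseteq> K" using simplex_interior(1)[OF sK] by (force simp: mem_interior)
    then have "measure lborel (ball a e) \<le> measure lborel K"
      using simplex_compact_convex(1)[OF sK] by (intro measure_mono_fmeasurable fmeasurable_compact) auto
    then show ?thesis using content_ball_pos[OF \<open>0 < e\<close>, of a] by linarith
  qed
  have Cm[measurable]: "(\<lambda>z. indicator (C K) (displaced z) :: real) \<in> borel_measurable borel" if "K \<in> T" for K
    using Cb[OF that] by measurable
  have Jm[measurable]: "J \<alpha> \<beta> K \<in> borel_measurable borel" if "K \<in> T" for \<alpha> \<beta> K
    unfolding J_def using Cm[OF that] by measurable
  have iN: "integrable P (\<lambda>z. nodal T v (displaced z))" for v
    by (rule integrable_bounded_finite[where C = 1]) (use fP nodal_bounds[OF mesh, of v] in auto)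
  have iC: "integrable P (\<lambda>z. indicator (C K) (displaced z) :: real)" if "K \<in> T" for K
    by (rule integrable_bounded_finite[where C = 1]) (use fP Cm[OF that] in auto)
  have M0: "0 \<le> M v" if "v \<in> vertices T" for v
    using patch_vol_pos[OF mesh that] nodal_bounds[OF mesh, of v]
    by (auto simp: M_def intro!: divide_nonneg_nonneg integral_nonneg)
  have pM: "patch_vol T v * M v = (LINT z|P. nodal T v (displaced z))" if "v \<in> vertices T" for v
    using patch_vol_pos[OF mesh that] by (simp add: M_def)
  have w1: "\<bar>\<alpha> + \<beta> * c z\<bar> \<le> 1" if "(\<alpha>, \<beta>) \<in> {(1, -1), (0, 1)}" for \<alpha> \<beta> :: real and z
    using that c01[of z] by auto
  have Jb: "norm (J \<alpha> \<beta> K z) \<le> \<delta> * indicator (C K) (displaced z)" if "(\<alpha>, \<beta>) \<in> {(1, -1), (0, 1)}" for \<alpha> \<beta> :: real and K z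
  proof -
    have "norm (J \<alpha> \<beta> K z) = \<bar>\<alpha> + \<beta> * c z\<bar> * (indicator (C K) (displaced z) * norm (velocity \<delta> z))"
      by (simp add: J_def abs_mult)
    also have "\<dots> \<le> 1 * (indicator (C K) (displaced z) * \<delta>)"
      using Wb[of z] w1[OF that, of z] by (intro mult_mono mult_left_mono) (auto simp: indicator_def)
    finally show ?thesis by (simp add: mult.commute)
  qed
  have iJ: "integrable P (J \<alpha> \<beta> K)" if "(\<alpha>, \<beta>) \<in> {(1, -1), (0, 1)}" "K \<in> T" for \<alpha> \<beta> :: real and K
  proof (rule integrable_bounded_finite[where C = \<delta>, OF fP])
    fix z
    have "\<delta> * indicator (C K) (displaced z) \<le> \<delta>" using \<delta> by (auto simp: indicator_def)
    then show "norm (J \<alpha> \<beta> K z) \<le> \<delta>" using Jb[OF that(1), of K z] by linarith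
  qed (use that in measurable)
  have Qn: "measure lborel K * norm (Q \<alpha> \<beta> K) \<le> \<delta> * mK K"
    if "(\<alpha>, \<beta>) \<in> {(1, -1), (0, 1)}" "K \<in> T" for \<alpha> \<beta> :: real and K
  proof -
    have "measure lborel K * norm (Q \<alpha> \<beta> K) = norm (LINT z|P. J \<alpha> \<beta> K z)"
      using Kpos[OF that(2)] by (simp add: Q_def)
    also have "\<dots> \<le> (LINT z|P. norm (J \<alpha> \<beta> K z))" by (rule integral_norm_bound)
    also have "\<dots> \<le> (LINT z|P. \<delta> * indicator (C K) (displaced z))"
      using iJ[OF that] iC[OF that(2)] Jb[OF that(1)] by (intro integral_mono) auto
    finally show ?thesis by (simp add: mK_def)
  qed
  have mK1: "mK K \<le> \<kappa> * measure lborel K * (\<Sum>v\<in>vertices_of K. M v)" if K: "K \<in> T" for K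
  proof -
    have vK: "v \<in> vertices T" if "v \<in> vertices_of K" for v using that K by (auto simp: vertices_def)
    have "mK K \<le> (LINT z|P. (\<Sum>v\<in>vertices_of K. nodal T v (displaced z)))"
      unfolding mK_def
    proof (intro integral_mono iC[OF K])
      show "integrable P (\<lambda>z. \<Sum>v\<in>vertices_of K. nodal T v (displaced z))" using iN by auto
      fix z show "indicator (C K) (displaced z) \<le> (\<Sum>v\<in>vertices_of K. nodal T v (displaced z))"
      proof (cases "displaced z \<in> C K")
        case True
        then show ?thesis using nodal_sum[OF mesh K, of "displaced z"] C[OF K] by auto
      qed (use nodal_bounds(1)[OF mesh] in \<open>auto intro: sum_nonneg\<close>)
    qed
    also have "\<dots> = (\<Sum>v\<in>vertices_of K. patch_vol T v * M v)"
      using iN vK by (simp add: pM)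
    also have "\<dots> \<le> (\<Sum>v\<in>vertices_of K. \<kappa> * measure lborel K * M v)"
      using \<kappa>[OF K] M0 vK by (intro sum_mono mult_right_mono) auto
    finally show ?thesis by (simp add: sum_distrib_left)
  qed
  have mKs: "(\<Sum>K\<in>T. mK K) \<le> measure \<gamma> UNIV"
  proof -
    have "(\<Sum>K\<in>T. mK K) = (LINT z|P. (\<Sum>K\<in>T. indicator (C K) (displaced z)))"
      unfolding mK_def using iC by simp
    also have "\<dots> \<le> (LINT z|P. 1)"
    proof (rule integral_mono)
      show "integrable P (\<lambda>z. \<Sum>K\<in>T. indicator (C K) (displaced z) :: real)" using iC by auto
      show "integrable P (\<lambda>z. 1 :: real)" by (rule integrable_bounded_finite[where C = 1]) (use fP in auto)
      fix z
      show "(\<Sum>K\<in>T. indicator (C K) (displaced z)) \<le> (1 :: real)"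
      proof (cases "displaced z \<in> \<Omega>")
        case True
        then obtain K where K: "K \<in> T" "\<And>K'. K' \<in> T \<Longrightarrow> displaced z \<in> C K' \<Longrightarrow> K' = K"
          using Cu[OF True] by blast
        have "(\<Sum>K'\<in>T. indicator (C K') (displaced z)) \<le> (\<Sum>K'\<in>T. if K' = K then 1 else 0 :: real)"
        proof (intro sum_mono)
          fix K' assume K': "K' \<in> T"
          show "indicator (C K') (displaced z) \<le> (if K' = K then 1 else 0 :: real)"
            using K(2)[OF K'] by (cases "displaced z \<in> C K'") auto
        qed
        then show ?thesis using K mesh_finite[OF mesh] by simp
      next
        case False
        then have "displaced z \<notin> C K" if "K \<in> T" for K using C[OF that] that mesh_Union[OF mesh] by blast
        then show ?thesis by simp
      qed
    qed
    also have "\<dots> = measure \<gamma> UNIV" using mP by (simp add: measure_def uP(2))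
    finally show ?thesis .
  qed
  have qK: "norm (Q \<alpha> \<beta> K) \<le> \<delta> * \<kappa> * (\<Sum>v\<in>vertices_of K. M v)"
    if "(\<alpha>, \<beta>) \<in> {(1, -1), (0, 1)}" "K \<in> T" for \<alpha> \<beta> :: real and K
  proof -
    have "measure lborel K * norm (Q \<alpha> \<beta> K) \<le> \<delta> * (\<kappa> * measure lborel K * (\<Sum>v\<in>vertices_of K. M v))"
      using Qn[OF that] mult_left_mono[OF mK1[OF that(2)] \<delta>] by linarith
    also have "\<dots> = measure lborel K * (\<delta> * \<kappa> * (\<Sum>v\<in>vertices_of K. M v))" by (simp add: ac_simps)
    finally show ?thesis using Kpos[OF that(2)] by (simp only: mult_le_cancel_left_pos)
  qed
  have qs: "(\<Sum>K\<in>T. measure lborel K * norm (Q \<alpha> \<beta> K)) \<le> \<delta> * measure \<gamma> UNIV"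
    if "(\<alpha>, \<beta>) \<in> {(1, -1), (0, 1)}" for \<alpha> \<beta> :: real
  proof -
    have "(\<Sum>K\<in>T. measure lborel K * norm (Q \<alpha> \<beta> K)) \<le> (\<Sum>K\<in>T. \<delta> * mK K)" using Qn[OF that] by (intro sum_mono)
    also have "\<dots> = \<delta> * (\<Sum>K\<in>T. mK K)" by (simp add: sum_distrib_left)
    also have "\<dots> \<le> \<delta> * measure \<gamma> UNIV" using mKs \<delta> by (rule mult_left_mono)
    finally show ?thesis .
  qed
  have id: "(\<Sum>K\<in>T. measure lborel K * (Q \<alpha> \<beta> K \<bullet> bary_grad K v)) =
      (\<alpha> + \<beta>) * (LINT p|\<gamma>. nodal T v (snd p)) - \<alpha> * (LINT p|\<gamma>. nodal T v (fst p)) - \<beta> * (patch_vol T v * M v)"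
    if w: "(\<alpha>, \<beta>) \<in> {(1, -1), (0, 1)}" and v: "v \<in> vertices T" for \<alpha> \<beta> :: real and v
  proof -
    define H where "H z = (\<Sum>K\<in>T. J \<alpha> \<beta> K z \<bullet> bary_grad K v) + \<beta> * nodal T v (displaced z)" for z
    have Hm[measurable]: "H \<in> borel_measurable borel"
      unfolding H_def using Jm by measurable
    have iH1: "integrable P (\<lambda>z. \<Sum>K\<in>T. J \<alpha> \<beta> K z \<bullet> bary_grad K v)" using iJ[OF w] by auto
    have Hb: "\<bar>H z\<bar> \<le> (\<Sum>K\<in>T. \<delta> * norm (bary_grad K v)) + \<bar>\<beta>\<bar>" for z
    proof -
      have "\<bar>J \<alpha> \<beta> K z \<bullet> bary_grad K v\<bar> \<le> \<delta> * norm (bary_grad K v)" for K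
      proof -
        have "\<delta> * indicator (C K) (displaced z) \<le> \<delta>" using \<delta> by (auto simp: indicator_def)
        then have "norm (J \<alpha> \<beta> K z) \<le> \<delta>" using Jb[OF w, of K z] by linarith
        then show ?thesis
          using Cauchy_Schwarz_ineq2[of "J \<alpha> \<beta> K z" "bary_grad K v"] mult_right_mono[OF _ norm_ge_zero] by (meson order.trans)
      qed
      then have "\<bar>\<Sum>K\<in>T. J \<alpha> \<beta> K z \<bullet> bary_grad K v\<bar> \<le> (\<Sum>K\<in>T. \<delta> * norm (bary_grad K v))"
        by (intro order.trans[OF sum_abs] sum_mono)
      moreover have "\<bar>\<beta> * nodal T v (displaced z)\<bar> \<le> \<bar>\<beta>\<bar> * 1"
        unfolding abs_mult using nodal_bounds[OF mesh, of v "displaced z"] by (intro mult_left_mono) auto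
      ultimately show ?thesis unfolding H_def by linarith
    qed
    have "(\<Sum>K\<in>T. measure lborel K * (Q \<alpha> \<beta> K \<bullet> bary_grad K v)) = (\<Sum>K\<in>T. (LINT z|P. J \<alpha> \<beta> K z) \<bullet> bary_grad K v)"
    proof (rule sum.cong)
      fix K assume "K \<in> T"
      then show "measure lborel K * (Q \<alpha> \<beta> K \<bullet> bary_grad K v) = (LINT z|P. J \<alpha> \<beta> K z) \<bullet> bary_grad K v"
        using Kpos[of K] by (simp add: Q_def)
    qed simp
    also have "\<dots> = (LINT z|P. (\<Sum>K\<in>T. J \<alpha> \<beta> K z \<bullet> bary_grad K v))"
      using iJ[OF w] by (simp add: Bochner_Integration.integral_sum)
    also have "\<dots> = (LINT z|P. H z) - \<beta> * (patch_vol T v * M v)"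
      using iH1 iN[of v] by (simp add: H_def pM[OF v])
    also have "(LINT z|P. H z) = (LINT p|\<gamma>. (\<alpha> + \<beta>) * nodal T v (snd p) - \<alpha> * nodal T v (fst p))"
      unfolding P_def
    proof (rule integral_unit_time_pair[OF s\<gamma> f\<gamma> Hm Hb])
      note fm = marginals_measurable[OF s\<gamma>]
      show "(\<lambda>p. (\<alpha> + \<beta>) * nodal T v (snd p) - \<alpha> * nodal T v (fst p)) \<in> borel_measurable \<gamma>"
        by (intro borel_measurable_diff borel_measurable_times borel_measurable_const
            measurable_compose[OF fm(1) nodal_measurable[OF mesh]] measurable_compose[OF fm(2) nodal_measurable[OF mesh]])
      show "AE p in \<gamma>. (LINT t|unit_time. H (t, p)) = (\<alpha> + \<beta>) * nodal T v (snd p) - \<alpha> * nodal T v (fst p)"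
        using good
      proof eventually_elim
        case (elim p)
        define y y' where "y = fst p" and "y' = snd p"
        have "(LINT t|unit_time. H (t, p)) =
          (LINT s|unit_time. (\<alpha> + \<beta> * s) * (\<Sum>K\<in>T. indicator (C K) (y + s *\<^sub>R (y' - y)) * (bary_grad K v \<bullet> (y' - y)))
            + \<beta> * nodal T v (y + s *\<^sub>R (y' - y)))"
        proof (rule integral_cong_AE)
          have [measurable]: "(\<lambda>t. (t, p)) \<in> borel_measurable borel"
            by (intro borel_measurable_continuous_onI continuous_intros)
          show "(\<lambda>t. H (t, p)) \<in> borel_measurable unit_time" by measurable
          have xt[measurable]: "(\<lambda>s. y + s *\<^sub>R (y' - y)) \<in> borel_measurable borel"
            by (intro borel_measurable_continuous_onI continuous_intros)
          have "(\<lambda>s. indicator (C K) (y + s *\<^sub>R (y' - y)) * (bary_grad K v \<bullet> (y' - y))) \<in> borel_measurable borel"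
            if "K \<in> T" for K using Cb[OF that] by measurable
          then have [measurable]: "(\<lambda>s. \<Sum>K\<in>T. indicator (C K) (y + s *\<^sub>R (y' - y)) * (bary_grad K v \<bullet> (y' - y))) \<in> borel_measurable borel"
            by (intro borel_measurable_sum) auto
          show "(\<lambda>s. (\<alpha> + \<beta> * s) * (\<Sum>K\<in>T. indicator (C K) (y + s *\<^sub>R (y' - y)) * (bary_grad K v \<bullet> (y' - y)))
            + \<beta> * nodal T v (y + s *\<^sub>R (y' - y))) \<in> borel_measurable unit_time"
            by measurable
          show "AE s in unit_time. H (s, p) = (\<alpha> + \<beta> * s) * (\<Sum>K\<in>T. indicator (C K) (y + s *\<^sub>R (y' - y)) * (bary_grad K v \<bullet> (y' - y)))
            + \<beta> * nodal T v (y + s *\<^sub>R (y' - y))"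
            using AE_unit_time
          proof eventually_elim
            case (elim s)
            have cs: "c (s, p) = s" using elim by (simp add: c_def)
            have xs: "displaced (s, p) = y + s *\<^sub>R (y' - y)" by (simp add: displaced_def y_def y'_def)
            have Ws: "velocity \<delta> (s, p) = y' - y"
              using \<open>_ \<and> norm (snd p - fst p) \<le> \<delta>\<close> by (simp add: velocity_def y_def y'_def)
            show ?case
              unfolding H_def J_def cs xs Ws sum_distrib_left
              by (simp add: inner_commute[of "y' - y"] mult.assoc)
          qed
        qed
        also have "\<dots> = (\<alpha> + \<beta>) * nodal T v y' - \<alpha> * nodal T v y"
          by (rule nodal_along_segment[OF _ C Cb Cu]) (use elim in \<open>auto simp: y_def y'_def\<close>)
        finally show ?case by (simp add: y_def y'_def)
      qed
    qed
    also have "\<dots> = (\<alpha> + \<beta>) * (LINT p|\<gamma>. nodal T v (snd p)) - \<alpha> * (LINT p|\<gamma>. nodal T v (fst p))"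
    proof -
      note fm = marginals_measurable[OF s\<gamma>]
      have i: "integrable \<gamma> (\<lambda>p. nodal T v (fst p))" "integrable \<gamma> (\<lambda>p. nodal T v (snd p))"
        using nodal_bounds[OF mesh, of v] f\<gamma>
        by (auto intro!: integrable_bounded_finite[where C = 1] measurable_compose[OF fm(1) nodal_measurable[OF mesh]]
            measurable_compose[OF fm(2) nodal_measurable[OF mesh]])
      then show ?thesis by simp
    qed
    finally show ?thesis .
  qed
  show ?thesis
  proof (rule that[of M "Q 1 (-1)" "Q 0 1"])
    fix v assume v: "v \<in> vertices T"
    show "0 \<le> M v" by (rule M0[OF v])
    show "patch_vol T v * M v - (LINT p|\<gamma>. nodal T v (fst p)) = (\<Sum>K\<in>T. measure lborel K * (Q 1 (-1) K \<bullet> bary_grad K v))"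
      using id[OF _ v, of 1 "-1"] by simp
    show "(LINT p|\<gamma>. nodal T v (snd p)) - patch_vol T v * M v = (\<Sum>K\<in>T. measure lborel K * (Q 0 1 K \<bullet> bary_grad K v))"
      using id[OF _ v, of 0 1] by simp
  qed (use qK qs in auto)
qed

end

section \<open>Discrete paths with quadratic time profile\<close>

text \<open>A flux \<open>b\<close> that is bounded by \<open>L m\<close> may be switched on with speed \<open>w\<close> over a fraction \<open>c\<close> of the
  density \<open>m\<close>, at a cost independent of \<open>c\<close>, if \<open>w\<^sup>2\<close> is of order \<open>c\<close>.\<close>

lemma dagger_sq_scaled_le:
  fixes b :: "'v::real_normed_vector"
  assumes a: "c * m / 2 \<le> a" and c: "0 \<le> c" and w: "w\<^sup>2 \<le> 36 * c" and m: "0 \<le> m"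
    and b: "norm b \<le> L * m"
  shows "dagger_sq a (w *\<^sub>R b) \<le> ennreal (72 * L * norm b)"
proof (cases "w *\<^sub>R b = 0")
  case True
  have "0 \<le> a" using a c m by (smt (verit) mult_nonneg_nonneg divide_nonneg_nonneg)
  then have "dagger_sq a (w *\<^sub>R b) = 0" unfolding True by (simp add: dagger_sq_def)
  then show ?thesis by simp
next
  case False
  then have "w \<noteq> 0" "b \<noteq> 0" by auto
  then have "0 < w\<^sup>2" "0 < norm b" by auto
  then have pos: "0 < c" "0 < m" using w b m c by (auto simp: less_le)
  then have a0: "0 < c * m / 2" by simp
  have "(norm (w *\<^sub>R b))\<^sup>2 / a \<le> (w\<^sup>2 * (norm b)\<^sup>2) / (c * m / 2)"
    unfolding norm_scaleR power_mult_distrib power2_abs real_norm_def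
    using a a0 by (intro divide_left_mono) auto
  also have "\<dots> \<le> (36 * c * (norm b)\<^sup>2) / (c * m / 2)"
    using w a0 by (intro divide_right_mono mult_right_mono) auto
  also have "\<dots> = 72 * ((norm b)\<^sup>2 / m)" using pos by simp
  also have "\<dots> \<le> 72 * (L * norm b)"
  proof -
    have "norm b * norm b \<le> L * m * norm b" using b by (intro mult_right_mono) auto
    then have "(norm b)\<^sup>2 / m \<le> L * norm b" using pos by (simp add: divide_le_eq power2_eq_square ac_simps)
    then show ?thesis by simp
  qed
  finally have "(norm (w *\<^sub>R b))\<^sup>2 / a \<le> 72 * L * norm b" by simp
  then show ?thesis using a a0 by (simp add: dagger_sq_def ennreal_leI)
qed

text \<open>The weights \<open>(k / m)\<^sup>2\<close> satisfy the condition on speed and fraction: their increments are of order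
  \<open>k / m\<^sup>2\<close>.\<close>

lemma quadratic_step:
  fixes k m N :: real
  assumes "1 \<le> k" "0 < m" "0 \<le> N" "N \<le> 3 * m"
  shows "(N * ((k / m)\<^sup>2 - ((k - 1) / m)\<^sup>2))\<^sup>2 \<le> 36 * (k / m)\<^sup>2"
proof -
  have eq: "N * ((k / m)\<^sup>2 - ((k - 1) / m)\<^sup>2) = (N / m) * ((2 * k - 1) / m)"
    using assms by (simp add: power2_eq_square field_simps)
  have "(N / m) * ((2 * k - 1) / m) \<le> 3 * (2 * k / m)"
    using assms by (intro mult_mono divide_right_mono) (auto simp: field_simps)
  moreover have "0 \<le> (N / m) * ((2 * k - 1) / m)" using assms by simp
  ultimately have "(N * ((k / m)\<^sup>2 - ((k - 1) / m)\<^sup>2))\<^sup>2 \<le> (3 * (2 * k / m))\<^sup>2"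
    unfolding eq by (intro power_mono)
  then show ?thesis by (simp add: power_mult_distrib power_divide)
qed

context
  fixes \<Omega> :: "'a::euclidean_space set" and \<sigma> :: real and T :: "'a set set"
  assumes mesh: "mesh \<Omega> \<sigma> T"
begin

lemma J_disc_step_le:
  assumes \<rho>: "\<And>v. v \<in> vertices T \<Longrightarrow> c * M v / 2 \<le> \<rho> v" and c: "0 \<le> c" and w: "w\<^sup>2 \<le> 36 * c"
    and M: "\<And>v. v \<in> vertices T \<Longrightarrow> 0 \<le> M v"
    and q: "\<And>K. K \<in> T \<Longrightarrow> norm (q K) \<le> L * (\<Sum>v\<in>vertices_of K. M v)"
    and qs: "(\<Sum>K\<in>T. measure lborel K * norm (q K)) \<le> F"
    and r: "\<And>v. v \<in> vertices T \<Longrightarrow> \<bar>r v\<bar> \<le> 2 * M v"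
    and rs: "(\<Sum>v\<in>vertices T. patch_vol T v * \<bar>r v\<bar>) \<le> R" and L: "0 \<le> L"
  shows "J_disc T \<rho> (\<lambda>K. w *\<^sub>R q K) (\<lambda>v. w * r v) \<le> ennreal (36 * (L * (DIM('a) + 1)) * F + 72 * R)"
proof -
  let ?d = "real DIM('a) + 1"
  have vK: "vertices_of K \<subseteq> vertices T" if "K \<in> T" for K using that by (auto simp: vertices_def)
  have 1: "dagger_sq (1 / ?d * (\<Sum>v\<in>vertices_of K. \<rho> v)) (w *\<^sub>R q K) \<le> ennreal (72 * (L * ?d) * norm (q K))"
    if K: "K \<in> T" for K
  proof (rule dagger_sq_scaled_le[where c = c and m = "1 / ?d * (\<Sum>v\<in>vertices_of K. M v)"])
    have "c / 2 * (\<Sum>v\<in>vertices_of K. M v) = (\<Sum>v\<in>vertices_of K. c * M v / 2)" by (simp add: sum_distrib_left)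
    also have "\<dots> \<le> (\<Sum>v\<in>vertices_of K. \<rho> v)" using \<rho> vK[OF K] by (intro sum_mono) auto
    finally have "1 / ?d * (c / 2 * (\<Sum>v\<in>vertices_of K. M v)) \<le> 1 / ?d * (\<Sum>v\<in>vertices_of K. \<rho> v)"
      by (intro mult_left_mono) auto
    then show "c * (1 / ?d * (\<Sum>v\<in>vertices_of K. M v)) / 2 \<le> 1 / ?d * (\<Sum>v\<in>vertices_of K. \<rho> v)"
      by simp
    show "0 \<le> 1 / ?d * (\<Sum>v\<in>vertices_of K. M v)" using M vK[OF K] by (auto intro!: sum_nonneg divide_nonneg_nonneg)
    have "?d \<noteq> 0" by (smt (verit) of_nat_0_le_iff)
    then show "norm (q K) \<le> L * ?d * (1 / ?d * (\<Sum>v\<in>vertices_of K. M v))" using q[OF K] by simp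
  qed (use c w in auto)
  have 2: "dagger_sq (\<rho> v) (w * r v) \<le> ennreal (144 * \<bar>r v\<bar>)" if v: "v \<in> vertices T" for v
    using dagger_sq_scaled_le[of c "M v" "\<rho> v" w "r v" 2] \<rho> M r c w v by simp
  have "(\<Sum>K\<in>T. ennreal (measure lborel K) * dagger_sq (1 / ?d * (\<Sum>v\<in>vertices_of K. \<rho> v)) (w *\<^sub>R q K))
      \<le> (\<Sum>K\<in>T. ennreal (measure lborel K) * ennreal (72 * (L * ?d) * norm (q K)))"
    using 1 by (intro sum_mono mult_left_mono) auto
  also have "\<dots> = ennreal (\<Sum>K\<in>T. measure lborel K * (72 * (L * ?d) * norm (q K)))"
    using L by (subst sum_ennreal[symmetric]) (auto simp: ennreal_mult)
  also have "(\<Sum>K\<in>T. measure lborel K * (72 * (L * ?d) * norm (q K))) =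
      72 * (L * ?d) * (\<Sum>K\<in>T. measure lborel K * norm (q K))"
    unfolding sum_distrib_left by (intro sum.cong refl) (simp only: ac_simps)
  also have "ennreal \<dots> \<le> ennreal (72 * (L * ?d) * F)"
    using qs L by (intro ennreal_leI mult_left_mono) auto
  finally have A: "(\<Sum>K\<in>T. ennreal (measure lborel K) * dagger_sq (1 / ?d * (\<Sum>v\<in>vertices_of K. \<rho> v)) (w *\<^sub>R q K))
      \<le> ennreal (72 * (L * ?d) * F)" .
  have F: "0 \<le> F" using qs by (rule order.trans[rotated]) (auto intro!: sum_nonneg)
  have pv: "0 \<le> patch_vol T v" if "v \<in> vertices T" for v using patch_vol_pos[OF mesh that] by simp
  have R: "0 \<le> R" using rs by (rule order.trans[rotated]) (auto intro!: sum_nonneg mult_nonneg_nonneg pv)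
  have "(\<Sum>v\<in>vertices T. ennreal (patch_vol T v) * dagger_sq (\<rho> v) (w * r v))
      \<le> (\<Sum>v\<in>vertices T. ennreal (patch_vol T v) * ennreal (144 * \<bar>r v\<bar>))"
    using 2 by (intro sum_mono mult_left_mono) auto
  also have "\<dots> = ennreal (\<Sum>v\<in>vertices T. patch_vol T v * (144 * \<bar>r v\<bar>))"
    using pv by (subst sum_ennreal[symmetric]) (auto simp: ennreal_mult)
  also have "(\<Sum>v\<in>vertices T. patch_vol T v * (144 * \<bar>r v\<bar>)) = 144 * (\<Sum>v\<in>vertices T. patch_vol T v * \<bar>r v\<bar>)"
    by (simp add: sum_distrib_left ac_simps)
  also have "ennreal \<dots> \<le> ennreal (144 * R)" using rs by (intro ennreal_leI mult_left_mono) auto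
  finally have B: "(\<Sum>v\<in>vertices T. ennreal (patch_vol T v) * dagger_sq (\<rho> v) (w * r v)) \<le> ennreal (144 * R)" .
  have "J_disc T \<rho> (\<lambda>K. w *\<^sub>R q K) (\<lambda>v. w * r v) \<le> ennreal (1/2) * ennreal (72 * (L * ?d) * F) + ennreal (1/2) * ennreal (144 * R)"
    unfolding J_disc_def by (intro add_mono mult_left_mono A B) auto
  also have "\<dots> = ennreal (1/2 * (72 * (L * ?d) * F)) + ennreal (1/2 * (144 * R))"
    by (simp only: ennreal_mult'[symmetric, of "1/2"])
  also have "\<dots> = ennreal (1/2 * (72 * (L * ?d) * F) + 1/2 * (144 * R))"
    using F R L by (intro ennreal_plus[symmetric]) auto
  finally show ?thesis by (simp add: algebra_simps)
qed

text \<open>The density first moves linearly from \<open>A\<close> to \<open>M' = M + \<epsilon> (E + B')\<close> and then to \<open>B\<close>, each time with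
  quadratic weights that vanish at the end points \<open>A\<close> and \<open>B\<close>. Since \<open>M'\<close> dominates the fluxes and
  the growth terms of both halves, every time step costs \<open>O(\<epsilon>)\<close> if \<open>F\<close> and \<open>L\<close> are of order \<open>\<epsilon>\<close>.\<close>

lemma discrete_path_from_fluxes:
  fixes A B B' E M :: "'a \<Rightarrow> real" and q0 q1 :: "'a set \<Rightarrow> 'a" and \<epsilon> F G L :: real
  assumes A: "A \<in> X_pos T" and B: "B \<in> X_pos T" and N: "2 \<le> N"
    and pos: "\<And>v. v \<in> vertices T \<Longrightarrow> 0 \<le> M v" "\<And>v. v \<in> vertices T \<Longrightarrow> 0 \<le> B' v" "\<And>v. v \<in> vertices T \<Longrightarrow> 0 \<le> E v"
    and e: "0 < \<epsilon>" "\<epsilon> < 1" and L: "0 \<le> L"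
    and BE: "\<And>v. v \<in> vertices T \<Longrightarrow> B v = (1 - \<epsilon>) * B' v + \<epsilon> * E v"
    and f0: "\<And>v. v \<in> vertices T \<Longrightarrow> patch_vol T v * (M v - A v) = (\<Sum>K\<in>T. measure lborel K * (q0 K \<bullet> bary_grad K v))"
    and f1: "\<And>v. v \<in> vertices T \<Longrightarrow> patch_vol T v * (B' v - M v) = (\<Sum>K\<in>T. measure lborel K * (q1 K \<bullet> bary_grad K v))"
    and q: "\<And>K. K \<in> T \<Longrightarrow> norm (q0 K) \<le> L * (\<Sum>v\<in>vertices_of K. M v)"
      "\<And>K. K \<in> T \<Longrightarrow> norm (q1 K) \<le> L * (\<Sum>v\<in>vertices_of K. M v)"
    and qs: "(\<Sum>K\<in>T. measure lborel K * norm (q0 K)) \<le> F" "(\<Sum>K\<in>T. measure lborel K * norm (q1 K)) \<le> F"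
    and G: "(\<Sum>v\<in>vertices T. patch_vol T v * (B' v + E v)) \<le> G"
  shows "\<exists>\<mu>\<in>CE_disc N T A B. J_time N T \<mu> \<le> ennreal (36 * (L * (DIM('a) + 1)) * F + 144 * \<epsilon> * G)"
proof -
  define m n where "m = N div 2" and "n = N - m"
  have mn: "0 < m" "0 < n" "m < N" "N \<le> 3 * m" "N \<le> 3 * n" "real n = real N - real m"
    using N by (auto simp: m_def n_def)
  \<comment> \<open>\<open>c j\<close> is the larger of the two fractions of \<open>M'\<close> at the ends of step \<open>j\<close>, and \<open>w j\<close> the rate
    of change of the fraction.\<close>
  define c where "c j = (if j \<le> m then (real j / m)\<^sup>2 else (real (N - (j - 1)) / n)\<^sup>2)" for j
  define w where "w j = (if j \<le> m then N * ((real j / m)\<^sup>2 - ((real j - 1) / m)\<^sup>2)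
      else N * ((real (N - (j - 1)) / n)\<^sup>2 - ((real (N - (j - 1)) - 1) / n)\<^sup>2))" for j
  define M' where "M' v = M v + \<epsilon> * E v + \<epsilon> * B' v" for v
  define Z where "Z j v = (if j \<le> m then (1 - (real j / m)\<^sup>2) * A v + (real j / m)\<^sup>2 * M' v
      else (1 - (real (N - j) / n)\<^sup>2) * B v + (real (N - j) / n)\<^sup>2 * M' v)" for j v
  define \<rho> where "\<rho> = (\<lambda>j\<in>{0..N}. \<lambda>v\<in>vertices T. Z j v)"
  define qq where "qq j = (if j \<le> m then q0 else q1)" for j
  define rr where "rr j v = (if j \<le> m then \<epsilon> * (E v + B' v) else - 2 * \<epsilon> * B' v)" for j v
  define qt where "qt = (\<lambda>j\<in>{1..N}. \<lambda>K\<in>T. w j *\<^sub>R qq j K)"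
  define rt where "rt = (\<lambda>j\<in>{1..N}. \<lambda>v\<in>vertices T. w j * rr j v)"
  have A0: "0 \<le> A v" and B0: "0 \<le> B v" and M'0: "0 \<le> M' v" if "v \<in> vertices T" for v
    using A B pos[OF that] that e by (auto simp: X_pos_def M'_def)
  have sq1: "(x / y)\<^sup>2 \<le> 1" if "0 \<le> x" "x \<le> y" for x y :: real
    using that by (cases "y = 0") (auto simp: abs_square_le_1 divide_le_eq_1)
  have g1: "(real j / m)\<^sup>2 \<le> 1" if "j \<le> m" for j by (rule sq1) (use that in auto)
  have h1: "(real (N - j) / n)\<^sup>2 \<le> 1" if "m \<le> j" for j by (rule sq1) (use that in \<open>auto simp: n_def\<close>)
  have Z2: "Z j v = (1 - (real (N - j) / n)\<^sup>2) * B v + (real (N - j) / n)\<^sup>2 * M' v" if "m \<le> j" for j v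
  proof (cases "j = m")
    case True
    then show ?thesis using mn by (simp add: Z_def n_def[symmetric])
  qed (use that in \<open>simp add: Z_def\<close>)
  have Z0: "0 \<le> Z j v" if "v \<in> vertices T" for j v
    using g1[of j] h1[of j] A0[OF that] B0[OF that] M'0[OF that]
    by (cases "j \<le> m") (auto simp: Z_def intro!: add_nonneg_nonneg mult_nonneg_nonneg)
  have \<rho>v: "\<rho> j v = Z j v" if "j \<le> N" "v \<in> vertices T" for j v using that by (simp add: \<rho>_def)
  have ce: "(\<rho> j v - \<rho> (j - 1) v) / (1 / real N) = - disc_div T (qt j) v + rt j v"
    if j: "j \<in> {1..N}" and v: "v \<in> vertices T" for j v
  proof -
    have pv: "0 < patch_vol T v" by (rule patch_vol_pos[OF mesh v])
    have jN: "j \<le> N" "j - 1 \<le> N" using j by auto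
    have "patch_vol T v * disc_div T (qt j) v = - (w j * (\<Sum>K\<in>T. measure lborel K * (qq j K \<bullet> bary_grad K v)))"
      using j by (simp add: disc_div_formula[OF mesh v] qt_def sum_distrib_left ac_simps)
    also have "\<dots> = patch_vol T v * (- (w j * (if j \<le> m then M v - A v else B' v - M v)))"
      using f0[OF v] f1[OF v] by (simp add: qq_def algebra_simps)
    finally have dd: "disc_div T (qt j) v = - (w j * (if j \<le> m then M v - A v else B' v - M v))"
      using pv by (metis less_irrefl mult_left_cancel)
    have rt: "rt j v = w j * rr j v" using j v by (simp add: rt_def)
    have "(\<rho> j v - \<rho> (j - 1) v) / (1 / real N) = N * (Z j v - Z (j - 1) v)"
      using \<rho>v[OF jN(1) v] \<rho>v[OF jN(2) v] by (simp add: mult.commute)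
    also have "\<dots> = w j * (if j \<le> m then M' v - A v else B v - M' v)"
    proof (cases "j \<le> m")
      case True
      have "real (j - 1) = real j - 1" using j by auto
      then have "Z (j - 1) v = (1 - ((real j - 1) / m)\<^sup>2) * A v + ((real j - 1) / m)\<^sup>2 * M' v"
        using True by (simp add: Z_def)
      moreover have "Z j v = (1 - (real j / m)\<^sup>2) * A v + (real j / m)\<^sup>2 * M' v" using True by (simp add: Z_def)
      ultimately show ?thesis using True unfolding w_def by (simp only: if_True) (simp only: algebra_simps)
    next
      case False
      have "real (N - (j - 1)) - 1 = real (N - j)" using j by (auto simp: of_nat_diff)
      moreover have "Z (j - 1) v = (1 - (real (N - (j - 1)) / n)\<^sup>2) * B v + (real (N - (j - 1)) / n)\<^sup>2 * M' v"
        using False by (intro Z2) auto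
      moreover have "Z j v = (1 - (real (N - j) / n)\<^sup>2) * B v + (real (N - j) / n)\<^sup>2 * M' v"
        using False by (intro Z2) auto
      ultimately show ?thesis using False unfolding w_def by (simp only: if_False) (simp only: algebra_simps)
    qed
    also have "\<dots> = - disc_div T (qt j) v + rt j v"
      unfolding dd rt rr_def M'_def BE[OF v] by (simp add: algebra_simps)
    finally show ?thesis .
  qed
  have CE: "(\<rho>, qt, rt) \<in> CE_disc N T A B"
    unfolding CE_disc_def
  proof (clarsimp, intro conjI ballI)
    show "\<rho> \<in> {0..N} \<rightarrow>\<^sub>E X_pos T" using Z0 by (auto simp: \<rho>_def X_pos_def X_space_def)
    show "qt \<in> {Suc 0..N} \<rightarrow>\<^sub>E Y_space T" by (auto simp: qt_def Y_space_def)
    show "rt \<in> {Suc 0..N} \<rightarrow>\<^sub>E X_space T" by (auto simp: rt_def X_space_def)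
    show "(\<rho> j v - \<rho> (j - Suc 0) v) * real N = rt j v - disc_div T (qt j) v"
      if "j \<in> {Suc 0..N}" "v \<in> vertices T" for j v using ce[of j v] that by simp
    show "\<rho> 0 = A"
    proof
      fix v show "\<rho> 0 v = A v"
        using A by (cases "v \<in> vertices T") (auto simp: \<rho>_def Z_def X_pos_def X_space_def PiE_def extensional_def)
    qed
    show "\<rho> N = B"
    proof
      fix v show "\<rho> N v = B v"
        using B mn by (cases "v \<in> vertices T") (auto simp: \<rho>_def Z_def X_pos_def X_space_def PiE_def extensional_def)
    qed
  qed
  have step: "J_disc T (\<lambda>v. (\<rho> (j - 1) v + \<rho> j v) / 2) (qt j) (rt j) \<le> ennreal (36 * (L * (DIM('a) + 1)) * F + 144 * \<epsilon> * G)"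
    if j: "j \<in> {1..N}" for j
  proof -
    have eq: "J_disc T (\<lambda>v. (\<rho> (j - 1) v + \<rho> j v) / 2) (qt j) (rt j) =
       J_disc T (\<lambda>v. (\<rho> (j - 1) v + \<rho> j v) / 2) (\<lambda>K. w j *\<^sub>R qq j K) (\<lambda>v. w j * rr j v)"
      unfolding J_disc_def using j by (simp add: qt_def rt_def)
    have "J_disc T (\<lambda>v. (\<rho> (j - 1) v + \<rho> j v) / 2) (\<lambda>K. w j *\<^sub>R qq j K) (\<lambda>v. w j * rr j v)
      \<le> ennreal (36 * (L * (DIM('a) + 1)) * F + 72 * (2 * \<epsilon> * G))"
    proof (rule J_disc_step_le[where c = "c j" and M = M'])
      show "0 \<le> c j" by (simp add: c_def)
      show "(w j)\<^sup>2 \<le> 36 * c j"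
      proof (cases "j \<le> m")
        case True
        have "(N * ((real j / m)\<^sup>2 - ((real j - 1) / m)\<^sup>2))\<^sup>2 \<le> 36 * (real j / m)\<^sup>2"
          by (rule quadratic_step) (use j mn in auto)
        then show ?thesis using True by (simp only: w_def c_def if_True)
      next
        case False
        have "(N * ((real (N - (j - 1)) / n)\<^sup>2 - ((real (N - (j - 1)) - 1) / n)\<^sup>2))\<^sup>2 \<le> 36 * (real (N - (j - 1)) / n)\<^sup>2"
          by (rule quadratic_step) (use j mn(2,5) in auto)
        then show ?thesis using False by (simp only: w_def c_def if_False)
      qed
      fix v assume v: "v \<in> vertices T"
      have "c j * M' v \<le> Z (j - 1) v + Z j v"
      proof (cases "j \<le> m")
        case True
        have "0 \<le> (1 - (real j / m)\<^sup>2) * A v" using g1[OF True] A0[OF v] by simp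
        then show ?thesis using True Z0[OF v, of "j - 1"] by (simp add: c_def Z_def[of j])
      next
        case False
        then have mj: "m \<le> j - 1" by auto
        have "0 \<le> (1 - (real (N - (j - 1)) / n)\<^sup>2) * B v" using h1[OF mj] B0[OF v] by simp
        moreover have "c j = (real (N - (j - 1)) / n)\<^sup>2" using False by (simp only: c_def if_False)
        ultimately show ?thesis using Z0[OF v, of j] Z2[OF mj, of v] by simp
      qed
      then show "c j * M' v / 2 \<le> (\<rho> (j - 1) v + \<rho> j v) / 2"
        using j \<rho>v[of j v, OF _ v] \<rho>v[of "j - 1" v, OF _ v] by auto
      show "0 \<le> M' v" by (rule M'0[OF v])
      have "\<bar>rr j v\<bar> \<le> 2 * \<epsilon> * (B' v + E v)" using pos[OF v] e by (auto simp: rr_def algebra_simps abs_if)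
      also have "\<dots> \<le> 2 * M' v" using pos[OF v] by (simp add: M'_def algebra_simps)
      finally show "\<bar>rr j v\<bar> \<le> 2 * M' v" .
    next
      fix K assume K: "K \<in> T"
      have "(\<Sum>v\<in>vertices_of K. M v) \<le> (\<Sum>v\<in>vertices_of K. M' v)"
        using pos e K by (intro sum_mono) (auto simp: M'_def vertices_def intro!: add_nonneg_nonneg mult_nonneg_nonneg)
      then have "L * (\<Sum>v\<in>vertices_of K. M v) \<le> L * (\<Sum>v\<in>vertices_of K. M' v)" using L by (rule mult_left_mono)
      then show "norm (qq j K) \<le> L * (\<Sum>v\<in>vertices_of K. M' v)"
        using q[OF K] by (auto simp: qq_def)
    next
      show "(\<Sum>K\<in>T. measure lborel K * norm (qq j K)) \<le> F" using qs by (simp add: qq_def)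
      have "(\<Sum>v\<in>vertices T. patch_vol T v * \<bar>rr j v\<bar>) \<le> (\<Sum>v\<in>vertices T. patch_vol T v * (2 * \<epsilon> * (B' v + E v)))"
      proof (intro sum_mono mult_left_mono)
        fix v assume v: "v \<in> vertices T"
        show "\<bar>rr j v\<bar> \<le> 2 * \<epsilon> * (B' v + E v)" using pos[OF v] e by (auto simp: rr_def algebra_simps abs_if)
        show "0 \<le> patch_vol T v" using patch_vol_pos[OF mesh v] by simp
      qed
      also have "\<dots> = 2 * \<epsilon> * (\<Sum>v\<in>vertices T. patch_vol T v * (B' v + E v))" by (simp add: sum_distrib_left ac_simps)
      also have "\<dots> \<le> 2 * \<epsilon> * G" using G e by (intro mult_left_mono) auto
      finally show "(\<Sum>v\<in>vertices T. patch_vol T v * \<bar>rr j v\<bar>) \<le> 2 * \<epsilon> * G" .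
    qed (rule L)
    then show ?thesis unfolding eq by (simp add: mult.assoc)
  qed
  have "J_time N T (\<rho>, qt, rt) \<le> ennreal (1 / N) * (\<Sum>j\<in>{1..N}. ennreal (36 * (L * (DIM('a) + 1)) * F + 144 * \<epsilon> * G))"
    unfolding J_time.simps using step by (intro mult_left_mono sum_mono) auto
  also have "\<dots> = ennreal (36 * (L * (DIM('a) + 1)) * F + 144 * \<epsilon> * G)"
    using N by (simp add: mult.assoc[symmetric] ennreal_of_nat_eq_real_of_nat ennreal_mult''[symmetric])
  finally show ?thesis using CE by blast
qed

end

section \<open>The gauge, the contraction and the kernel\<close>

context
  fixes \<Omega> :: "'a::euclidean_space set" and x0 :: 'a
  assumes star: "star_domain \<Omega>" and x0: "x0 \<in> interior (star_points \<Omega>)"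
begin

lemma star_compact: "compact \<Omega>" and star_closed: "closed \<Omega>"
  using star by (auto simp: star_domain_def compact_imp_closed)

lemma star_convex_comb:
  assumes "c \<in> star_points \<Omega>" "y \<in> \<Omega>" "0 \<le> t" "t \<le> 1"
  shows "(1 - t) *\<^sub>R c + t *\<^sub>R y \<in> \<Omega>"
  using assms unfolding star_points_def closed_segment_def by blast

lemma star_center_mem: "x0 \<in> star_points \<Omega>" "x0 \<in> \<Omega>"
  using x0 interior_subset by (auto simp: star_points_def)

text \<open>The factors \<open>l\<close> for which \<open>x\<close> lies in the copy of \<open>\<Omega>\<close> dilated by \<open>l\<close> about \<open>x0\<close>; their infimum is
  the gauge of \<open>x\<close>.\<close>

definition scales :: "'a \<Rightarrow> real set" where
  "scales x = {l. l > 0 \<and> x - x0 \<in> (\<lambda>y. l *\<^sub>R (y - x0)) ` \<Omega>}"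

lemma scalesI: "0 < l \<Longrightarrow> y \<in> \<Omega> \<Longrightarrow> x - x0 = l *\<^sub>R (y - x0) \<Longrightarrow> l \<in> scales x"
  by (auto simp: scales_def)

lemma scales_mono:
  assumes "l \<in> scales x" "l \<le> l'"
  shows "l' \<in> scales x"
proof -
  obtain y where y: "y \<in> \<Omega>" "0 < l" "x - x0 = l *\<^sub>R (y - x0)" using assms by (auto simp: scales_def)
  have "(1 - l / l') *\<^sub>R x0 + (l / l') *\<^sub>R y \<in> \<Omega>"
    using assms y by (intro star_convex_comb star_center_mem) auto
  then show ?thesis
    using y assms by (intro scalesI[of l' "(1 - l / l') *\<^sub>R x0 + (l / l') *\<^sub>R y"]) (auto simp: algebra_simps)
qed

lemma gauge_at_eq: "gauge_at \<Omega> x0 x = Inf (scales x)"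
  by (simp add: gauge_at_def scales_def)

lemma scales_bdd: "bdd_below (scales x)"
  by (auto simp: scales_def bdd_below_def intro!: exI[of _ 0])

text \<open>The Lipschitz estimate of the gauge: \<open>\<Omega>\<close> is star-shaped with respect to the point at
  distance \<open>r\<close> from \<open>x0\<close> in the direction \<open>u - w\<close>.\<close>

lemma scales_add:
  assumes r: "0 < r" "cball x0 r \<subseteq> star_points \<Omega>" and l: "l \<in> scales w" and "u \<noteq> w"
  shows "l + norm (u - w) / r \<in> scales u"
proof -
  define \<delta> where "\<delta> = norm (u - w) / r"
  have \<delta>: "0 < \<delta>" using assms by (simp add: \<delta>_def)
  obtain y where y: "y \<in> \<Omega>" "0 < l" "w - x0 = l *\<^sub>R (y - x0)" using l by (auto simp: scales_def)
  define b where "b = x0 + (u - w) /\<^sub>R \<delta>"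
  have "norm (b - x0) = r" using r \<open>u \<noteq> w\<close> by (simp add: b_def \<delta>_def)
  then have "b \<in> cball x0 r" by (simp add: dist_norm norm_minus_commute)
  then have b: "b \<in> star_points \<Omega>" using r by blast
  define z where "z = (1 - l / (l + \<delta>)) *\<^sub>R b + (l / (l + \<delta>)) *\<^sub>R y"
  have z: "z \<in> \<Omega>" unfolding z_def using y \<delta> by (intro star_convex_comb b) auto
  have 1: "l + \<delta> \<noteq> 0" using y \<delta> by auto
  have "(l + \<delta>) *\<^sub>R z = ((l + \<delta>) * (1 - l / (l + \<delta>))) *\<^sub>R b + ((l + \<delta>) * (l / (l + \<delta>))) *\<^sub>R y"
    by (simp add: z_def scaleR_add_right)
  also have "(l + \<delta>) * (1 - l / (l + \<delta>)) = \<delta>" using 1 by (simp add: field_simps)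
  also have "(l + \<delta>) * (l / (l + \<delta>)) = l" using 1 by simp
  finally have "(l + \<delta>) *\<^sub>R (z - x0) = \<delta> *\<^sub>R (b - x0) + l *\<^sub>R (y - x0)" by (simp add: algebra_simps)
  also have "\<delta> *\<^sub>R (b - x0) = u - w" using \<delta> by (simp add: b_def)
  also have "l *\<^sub>R (y - x0) = w - x0" using y(3) by (rule sym)
  also have "(u - w) + (w - x0) = u - x0" by simp
  finally have "u - x0 = (l + \<delta>) *\<^sub>R (z - x0)" by (rule sym)
  then show ?thesis using y \<delta> z unfolding \<delta>_def[symmetric] by (intro scalesI) auto
qed

lemma center_ball: obtains r where "0 < r" "cball x0 r \<subseteq> star_points \<Omega>"
  using x0 by (auto simp: mem_interior_cball)

lemma scales_nonempty: "scales x \<noteq> {}"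
proof -
  obtain r where r: "0 < r" "cball x0 r \<subseteq> star_points \<Omega>" by (rule center_ball)
  have "1 \<in> scales x0" using star_center_mem by (intro scalesI[of _ x0]) auto
  then show ?thesis using scales_add[OF r, of 1 x0 x] by (cases "x = x0") auto
qed

lemma gauge_le: "l \<in> scales x \<Longrightarrow> gauge_at \<Omega> x0 x \<le> l"
  unfolding gauge_at_eq by (intro cInf_lower scales_bdd)

lemma gauge_lipschitz_ex: "\<exists>L. L-lipschitz_on UNIV (gauge_at \<Omega> x0)"
proof -
  obtain r where r: "0 < r" "cball x0 r \<subseteq> star_points \<Omega>" by (rule center_ball)
  have le: "gauge_at \<Omega> x0 u \<le> gauge_at \<Omega> x0 w + norm (u - w) / r" for u w
  proof (cases "u = w")
    case False
    have "gauge_at \<Omega> x0 u - norm (u - w) / r \<le> Inf (scales w)"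
    proof (rule cInf_greatest[OF scales_nonempty])
      fix l assume "l \<in> scales w"
      from gauge_le[OF scales_add[OF r this False]]
      show "gauge_at \<Omega> x0 u - norm (u - w) / r \<le> l" by simp
    qed
    then show ?thesis by (simp add: gauge_at_eq)
  qed simp
  have "(1 / r)-lipschitz_on UNIV (gauge_at \<Omega> x0)"
  proof (rule lipschitz_onI)
    fix u w
    show "dist (gauge_at \<Omega> x0 u) (gauge_at \<Omega> x0 w) \<le> 1 / r * dist u w"
      using le[of u w] le[of w u] by (simp add: dist_norm norm_minus_commute abs_le_iff)
  qed (use r in simp)
  then show ?thesis by blast
qed

lemma gauge_lip_nonneg: "0 \<le> gauge_lip \<Omega> x0"
  unfolding gauge_lip_def using gauge_lipschitz_ex
  by (intro cInf_greatest) (auto dest: lipschitz_on_nonneg)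

lemma gauge_lip_le: "gauge_at \<Omega> x0 u \<le> gauge_at \<Omega> x0 w + gauge_lip \<Omega> x0 * norm (u - w)"
proof (cases "u = w")
  case False
  then have n: "0 < norm (u - w)" by simp
  have "(gauge_at \<Omega> x0 u - gauge_at \<Omega> x0 w) / norm (u - w) \<le> gauge_lip \<Omega> x0"
    unfolding gauge_lip_def
  proof (rule cInf_greatest)
    show "{L. L-lipschitz_on UNIV (gauge_at \<Omega> x0)} \<noteq> {}" using gauge_lipschitz_ex by auto
    fix L assume "L \<in> {L. L-lipschitz_on UNIV (gauge_at \<Omega> x0)}"
    then have "dist (gauge_at \<Omega> x0 u) (gauge_at \<Omega> x0 w) \<le> L * dist u w"
      by (auto dest: lipschitz_onD)
    then have "gauge_at \<Omega> x0 u - gauge_at \<Omega> x0 w \<le> L * norm (u - w)" by (simp add: dist_norm)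
    then show "(gauge_at \<Omega> x0 u - gauge_at \<Omega> x0 w) / norm (u - w) \<le> L"
      using n by (simp add: divide_le_eq)
  qed
  then show ?thesis using n by (simp add: divide_le_eq)
qed simp

lemma gauge_le_1_imp_mem:
  assumes "gauge_at \<Omega> x0 x \<le> 1"
  shows "x \<in> \<Omega>"
proof -
  define p where "p n = x0 + (x - x0) /\<^sub>R (1 + inverse (real (Suc n)))" for n
  have p: "p n \<in> \<Omega>" for n
  proof -
    define l' where "l' = 1 + inverse (real (Suc n))"
    have "0 < inverse (real (Suc n))" by (simp only: inverse_positive_iff_positive of_nat_0_less_iff)
    then have l': "1 < l'" by (simp only: l'_def)
    then have "Inf (scales x) < l'" using assms unfolding gauge_at_eq by linarith
    from cInf_lessD[OF scales_nonempty this] obtain l where l: "l \<in> scales x" "l < l'" ..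
    have "l' \<in> scales x" by (rule scales_mono[OF l(1) less_imp_le[OF l(2)]])
    then obtain y where y: "y \<in> \<Omega>" "x - x0 = l' *\<^sub>R (y - x0)" by (auto simp: scales_def)
    have "p n = x0 + (l' *\<^sub>R (y - x0)) /\<^sub>R l'" by (simp only: p_def l'_def[symmetric] y(2))
    also have "\<dots> = y" using l' by simp
    finally show ?thesis using y(1) by simp
  qed
  have "(\<lambda>n. x0 + (x - x0) /\<^sub>R (1 + inverse (real (Suc n)))) \<longlonglongrightarrow> x0 + (x - x0) /\<^sub>R (1 + 0)"
    by (intro tendsto_intros LIMSEQ_inverse_real_of_nat) simp
  then have "p \<longlonglongrightarrow> x" by (simp add: p_def[abs_def])
  then show ?thesis using p star_closed by (meson closed_sequentially)
qed

text \<open>Let \<open>\<kappa>\<close> be the contraction factor and \<open>L\<close> the Lipschitz constant of the gauge. The point with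
  parameter \<open>s\<close> lies within \<open>s \<kappa> \<epsilon>\<close> of a point of gauge at most \<open>1 - s (1 - \<kappa>)\<close> on the ray from
  \<open>x0\<close> through \<open>y\<close>, so its gauge is at most \<open>1 - s (1 - \<kappa>) + s \<kappa> L \<epsilon> = 1\<close>.\<close>

lemma contraction_segment:
  assumes e: "0 < \<epsilon>" and y: "y \<in> \<Omega>" and xy: "norm (x - y) \<le> \<epsilon>"
  shows "closed_segment y (contraction \<Omega> x0 \<epsilon> x) \<subseteq> \<Omega>"
proof
  let ?L = "gauge_lip \<Omega> x0"
  define \<kappa> where "\<kappa> = 1 / (1 + ?L * \<epsilon>)"
  have "0 \<le> ?L * \<epsilon>" using gauge_lip_nonneg e by simp
  then have \<kappa>: "0 < \<kappa>" "\<kappa> \<le> 1" "\<kappa> * (1 + ?L * \<epsilon>) = 1" by (auto simp: \<kappa>_def)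
  fix p assume "p \<in> closed_segment y (contraction \<Omega> x0 \<epsilon> x)"
  then obtain s where s: "0 \<le> s" "s \<le> 1" "p = (1 - s) *\<^sub>R y + s *\<^sub>R contraction \<Omega> x0 \<epsilon> x"
    by (auto simp: closed_segment_def)
  have Tx: "contraction \<Omega> x0 \<epsilon> x = x0 + \<kappa> *\<^sub>R (x - x0)" by (simp add: contraction_def \<kappa>_def divide_inverse)
  define a where "a = 1 - s + s * \<kappa>"
  have a: "0 < a"
  proof (cases "s = 1")
    case False
    then show ?thesis using s \<kappa> by (auto simp: a_def intro!: add_pos_nonneg)
  qed (use \<kappa> in \<open>simp add: a_def\<close>)
  define w where "w = x0 + a *\<^sub>R (y - x0)"
  have "a \<in> scales w" using a y by (intro scalesI) (auto simp: w_def)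
  then have gw: "gauge_at \<Omega> x0 w \<le> a" by (rule gauge_le)
  have pw: "p - w = (s * \<kappa>) *\<^sub>R (x - y)" by (simp add: s Tx w_def a_def algebra_simps)
  have "gauge_at \<Omega> x0 p \<le> a + ?L * norm (p - w)" using gauge_lip_le[of p w] gw by linarith
  also have "norm (p - w) \<le> s * \<kappa> * \<epsilon>" unfolding pw using s \<kappa> xy by (simp add: mult_left_mono)
  then have "a + ?L * norm (p - w) \<le> a + ?L * (s * \<kappa> * \<epsilon>)"
    using gauge_lip_nonneg by (intro add_left_mono mult_left_mono)
  also have "\<dots> = 1 - s + s * (\<kappa> * (1 + ?L * \<epsilon>))" by (simp add: a_def algebra_simps)
  also have "\<dots> = 1" using \<kappa> by simp
  finally show "p \<in> \<Omega>" by (rule gauge_le_1_imp_mem)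
qed

lemma contraction_dist:
  assumes e: "0 < \<epsilon>" and y: "norm (y - x0) \<le> D" and xy: "norm (x - y) \<le> \<epsilon>"
  shows "norm (contraction \<Omega> x0 \<epsilon> x - y) \<le> (1 + gauge_lip \<Omega> x0 * D) * \<epsilon>"
proof -
  let ?L = "gauge_lip \<Omega> x0"
  define \<kappa> where "\<kappa> = 1 / (1 + ?L * \<epsilon>)"
  have L: "0 \<le> ?L * \<epsilon>" using gauge_lip_nonneg e by simp
  then have \<kappa>: "0 < \<kappa>" "\<kappa> \<le> 1" "1 - \<kappa> = \<kappa> * (?L * \<epsilon>)" by (auto simp: \<kappa>_def field_simps)
  have "contraction \<Omega> x0 \<epsilon> x = x0 + \<kappa> *\<^sub>R (x - x0)" by (simp add: contraction_def \<kappa>_def divide_inverse)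
  then have "contraction \<Omega> x0 \<epsilon> x - y = \<kappa> *\<^sub>R (x - y) - (1 - \<kappa>) *\<^sub>R (y - x0)" by (simp add: algebra_simps)
  then have "norm (contraction \<Omega> x0 \<epsilon> x - y) \<le> norm (\<kappa> *\<^sub>R (x - y)) + norm ((1 - \<kappa>) *\<^sub>R (y - x0))"
    by (simp only: norm_triangle_ineq4)
  also have "norm (\<kappa> *\<^sub>R (x - y)) \<le> 1 * \<epsilon>"
    unfolding norm_scaleR using \<kappa> xy by (intro mult_mono) auto
  also have "norm ((1 - \<kappa>) *\<^sub>R (y - x0)) \<le> (1 * (?L * \<epsilon>)) * D"
    unfolding norm_scaleR using \<kappa> L y mult_right_mono[of \<kappa> 1 "?L * \<epsilon>"] by (intro mult_mono) auto
  finally show ?thesis by (simp add: algebra_simps)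
qed

lemma contraction_thicken:
  assumes e: "0 < \<epsilon>" and x: "x \<in> thicken \<Omega> \<epsilon>"
  shows "contraction \<Omega> x0 \<epsilon> x \<in> \<Omega>"
proof -
  obtain y where "y \<in> \<Omega>" "infdist x \<Omega> = dist x y"
    using infdist_attains_inf[OF star_closed, of x] star_center_mem by blast
  then have "norm (x - y) \<le> \<epsilon>" using x by (simp add: thicken_def dist_norm)
  from contraction_segment[OF e \<open>y \<in> \<Omega>\<close> this] show ?thesis by (meson ends_in_segment(2) subsetD)
qed

end

lemma smooth_continuous: "smooth f \<Longrightarrow> continuous_on UNIV f"
  unfolding smooth_def by (metis C_order.simps(1))

lemma smooth_measurable: "smooth f \<Longrightarrow> f \<in> borel_measurable borel"
  by (intro borel_measurable_continuous_onI smooth_continuous)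

context
  fixes \<theta> :: "'a::euclidean_space \<Rightarrow> real" and \<epsilon> :: real
  assumes ker: "radial_kernel \<theta>" and e: "0 < \<epsilon>"
begin

lemma profile_properties: "smooth \<theta>" "0 \<le> \<theta> x" "(LINT x|lborel. \<theta> x) = 1"
  using ker unfolding radial_kernel_def by blast+

lemma kernel_nonneg: "0 \<le> rescale \<theta> \<epsilon> x"
  using profile_properties(2) e by (simp add: rescale_def)

lemma kernel_support:
  assumes "rescale \<theta> \<epsilon> x \<noteq> 0"
  shows "norm x \<le> \<epsilon>"
proof -
  have "\<theta> (x /\<^sub>R \<epsilon>) \<noteq> 0" using assms by (auto simp: rescale_def)
  then have "x /\<^sub>R \<epsilon> \<in> cball 0 1" using ker unfolding radial_kernel_def by blast
  then have "norm x / \<epsilon> \<le> 1" using e by (simp add: divide_inverse mult.commute)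
  then show ?thesis using e by (simp add: divide_le_eq)
qed

lemma kernel_sym: "rescale \<theta> \<epsilon> (- x) = rescale \<theta> \<epsilon> x"
proof -
  have "norm ((- x) /\<^sub>R \<epsilon>) = norm (x /\<^sub>R \<epsilon>)" by simp
  then show ?thesis using ker unfolding rescale_def radial_kernel_def
    by (metis (no_types))
qed

lemma kernel_continuous: "continuous_on UNIV (rescale \<theta> \<epsilon>)"
proof -
  have "continuous_on UNIV \<theta>" using profile_properties(1) by (rule smooth_continuous)
  then have "continuous_on UNIV (\<lambda>x. \<theta> (x /\<^sub>R \<epsilon>))"
    by (rule continuous_on_compose2) (auto intro: continuous_intros)
  then show ?thesis unfolding rescale_def[abs_def] using e
    by (intro continuous_on_divide continuous_on_const) auto
qed

lemma kernel_measurable: "rescale \<theta> \<epsilon> \<in> borel_measurable borel"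
  using kernel_continuous by (rule borel_measurable_continuous_onI)

lemma kernel_bounded: "\<exists>B. \<forall>x. rescale \<theta> \<epsilon> x \<le> B"
proof -
  have "compact (rescale \<theta> \<epsilon> ` cball 0 \<epsilon>)"
    by (intro compact_continuous_image continuous_on_subset[OF kernel_continuous]) auto
  then have "bdd_above (rescale \<theta> \<epsilon> ` cball 0 \<epsilon>)" by (intro bounded_imp_bdd_above compact_imp_bounded)
  then obtain B where B: "\<And>x. x \<in> cball 0 \<epsilon> \<Longrightarrow> rescale \<theta> \<epsilon> x \<le> B"
    unfolding bdd_above_def by blast
  have "rescale \<theta> \<epsilon> x \<le> max 0 B" for x
    using B[of x] kernel_support[of x] by (cases "rescale \<theta> \<epsilon> x = 0") auto
  then show ?thesis by blast
qed

lemma kernel_mass: "(\<integral>\<^sup>+x. ennreal (rescale \<theta> \<epsilon> (x - y)) \<partial>lborel) = 1"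
proof -
  have \<theta>m[measurable]: "\<theta> \<in> borel_measurable borel" using profile_properties(1) by (rule smooth_measurable)
  have i: "integrable lborel \<theta>" using profile_properties(3) by (metis not_integrable_integral_eq zero_neq_one)
  have \<theta>1: "(\<integral>\<^sup>+x. ennreal (\<theta> x) \<partial>lborel) = 1"
    using nn_integral_eq_integral[OF i] profile_properties(2,3) by simp
  note [measurable] = kernel_measurable
  have [measurable]: "(\<lambda>x. rescale \<theta> \<epsilon> (x - y)) \<in> borel_measurable borel" by measurable
  have "(\<integral>\<^sup>+x. ennreal (rescale \<theta> \<epsilon> (x - y)) \<partial>lborel) =
      (\<integral>\<^sup>+x. ennreal (\<bar>\<epsilon>\<bar> ^ DIM('a)) * ennreal (rescale \<theta> \<epsilon> (y + \<epsilon> *\<^sub>R x - y)) \<partial>lborel)"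
    using e by (subst lborel_affine[of \<epsilon> y])
      (auto simp: nn_integral_density nn_integral_distr)
  also have "\<dots> = (\<integral>\<^sup>+x. ennreal (\<theta> x) \<partial>lborel)"
    using e by (intro nn_integral_cong) (simp add: rescale_def ennreal_mult'[symmetric])
  finally show ?thesis using \<theta>1 by simp
qed

end

lemma thicken_compact:
  assumes "compact \<Omega>" "\<Omega> \<noteq> {}"
  shows "compact (thicken \<Omega> r)" "thicken \<Omega> r \<in> sets borel"
proof -
  have cl: "closed (thicken \<Omega> r)" unfolding thicken_def by (intro closed_Collect_le continuous_intros)
  obtain R where R: "\<And>y. y \<in> \<Omega> \<Longrightarrow> norm y \<le> R" using compact_imp_bounded[OF assms(1)] by (auto simp: bounded_iff)
  have "norm x \<le> R + r" if "x \<in> thicken \<Omega> r" for x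
  proof -
    obtain y where "y \<in> \<Omega>" "infdist x \<Omega> = dist x y"
      using infdist_attains_inf[OF compact_imp_closed[OF assms(1)] assms(2), of x] by blast
    then show ?thesis using that R[of y] norm_triangle_ineq2[of x y] by (simp add: thicken_def dist_norm)
  qed
  then show "compact (thicken \<Omega> r)" using cl by (auto simp: compact_eq_bounded_closed bounded_iff)
  show "thicken \<Omega> r \<in> sets borel" using cl by (rule borel_closed)
qed

section \<open>The coupling of a measure with its regularization\<close>

text \<open>The image of the measure \<open>\<theta>\<^sub>\<epsilon>(x - y) \<rho>(dy) dx\<close> under \<open>(y, x) \<mapsto> (y, T x)\<close>.\<close>

lemma mollified_coupling:
  fixes \<Omega> :: "'a::euclidean_space set" and \<rho> :: "'a measure"
  assumes star: "star_domain \<Omega>" and x0: "x0 \<in> interior (star_points \<Omega>)" and ker: "radial_kernel \<theta>"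
    and \<rho>: "\<rho> \<in> nonneg_measures \<Omega>" and e: "0 < \<epsilon>" and D: "\<And>y. y \<in> \<Omega> \<Longrightarrow> norm (y - x0) \<le> D"
  obtains \<gamma> where "displacement_plan \<Omega> ((1 + gauge_lip \<Omega> x0 * D) * \<epsilon>) \<gamma>"
    "distr \<gamma> borel fst = \<rho>"
    "distr \<gamma> borel snd =
       distr (density lborel (\<lambda>x. ennreal (conv_measure (rescale \<theta> \<epsilon>) \<rho> x))) borel (contraction \<Omega> x0 \<epsilon>)"
proof -
  let ?k = "rescale \<theta> \<epsilon>" and ?T = "contraction \<Omega> x0 \<epsilon>"
  have s\<rho>[measurable_cong]: "sets \<rho> = sets borel" and f\<rho>: "emeasure \<rho> UNIV < \<infinity>" and \<rho>\<Omega>: "emeasure \<rho> (- \<Omega>) = 0"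
    using \<rho> by (auto simp: nonneg_measures_def)
  have sp[simp]: "space \<rho> = UNIV" using s\<rho> by (metis sets_eq_imp_space_eq space_borel)
  interpret \<rho>: finite_measure \<rho> using f\<rho> by (intro finite_measureI) auto
  interpret PS: pair_sigma_finite \<rho> lborel ..
  have \<Omega>b: "\<Omega> \<in> sets borel" using star_compact[OF star x0] by (rule borel_compact)
  have AE\<Omega>: "AE y in \<rho>. y \<in> \<Omega>"
    using \<rho>\<Omega> \<Omega>b by (intro AE_I[where N = "- \<Omega>"]) (auto simp: s\<rho>)
  have sP[measurable_cong]: "sets (\<rho> \<Otimes>\<^sub>M lborel) = sets (borel :: ('a \<times> 'a) measure)"
    by (metis borel_prod s\<rho> sets_lborel sets_pair_measure_cong)
  have km[measurable]: "(\<lambda>z :: 'a \<times> 'a. ?k (snd z - fst z)) \<in> borel_measurable borel"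
    by (intro borel_measurable_continuous_onI continuous_on_compose2[OF kernel_continuous[OF ker e]]
        continuous_intros) auto
  have Tm[measurable]: "?T \<in> borel_measurable borel"
    unfolding contraction_def[abs_def] by (intro borel_measurable_continuous_onI continuous_intros)
  define \<Psi> where "\<Psi> z = (fst z, ?T (snd z))" for z :: "'a \<times> 'a"
  have \<Psi>m[measurable]: "\<Psi> \<in> borel_measurable borel"
    unfolding \<Psi>_def contraction_def by (intro borel_measurable_continuous_onI continuous_intros)
  define \<gamma> where "\<gamma> = distr (density (\<rho> \<Otimes>\<^sub>M lborel) (\<lambda>z. ennreal (?k (snd z - fst z)))) borel \<Psi>"
  have s\<gamma>: "sets \<gamma> = sets borel" by (simp add: \<gamma>_def)
  have em: "emeasure \<gamma> B = (\<integral>\<^sup>+y. (\<integral>\<^sup>+x. ennreal (?k (x - y)) * indicator B (y, ?T x) \<partial>lborel) \<partial>\<rho>)"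
    if B: "B \<in> sets borel" for B
  proof -
    have [measurable]: "\<Psi> -` B \<in> sets borel" using measurable_sets[OF \<Psi>m B] by simp
    have "emeasure \<gamma> B = (\<integral>\<^sup>+z. ennreal (?k (snd z - fst z)) * indicator (\<Psi> -` B) z \<partial>(\<rho> \<Otimes>\<^sub>M lborel))"
    proof -
      have "\<Psi> -` B \<in> sets (\<rho> \<Otimes>\<^sub>M lborel)" unfolding sP by measurable
      moreover have "(\<lambda>z. ennreal (?k (snd z - fst z))) \<in> borel_measurable (\<rho> \<Otimes>\<^sub>M lborel)" by measurable
      ultimately show ?thesis
        unfolding \<gamma>_def using B by (subst emeasure_distr) (auto simp: emeasure_density space_pair_measure)
    qed
    also have "\<dots> = (\<integral>\<^sup>+y. (\<integral>\<^sup>+x. ennreal (?k (snd (y, x) - fst (y, x))) * indicator (\<Psi> -` B) (y, x) \<partial>lborel) \<partial>\<rho>)"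
      by (rule lborel.nn_integral_fst[symmetric]) measurable
    finally show ?thesis by (simp add: \<Psi>_def indicator_def)
  qed
  have k1: "(\<integral>\<^sup>+x. ennreal (?k (x - y)) \<partial>lborel) = 1" for y by (rule kernel_mass[OF ker e])
  have fm: "(fst :: 'a \<times> 'a \<Rightarrow> 'a) \<in> borel_measurable borel" "(snd :: 'a \<times> 'a \<Rightarrow> 'a) \<in> borel_measurable borel"
    by (intro borel_measurable_continuous_onI continuous_intros)+
  have fm\<gamma>: "fst \<in> borel_measurable \<gamma>" "snd \<in> borel_measurable \<gamma>"
    using fm by (simp_all cong: measurable_cong_sets add: s\<gamma>)
  have sp\<gamma>: "space \<gamma> = UNIV" by (simp add: \<gamma>_def)
  have m1: "distr \<gamma> borel fst = \<rho>"
  proof (rule measure_eqI)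
    fix A assume "A \<in> sets (distr \<gamma> borel fst)"
    then have A: "A \<in> sets borel" by simp
    have FA: "fst -` A \<in> sets (borel :: ('a \<times> 'a) measure)" using measurable_sets[OF fm(1) A] by simp
    have "emeasure (distr \<gamma> borel fst) A = emeasure \<gamma> (fst -` A)"
      using A fm\<gamma> by (simp add: emeasure_distr sp\<gamma>)
    also have "\<dots> = (\<integral>\<^sup>+y. (\<integral>\<^sup>+x. ennreal (?k (x - y)) \<partial>lborel) * indicator A y \<partial>\<rho>)"
      unfolding em[OF FA] by (intro nn_integral_cong) (auto simp: indicator_def)
    also have "\<dots> = emeasure \<rho> A" using A by (simp add: k1 s\<rho>)
    finally show "emeasure (distr \<gamma> borel fst) A = emeasure \<rho> A" .
  qed (simp add: s\<rho>)
  have conv: "ennreal (conv_measure ?k \<rho> x) = (\<integral>\<^sup>+y. ennreal (?k (x - y)) \<partial>\<rho>)" for x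
  proof -
    obtain B where B: "\<And>x. ?k x \<le> B" using kernel_bounded[OF ker e] by blast
    have "(\<lambda>y. ?k (x - y)) \<in> borel_measurable borel"
      by (intro borel_measurable_continuous_onI continuous_on_compose2[OF kernel_continuous[OF ker e]]
          continuous_intros) auto
    then have "integrable \<rho> (\<lambda>y. ?k (x - y))"
      using f\<rho> B kernel_nonneg[OF ker e]
      by (intro integrable_bounded_finite[where C = B]) (auto cong: measurable_cong_sets simp: s\<rho>)
    then show ?thesis unfolding conv_measure_def
      using kernel_nonneg[OF ker e] by (intro nn_integral_eq_integral[symmetric]) auto
  qed
  have m2: "distr \<gamma> borel snd = distr (density lborel (\<lambda>x. ennreal (conv_measure ?k \<rho> x))) borel ?T"
  proof (rule measure_eqI)
    fix A assume "A \<in> sets (distr \<gamma> borel snd)"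
    then have A: "A \<in> sets borel" by simp
    have SA: "snd -` A \<in> sets (borel :: ('a \<times> 'a) measure)" using measurable_sets[OF fm(2) A] by simp
    have TA[measurable]: "?T -` A \<in> sets borel" using measurable_sets[OF Tm A] by simp
    have jm: "(\<lambda>z. ennreal (?k (snd z - fst z)) * indicator (?T -` A) (snd z)) \<in> borel_measurable (\<rho> \<Otimes>\<^sub>M lborel)"
    proof (rule borel_measurable_times_ennreal)
      show "(\<lambda>z. ennreal (?k (snd z - fst z))) \<in> borel_measurable (\<rho> \<Otimes>\<^sub>M lborel)" by measurable
      have "(snd :: 'a \<times> 'a \<Rightarrow> 'a) \<in> borel_measurable (\<rho> \<Otimes>\<^sub>M lborel)"
        unfolding measurable_cong_sets[OF sP refl] by (rule fm(2))
      from measurable_compose[OF this borel_measurable_indicator[OF TA]]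
      show "(\<lambda>z. indicator (?T -` A) (snd z)) \<in> borel_measurable (\<rho> \<Otimes>\<^sub>M lborel)" .
    qed
    have cm: "(\<lambda>x. ennreal (conv_measure ?k \<rho> x)) \<in> borel_measurable lborel"
      unfolding conv
    proof -
      have "(\<lambda>x. \<integral>\<^sup>+y. ennreal (?k (snd (y, x) - fst (y, x))) \<partial>\<rho>) \<in> borel_measurable lborel"
      proof (rule \<rho>.borel_measurable_nn_integral)
        have "(\<lambda>z :: 'a \<times> 'a. ?k (fst z - snd z)) \<in> borel_measurable borel"
          by (intro borel_measurable_continuous_onI continuous_on_compose2[OF kernel_continuous[OF ker e]]
            continuous_intros) auto
        moreover have "sets (lborel \<Otimes>\<^sub>M \<rho>) = sets (borel :: ('a \<times> 'a) measure)"
          by (metis borel_prod s\<rho> sets_lborel sets_pair_measure_cong)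
        ultimately have "(\<lambda>z. ?k (fst z - snd z)) \<in> borel_measurable (lborel \<Otimes>\<^sub>M \<rho>)"
          by (simp cong: measurable_cong_sets)
        then show "(\<lambda>(x, y). ennreal (?k (snd (y, x) - fst (y, x)))) \<in> borel_measurable (lborel \<Otimes>\<^sub>M \<rho>)"
          by (simp add: case_prod_beta)
      qed
      then show "(\<lambda>x. \<integral>\<^sup>+y. ennreal (?k (x - y)) \<partial>\<rho>) \<in> borel_measurable lborel" by simp
    qed
    have "emeasure (distr \<gamma> borel snd) A = emeasure \<gamma> (snd -` A)"
      using A fm\<gamma> by (simp add: emeasure_distr sp\<gamma>)
    also have "\<dots> = (\<integral>\<^sup>+y. (\<integral>\<^sup>+x. ennreal (?k (x - y)) * indicator (?T -` A) x \<partial>lborel) \<partial>\<rho>)"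
      unfolding em[OF SA] by (intro nn_integral_cong) (auto simp: indicator_def)
    also have "\<dots> = (\<integral>\<^sup>+x. (\<integral>\<^sup>+y. ennreal (?k (x - y)) * indicator (?T -` A) x \<partial>\<rho>) \<partial>lborel)"
      using PS.Fubini'[of "\<lambda>y x. ennreal (?k (x - y)) * indicator (?T -` A) x"] jm by (simp add: case_prod_beta)
    also have "\<dots> = (\<integral>\<^sup>+x. ennreal (conv_measure ?k \<rho> x) * indicator (?T -` A) x \<partial>lborel)"
    proof (rule nn_integral_cong)
      fix x
      have "(\<lambda>y. ?k (x - y)) \<in> borel_measurable borel"
        by (intro borel_measurable_continuous_onI continuous_on_compose2[OF kernel_continuous[OF ker e]]
            continuous_intros) auto
      then have "(\<lambda>y. ennreal (?k (x - y))) \<in> borel_measurable \<rho>" by (simp add: s\<rho> cong: measurable_cong_sets)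
      then show "(\<integral>\<^sup>+y. ennreal (?k (x - y)) * indicator (?T -` A) x \<partial>\<rho>) = ennreal (conv_measure ?k \<rho> x) * indicator (?T -` A) x"
        by (simp add: conv nn_integral_multc)
    qed
    also have "\<dots> = emeasure (distr (density lborel (\<lambda>x. ennreal (conv_measure ?k \<rho> x))) borel ?T) A"
      using A cm by (simp add: emeasure_distr emeasure_density)
    finally show "emeasure (distr \<gamma> borel snd) A =
       emeasure (distr (density lborel (\<lambda>x. ennreal (conv_measure ?k \<rho> x))) borel ?T) A" .
  qed simp
  define \<eta> where "\<eta> = 1 + gauge_lip \<Omega> x0 * \<epsilon>"
  have \<eta>: "0 < \<eta>" using gauge_lip_nonneg[OF star x0] e by (auto simp: \<eta>_def intro: add_pos_nonneg)
  \<comment> \<open>A closed set of full measure, namely the pairs \<open>(y, T x)\<close> with \<open>y \<in> \<Omega>\<close> and \<open>|x - y| \<le> \<epsilon>\<close>; the set of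
    pairs whose segment lies in \<open>\<Omega>\<close> need not be checked for measurability.\<close>
  define G where "G = {p :: 'a \<times> 'a. fst p \<in> \<Omega> \<and> norm (x0 + \<eta> *\<^sub>R (snd p - x0) - fst p) \<le> \<epsilon>}"
  have "G = fst -` \<Omega> \<inter> {p. norm (x0 + \<eta> *\<^sub>R (snd p - x0) - fst p) \<le> \<epsilon>}" by (auto simp: G_def)
  moreover have "closed (fst -` \<Omega> \<inter> {p :: 'a \<times> 'a. norm (x0 + \<eta> *\<^sub>R (snd p - x0) - fst p) \<le> \<epsilon>})"
    by (intro closed_Int closed_vimage closed_Collect_le continuous_intros star_closed[OF star x0])
  ultimately have "closed G" by simp
  then have Gb: "- G \<in> sets borel" by (intro borel_open open_Compl)
  have inv: "x0 + \<eta> *\<^sub>R (?T x - x0) = x" for x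
    using \<eta> unfolding contraction_def \<eta>_def[symmetric] by simp
  have "emeasure \<gamma> (- G) = (\<integral>\<^sup>+y. 0 \<partial>\<rho>)"
    unfolding em[OF Gb]
  proof (rule nn_integral_cong_AE)
    show "AE y in \<rho>. (\<integral>\<^sup>+x. ennreal (?k (x - y)) * indicator (- G) (y, ?T x) \<partial>lborel) = 0"
      using AE\<Omega>
    proof eventually_elim
      case (elim y)
      have "ennreal (?k (x - y)) * indicator (- G) (y, ?T x) = 0" for x
      proof (cases "?k (x - y) = 0")
        case False
        then have "(y, ?T x) \<in> G" using elim kernel_support[OF ker e False] by (simp add: G_def inv)
        then show ?thesis by simp
      qed simp
      then show ?case by (simp only: nn_integral_const mult_zero_left)
    qed
  qed
  then have "AE p in \<gamma>. p \<in> G" using Gb by (intro AE_I[where N = "- G"]) (auto simp: s\<gamma>)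
  then have good: "AE p in \<gamma>. closed_segment (fst p) (snd p) \<subseteq> \<Omega> \<and>
      norm (snd p - fst p) \<le> (1 + gauge_lip \<Omega> x0 * D) * \<epsilon>"
  proof eventually_elim
    case (elim p)
    define x where "x = x0 + \<eta> *\<^sub>R (snd p - x0)"
    have "?T x = snd p" using \<eta> unfolding contraction_def \<eta>_def[symmetric] x_def by simp
    moreover have "fst p \<in> \<Omega>" "norm (x - fst p) \<le> \<epsilon>" using elim by (auto simp: G_def x_def)
    ultimately show ?case
      using contraction_segment[OF star x0 e, of "fst p" x] contraction_dist[OF star x0 e D, of "fst p" x] by simp
  qed
  have "emeasure \<gamma> UNIV < \<infinity>"
    using f\<rho> fm\<gamma> unfolding m1[symmetric] by (simp add: emeasure_distr sp\<gamma>)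
  then have "displacement_plan \<Omega> ((1 + gauge_lip \<Omega> x0 * D) * \<epsilon>) \<gamma>"
    using s\<gamma> good by (simp add: displacement_plan_def)
  then show ?thesis by (rule that[OF _ m1 m2])
qed

text \<open>The contracted image of the mollified background on \<open>\<Omega>\<^sub>\<epsilon>\<close>. The regularized measure is its mixture
  with the contracted mollification of \<open>\<rho>\<close>, with weights \<open>\<epsilon>\<close> and \<open>1 - \<epsilon>\<close>.\<close>

definition background_part ::
    "'a::euclidean_space set \<Rightarrow> 'a \<Rightarrow> ('a \<Rightarrow> real) \<Rightarrow> ('a \<Rightarrow> real) \<Rightarrow> real \<Rightarrow> 'a measure" where
  "background_part \<Omega> x0 \<theta> \<rho>b \<epsilon> =
     distr (density lborel (\<lambda>x. ennreal (conv_fun (rescale \<theta> \<epsilon>) \<rho>b x) * indicator (thicken \<Omega> \<epsilon>) x))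
        borel (contraction \<Omega> x0 \<epsilon>)"

text \<open>Mollification does not increase the supremum of the background, which bounds the mass of this
  measure uniformly in \<open>\<epsilon>\<close>.\<close>

lemma background_measure:
  fixes \<Omega> :: "'a::euclidean_space set"
  assumes star: "star_domain \<Omega>" and x0: "x0 \<in> interior (star_points \<Omega>)" and ker: "radial_kernel \<theta>"
    and bg: "background \<Omega> \<rho>b"
  obtains H where "0 \<le> H" "\<forall>\<epsilon>. 0 < \<epsilon> \<longrightarrow> \<epsilon> < 1 \<longrightarrow>
     background_part \<Omega> x0 \<theta> \<rho>b \<epsilon> \<in> nonneg_measures \<Omega> \<and> measure (background_part \<Omega> x0 \<theta> \<rho>b \<epsilon>) UNIV \<le> H"
proof -
  have cb: "continuous_on UNIV \<rho>b" and b0: "\<And>x. 0 \<le> \<rho>b x" and bs: "\<And>x. x \<notin> thicken \<Omega> 1 \<Longrightarrow> \<rho>b x = 0"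
    using bg unfolding background_def by (auto intro: smooth_continuous)
  note c\<Omega> = star_compact[OF star x0]
  have ne: "\<Omega> \<noteq> {}" using star_center_mem[OF star x0] by auto
  note tc = thicken_compact[OF c\<Omega> ne]
  have "compact (\<rho>b ` thicken \<Omega> 1)"
    by (intro compact_continuous_image continuous_on_subset[OF cb] tc) auto
  then have "bdd_above (\<rho>b ` thicken \<Omega> 1)" by (intro bounded_imp_bdd_above compact_imp_bounded)
  then obtain B' where B': "\<And>x. x \<in> thicken \<Omega> 1 \<Longrightarrow> \<rho>b x \<le> B'" unfolding bdd_above_def by blast
  define B where "B = max 0 B'"
  have B: "\<rho>b x \<le> B" "0 \<le> B" for x using B'[of x] bs[of x] by (cases "x \<in> thicken \<Omega> 1"; force simp: B_def)+
  define H where "H = B * measure lborel (thicken \<Omega> 1)"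
  show ?thesis
  proof (rule that[of H], goal_cases)
    case 1
    show "0 \<le> H" using B by (simp add: H_def)
  next
    case 2
    show ?case
    proof (intro allI impI)
      fix \<epsilon> :: real assume e: "0 < \<epsilon>" and e1: "\<epsilon> < 1"
      let ?k = "rescale \<theta> \<epsilon>" and ?T = "contraction \<Omega> x0 \<epsilon>"
      let ?f = "\<lambda>x. ennreal (conv_fun ?k \<rho>b x) * indicator (thicken \<Omega> \<epsilon>) x"
      let ?\<nu> = "distr (density lborel ?f) borel ?T"
      have Tm[measurable]: "?T \<in> borel_measurable borel"
        unfolding contraction_def[abs_def] by (intro borel_measurable_continuous_onI continuous_intros)
      note [measurable] = tc(2)
      have pm: "(\<lambda>z :: 'a \<times> 'a. ?k (fst z - snd z) * \<rho>b (snd z)) \<in> borel_measurable borel"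
        by (intro borel_measurable_continuous_onI continuous_on_mult continuous_on_compose2[OF kernel_continuous[OF ker e]]
            continuous_on_compose2[OF cb] continuous_intros) auto
      have cm[measurable]: "conv_fun ?k \<rho>b \<in> borel_measurable borel"
      proof -
        have "(\<lambda>x. LINT y|lborel. ?k (fst (x, y) - snd (x, y)) * \<rho>b (snd (x, y))) \<in> borel_measurable lborel"
        proof (rule lborel.borel_measurable_lebesgue_integral)
          have "sets (lborel \<Otimes>\<^sub>M lborel) = sets (borel :: ('a \<times> 'a) measure)"
            by (metis borel_prod sets_lborel sets_pair_measure_cong)
          then show "(\<lambda>(x, y). ?k (fst (x, y) - snd (x, y)) * \<rho>b (snd (x, y))) \<in> borel_measurable (lborel \<Otimes>\<^sub>M lborel)"
            using pm by (simp add: case_prod_beta cong: measurable_cong_sets)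
        qed
        then show ?thesis by (simp add: conv_fun_def[abs_def])
      qed
      have convB: "ennreal (conv_fun ?k \<rho>b x) \<le> ennreal B" for x
      proof -
        have "ennreal (conv_fun ?k \<rho>b x) \<le> (\<integral>\<^sup>+y. ennreal (?k (x - y) * \<rho>b y) \<partial>lborel)"
        proof (cases "integrable lborel (\<lambda>y. ?k (x - y) * \<rho>b y)")
          case True
          then show ?thesis using b0 kernel_nonneg[OF ker e] by (simp add: conv_fun_def nn_integral_eq_integral)
        next
          case False
          then show ?thesis by (simp add: conv_fun_def not_integrable_integral_eq)
        qed
        also have "\<dots> \<le> (\<integral>\<^sup>+y. ennreal B * ennreal (?k (y - x)) \<partial>lborel)"
        proof (rule nn_integral_mono)
          fix y
          have "?k (x - y) = ?k (y - x)" using kernel_sym[OF ker e, of "y - x"] by simp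
          then show "ennreal (?k (x - y) * \<rho>b y) \<le> ennreal B * ennreal (?k (y - x))"
            using B kernel_nonneg[OF ker e, of "y - x"]
            by (auto simp: ennreal_mult'[symmetric] mult.commute intro!: ennreal_leI mult_right_mono)
        qed
        also have "\<dots> = ennreal B * (\<integral>\<^sup>+y. ennreal (?k (y - x)) \<partial>lborel)"
        proof (rule nn_integral_cmult)
          have "(\<lambda>y. ?k (y - x)) \<in> borel_measurable borel"
            by (intro borel_measurable_continuous_onI continuous_on_compose2[OF kernel_continuous[OF ker e]]
                continuous_intros) auto
          then show "(\<lambda>y. ennreal (?k (y - x))) \<in> borel_measurable lborel" by simp
        qed
        finally show ?thesis by (simp add: kernel_mass[OF ker e])
      qed
      have em: "emeasure ?\<nu> A = (\<integral>\<^sup>+x. ?f x * indicator A (?T x) \<partial>lborel)" if A: "A \<in> sets borel" for A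
      proof -
        have "?T -` A \<in> sets borel" using measurable_sets[OF Tm A] by simp
        then show ?thesis using A
          by (simp add: emeasure_distr emeasure_density) (auto intro!: nn_integral_cong simp: indicator_def)
      qed
      have "emeasure ?\<nu> UNIV = (\<integral>\<^sup>+x. ?f x * indicator UNIV (?T x) \<partial>lborel)" by (rule em) simp
      also have "\<dots> \<le> (\<integral>\<^sup>+x. ennreal B * indicator (thicken \<Omega> 1) x \<partial>lborel)"
      proof (rule nn_integral_mono)
        fix x
        have "thicken \<Omega> \<epsilon> \<subseteq> thicken \<Omega> 1" using e1 by (auto simp: thicken_def)
        then show "?f x * indicator UNIV (?T x) \<le> ennreal B * indicator (thicken \<Omega> 1) x"
          using convB[of x] by (auto simp: indicator_def)
      qed
      also have "\<dots> = ennreal B * emeasure lborel (thicken \<Omega> 1)" by (simp add: nn_integral_cmult)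
      also have "\<dots> = ennreal H"
        using emeasure_compact_finite[OF tc(1), of 1] B
        by (simp add: H_def ennreal_mult' emeasure_eq_ennreal_measure less_top[symmetric])
      finally have mass: "emeasure ?\<nu> UNIV \<le> ennreal H" .
      have "emeasure ?\<nu> (- \<Omega>) = (\<integral>\<^sup>+(x :: 'a). 0 \<partial>lborel)"
      proof (subst em)
        show "- \<Omega> \<in> sets borel" using borel_compact[OF c\<Omega>] by auto
        show "(\<integral>\<^sup>+x. ?f x * indicator (- \<Omega>) (?T x) \<partial>lborel) = (\<integral>\<^sup>+(x :: 'a). 0 \<partial>lborel)"
          by (rule nn_integral_cong, use contraction_thicken[OF star x0 e] in \<open>auto simp: indicator_def\<close>)
      qed
      then have "?\<nu> \<in> nonneg_measures \<Omega>" using mass by (auto simp: nonneg_measures_def intro: le_less_trans)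
      moreover have "measure ?\<nu> UNIV \<le> H"
        using mass B unfolding measure_def H_def by (intro enn2real_leI) auto
      ultimately show "background_part \<Omega> x0 \<theta> \<rho>b \<epsilon> \<in> nonneg_measures \<Omega> \<and> measure (background_part \<Omega> x0 \<theta> \<rho>b \<epsilon>) UNIV \<le> H"
        unfolding background_part_def by blast
    qed
  qed
qed

lemma regularize_coupling:
  fixes \<Omega> :: "'a::euclidean_space set" and \<rho> :: "'a measure"
  assumes star: "star_domain \<Omega>" and x0: "x0 \<in> interior (star_points \<Omega>)" and bg: "background \<Omega> \<rho>b"
    and ker: "radial_kernel \<theta>" and \<rho>: "\<rho> \<in> nonneg_measures \<Omega>"
  obtains C H :: real where "0 \<le> C" "0 \<le> H"
    "\<forall>\<epsilon>. 0 < \<epsilon> \<longrightarrow> \<epsilon> < 1 \<longrightarrow> (\<exists>\<gamma> \<nu>.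
       displacement_plan \<Omega> (C * \<epsilon>) \<gamma> \<and> measure \<gamma> UNIV = measure \<rho> UNIV \<and>
       \<nu> \<in> nonneg_measures \<Omega> \<and> measure \<nu> UNIV \<le> H \<and>
       joins_by \<gamma> \<nu> \<epsilon> \<rho> (regularize \<Omega> x0 \<theta> \<rho>b \<epsilon> \<rho>))"
proof -
  obtain D where D: "\<And>y. y \<in> \<Omega> \<Longrightarrow> norm (y - x0) \<le> D"
  proof -
    have "bounded ((\<lambda>y. y - x0) ` \<Omega>)"
      by (intro bounded_translation_minus compact_imp_bounded star_compact[OF star x0])
    then show ?thesis using that by (auto simp: bounded_iff)
  qed
  have D0: "0 \<le> D" using D[of x0] star_center_mem[OF star x0] by simp
  define C where "C = 1 + gauge_lip \<Omega> x0 * D"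
  obtain H where H: "0 \<le> H" and bgm: "\<forall>\<epsilon>. 0 < \<epsilon> \<longrightarrow> \<epsilon> < 1 \<longrightarrow>
     background_part \<Omega> x0 \<theta> \<rho>b \<epsilon> \<in> nonneg_measures \<Omega> \<and> measure (background_part \<Omega> x0 \<theta> \<rho>b \<epsilon>) UNIV \<le> H"
    by (rule background_measure[OF star x0 ker bg], rule that)
  show ?thesis
  proof (rule that[of C H], goal_cases)
    case 1
    show "0 \<le> C" using gauge_lip_nonneg[OF star x0] D0 by (simp add: C_def)
  next
    case 2
    show "0 \<le> H" by (rule H)
  next
    case 3
    show ?case
    proof (intro allI impI)
      fix \<epsilon> :: real assume e: "0 < \<epsilon>" and e1: "\<epsilon> < 1"
      define \<nu> where "\<nu> = background_part \<Omega> x0 \<theta> \<rho>b \<epsilon>"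
      define M1 where "M1 = distr (density lborel (\<lambda>x. ennreal (conv_measure (rescale \<theta> \<epsilon>) \<rho> x))) borel (contraction \<Omega> x0 \<epsilon>)"
      obtain \<gamma> where plan: "displacement_plan \<Omega> (C * \<epsilon>) \<gamma>"
        and m1: "distr \<gamma> borel fst = \<rho>" and m2: "distr \<gamma> borel snd = M1"
        by (rule mollified_coupling[OF star x0 ker \<rho> e D, folded C_def M1_def], assumption, rule that)
      have s\<gamma>: "sets \<gamma> = sets borel" using plan by (simp add: displacement_plan_def)
      note fm = marginals_measurable[OF s\<gamma>]
      have sp: "space \<gamma> = UNIV" using s\<gamma> by (metis sets_eq_imp_space_eq space_borel)
      have \<nu>: "\<nu> \<in> nonneg_measures \<Omega>" "measure \<nu> UNIV \<le> H" using bgm e e1 unfolding \<nu>_def by auto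
      have reg: "regularize \<Omega> x0 \<theta> \<rho>b \<epsilon> \<rho> = mix_measure (ennreal (1 - \<epsilon>)) M1 (ennreal \<epsilon>) \<nu>"
        by (simp add: regularize_def mix_measure_def M1_def \<nu>_def background_part_def Let_def)
      have mass: "emeasure \<gamma> UNIV = emeasure \<rho> UNIV" "emeasure M1 UNIV = emeasure \<gamma> UNIV"
        unfolding m1[symmetric] m2[symmetric] using fm by (simp_all add: emeasure_distr sp)
      have f\<rho>: "emeasure \<rho> UNIV < \<infinity>" using \<rho> by (simp add: nonneg_measures_def)
      have "(LINT x|\<rho>. f x) = (LINT p|\<gamma>. f (fst p)) \<and>
            (LINT x|regularize \<Omega> x0 \<theta> \<rho>b \<epsilon> \<rho>. f x) = (1 - \<epsilon>) * (LINT p|\<gamma>. f (snd p)) + \<epsilon> * (LINT x|\<nu>. f x)"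
        if f: "f \<in> borel_measurable borel" and B: "\<And>x. \<bar>f x\<bar> \<le> B" for f :: "'a \<Rightarrow> real" and B
      proof
        show "(LINT x|\<rho>. f x) = (LINT p|\<gamma>. f (fst p))"
          unfolding m1[symmetric] by (rule integral_distr[OF fm(1) f])
        have "(LINT x|M1. f x) = (LINT p|\<gamma>. f (snd p))"
          unfolding m2[symmetric] by (rule integral_distr[OF fm(2) f])
        then show "(LINT x|regularize \<Omega> x0 \<theta> \<rho>b \<epsilon> \<rho>. f x) = (1 - \<epsilon>) * (LINT p|\<gamma>. f (snd p)) + \<epsilon> * (LINT x|\<nu>. f x)"
          unfolding reg using \<nu>(1) mass f\<rho> e e1 f B
          by (subst integral_mix_measure[where C = B]) (auto simp: nonneg_measures_def M1_def)
      qed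
      then have "joins_by \<gamma> \<nu> \<epsilon> \<rho> (regularize \<Omega> x0 \<theta> \<rho>b \<epsilon> \<rho>)" unfolding joins_by_def by blast
      moreover have "measure \<gamma> UNIV = measure \<rho> UNIV" using mass(1) by (simp add: measure_def)
      ultimately show "\<exists>\<gamma> \<nu>.
         displacement_plan \<Omega> (C * \<epsilon>) \<gamma> \<and> measure \<gamma> UNIV = measure \<rho> UNIV \<and>
         \<nu> \<in> nonneg_measures \<Omega> \<and> measure \<nu> UNIV \<le> H \<and>
         joins_by \<gamma> \<nu> \<epsilon> \<rho> (regularize \<Omega> x0 \<theta> \<rho>b \<epsilon> \<rho>)"
        using plan \<nu> by blast
    qed
  qed
qed

section \<open>Sampled measures and the main estimate\<close>

lemma sample_eq:
  assumes mesh: "mesh \<Omega> \<sigma> T" and v: "v \<in> vertices T"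
  shows "sample T M v = (LINT x|M. nodal T v x) / patch_vol T v"
proof -
  have "(\<lambda>x. indicator (\<Union>T) x *\<^sub>R nodal T v x) = nodal T v"
    using nodal_indicator[OF mesh, of v] mesh_Union[OF mesh] by simp
  then show ?thesis using v by (simp only: sample_def set_lebesgue_integral_def restrict_apply if_True)
qed

lemma sample_X_pos:
  assumes mesh: "mesh \<Omega> \<sigma> T"
  shows "sample T M \<in> X_pos T"
proof -
  have "0 \<le> sample T M v" if "v \<in> vertices T" for v
    unfolding sample_eq[OF mesh that] using patch_vol_pos[OF mesh that] nodal_bounds(1)[OF mesh]
    by (intro divide_nonneg_nonneg integral_nonneg) (auto simp: less_imp_le)
  then show ?thesis by (simp add: X_pos_def X_space_def sample_def)
qed

lemma discrete_path_of_coupling: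
  fixes \<Omega> :: "'a::euclidean_space set" and \<gamma> :: "('a \<times> 'a) measure" and \<nu> \<rho>0 \<rho>1 :: "'a measure"
    and \<delta> \<epsilon> \<kappa> :: real
  assumes mesh: "mesh \<Omega> \<sigma> T" and N: "2 \<le> N"
    and plan: "displacement_plan \<Omega> \<delta> \<gamma>" and \<delta>: "0 \<le> \<delta>"
    and \<kappa>: "\<And>K v. K \<in> T \<Longrightarrow> v \<in> vertices_of K \<Longrightarrow> patch_vol T v \<le> \<kappa> * measure lborel K" and \<kappa>0: "0 \<le> \<kappa>"
    and \<nu>: "\<nu> \<in> nonneg_measures \<Omega>" and e: "0 < \<epsilon>" "\<epsilon> < 1"
    and joins: "joins_by \<gamma> \<nu> \<epsilon> \<rho>0 \<rho>1"
  shows "\<exists>\<mu>\<in>CE_disc N T (sample T \<rho>0) (sample T \<rho>1). J_time N T \<mu> \<le>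
     ennreal (36 * (\<delta> * \<kappa> * (DIM('a) + 1)) * (\<delta> * measure \<gamma> UNIV) + 144 * \<epsilon> * (measure \<gamma> UNIV + measure \<nu> UNIV))"
proof -
  have s\<gamma>: "sets \<gamma> = sets borel" and f\<gamma>: "emeasure \<gamma> UNIV < \<infinity>"
    using plan unfolding displacement_plan_def by blast+
  have \<rho>0: "(LINT x|\<rho>0. f x) = (LINT p|\<gamma>. f (fst p))"
    and \<rho>1: "(LINT x|\<rho>1. f x) = (1 - \<epsilon>) * (LINT p|\<gamma>. f (snd p)) + \<epsilon> * (LINT x|\<nu>. f x)"
    if "f \<in> borel_measurable borel" "\<And>x. \<bar>f x\<bar> \<le> C" for f :: "'a \<Rightarrow> real" and C
    using joins that unfolding joins_by_def by blast+
  obtain M q0 q1 where M: "\<And>v. v \<in> vertices T \<Longrightarrow> 0 \<le> M v"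
    and id0: "\<And>v. v \<in> vertices T \<Longrightarrow> patch_vol T v * M v - (LINT p|\<gamma>. nodal T v (fst p)) =
        (\<Sum>K\<in>T. measure lborel K * (q0 K \<bullet> bary_grad K v))"
    and id1: "\<And>v. v \<in> vertices T \<Longrightarrow> (LINT p|\<gamma>. nodal T v (snd p)) - patch_vol T v * M v =
        (\<Sum>K\<in>T. measure lborel K * (q1 K \<bullet> bary_grad K v))"
    and q: "\<And>K. K \<in> T \<Longrightarrow> norm (q0 K) \<le> \<delta> * \<kappa> * (\<Sum>v\<in>vertices_of K. M v)"
      "\<And>K. K \<in> T \<Longrightarrow> norm (q1 K) \<le> \<delta> * \<kappa> * (\<Sum>v\<in>vertices_of K. M v)"
    and qs: "(\<Sum>K\<in>T. measure lborel K * norm (q0 K)) \<le> \<delta> * measure \<gamma> UNIV"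
      "(\<Sum>K\<in>T. measure lborel K * norm (q1 K)) \<le> \<delta> * measure \<gamma> UNIV"
    by (rule discrete_fluxes_of_coupling[OF mesh plan \<delta> \<kappa>], assumption, assumption, rule that)
  have s\<nu>: "sets \<nu> = sets borel" and f\<nu>: "emeasure \<nu> UNIV < \<infinity>" using \<nu> by (auto simp: nonneg_measures_def)
  have sp: "space \<gamma> = UNIV" "space \<nu> = UNIV" using s\<gamma> s\<nu> by (metis sets_eq_imp_space_eq space_borel)+
  interpret \<gamma>: finite_measure \<gamma> using f\<gamma> sp by (intro finite_measureI) auto
  interpret \<nu>: finite_measure \<nu> using f\<nu> sp by (intro finite_measureI) auto
  have nm: "nodal T v \<in> borel_measurable borel" for v by (rule nodal_measurable[OF mesh])
  have nb: "\<bar>nodal T v x\<bar> \<le> 1" for v x using nodal_bounds[OF mesh, of v x] by simp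
  note fm = marginals_measurable(2)[OF s\<gamma>]
  have i1: "integrable \<gamma> (\<lambda>p. nodal T v (snd p))" for v
    by (rule integrable_bounded_finite[where C = 1]) (use f\<gamma> sp nb measurable_compose[OF fm nm] in auto)
  have i2: "integrable \<nu> (\<lambda>x. nodal T v x)" for v
    by (rule integrable_bounded_finite[where C = 1]) (use f\<nu> sp nb nm in \<open>auto simp: s\<nu> cong: measurable_cong_sets\<close>)
  define B' where "B' v = (LINT p|\<gamma>. nodal T v (snd p)) / patch_vol T v" for v
  define E where "E v = (LINT x|\<nu>. nodal T v x) / patch_vol T v" for v
  have pv: "0 < patch_vol T v" if "v \<in> vertices T" for v by (rule patch_vol_pos[OF mesh that])
  show ?thesis
  proof (rule discrete_path_from_fluxes[OF mesh sample_X_pos[OF mesh] sample_X_pos[OF mesh] N M])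
    fix v assume v: "v \<in> vertices T"
    show "0 \<le> B' v" "0 \<le> E v"
      using pv[OF v] nodal_bounds(1)[OF mesh] by (auto simp: B'_def E_def intro!: divide_nonneg_nonneg integral_nonneg)
    show "sample T \<rho>1 v = (1 - \<epsilon>) * B' v + \<epsilon> * E v"
      by (simp add: sample_eq[OF mesh v] \<rho>1[OF nm nb] B'_def E_def add_divide_distrib)
    show "patch_vol T v * (M v - sample T \<rho>0 v) = (\<Sum>K\<in>T. measure lborel K * (q0 K \<bullet> bary_grad K v))"
      using id0[OF v] pv[OF v] by (simp add: sample_eq[OF mesh v] \<rho>0[OF nm nb] right_diff_distrib)
    show "patch_vol T v * (B' v - M v) = (\<Sum>K\<in>T. measure lborel K * (q1 K \<bullet> bary_grad K v))"
      using id1[OF v] pv[OF v] by (simp add: B'_def right_diff_distrib)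
  next
    show "(\<Sum>v\<in>vertices T. patch_vol T v * (B' v + E v)) \<le> measure \<gamma> UNIV + measure \<nu> UNIV"
    proof -
      have "(\<Sum>v\<in>vertices T. patch_vol T v * (B' v + E v)) =
          (\<Sum>v\<in>vertices T. (LINT p|\<gamma>. nodal T v (snd p)) + (LINT x|\<nu>. nodal T v x))"
        using pv by (intro sum.cong) (auto simp: B'_def E_def distrib_left dest: less_imp_neq[THEN not_sym])
      also have "\<dots> = (LINT p|\<gamma>. (\<Sum>v\<in>vertices T. nodal T v (snd p))) + (LINT x|\<nu>. (\<Sum>v\<in>vertices T. nodal T v x))"
        using i1 i2 by (simp add: sum.distrib Bochner_Integration.integral_sum)
      also have "\<dots> \<le> (LINT p|\<gamma>. 1) + (LINT x|\<nu>. 1)"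
        using i1 i2 nodal_sum_le[OF mesh] by (intro add_mono integral_mono) auto
      finally show ?thesis using sp by simp
    qed
  qed (use e q qs \<delta> \<kappa>0 in auto)
qed

theorem theorem5p1:
  fixes \<Omega> :: "'a::euclidean_space set" and x0 :: 'a
    and \<theta> \<rho>b :: "'a \<Rightarrow> real" and S :: "real set" and \<T> :: "real \<Rightarrow> 'a set set"
    and \<rho> :: "'a measure"
  assumes "star_domain \<Omega>"
    and "x0 \<in> interior (star_points \<Omega>)"
    and "background \<Omega> \<rho>b"
    and "radial_kernel \<theta>"
    and "S \<subseteq> {0<..}" and "0 islimpt S"
    and "\<And>\<sigma>. \<sigma> \<in> S \<Longrightarrow> mesh \<Omega> \<sigma> (\<T> \<sigma>)"
    and "quasi_uniform S \<T>"
    and "\<rho> \<in> nonneg_measures \<Omega>"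
  shows "(\<exists>C::real. \<forall>\<^sub>F \<epsilon> in at_right 0.
            WFR_sq \<Omega> \<rho> (regularize \<Omega> x0 \<theta> \<rho>b \<epsilon> \<rho>) \<le> ennreal (C * \<epsilon>)) \<and>
         (\<exists>\<mu> :: real \<Rightarrow> nat \<Rightarrow> real \<Rightarrow>
              (nat \<Rightarrow> 'a \<Rightarrow> real) \<times> (nat \<Rightarrow> 'a set \<Rightarrow> 'a) \<times> (nat \<Rightarrow> 'a \<Rightarrow> real).
            (\<forall>\<epsilon>\<in>{0<..<1}. \<forall>N\<ge>2. \<forall>\<sigma>\<in>S.
               \<mu> \<epsilon> N \<sigma> \<in> CE_disc N (\<T> \<sigma>) (sample (\<T> \<sigma>) \<rho>)
                            (sample (\<T> \<sigma>) (regularize \<Omega> x0 \<theta> \<rho>b \<epsilon> \<rho>))) \<and>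
            (\<exists>C \<epsilon>0 \<sigma>0 :: real. 0 < \<epsilon>0 \<and> 0 < \<sigma>0 \<and>
               (\<forall>\<epsilon>\<in>{0<..<\<epsilon>0}. \<forall>\<sigma>\<in>S \<inter> {0<..<\<sigma>0}. \<forall>N\<ge>2.
                  J_time N (\<T> \<sigma>) (\<mu> \<epsilon> N \<sigma>) \<le> ennreal (C * (\<epsilon> + \<sigma>)))))"
proof -
  let ?R = "\<lambda>\<epsilon>. regularize \<Omega> x0 \<theta> \<rho>b \<epsilon> \<rho>"
  have c\<Omega>: "compact \<Omega>" and ne: "\<Omega> \<noteq> {}"
    using star_compact[OF assms(1,2)] star_center_mem(2)[OF assms(1,2)] by auto
  obtain D H :: real where D: "0 \<le> D" and H: "0 \<le> H" and
    cpl: "\<forall>\<epsilon>. 0 < \<epsilon> \<longrightarrow> \<epsilon> < 1 \<longrightarrow> (\<exists>\<gamma> \<nu>. displacement_plan \<Omega> (D * \<epsilon>) \<gamma> \<and>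
       measure \<gamma> UNIV = measure \<rho> UNIV \<and> \<nu> \<in> nonneg_measures \<Omega> \<and> measure \<nu> UNIV \<le> H \<and>
       joins_by \<gamma> \<nu> \<epsilon> \<rho> (?R \<epsilon>))"
    by (rule regularize_coupling[OF assms(1-4,9)], rule that)
  obtain c where c: "0 < c" and qu: "\<And>\<sigma> K. \<sigma> \<in> S \<Longrightarrow> K \<in> \<T> \<sigma> \<Longrightarrow> \<exists>x r. c * \<sigma> \<le> 2 * r \<and> ball x r \<subseteq> K"
    using assms(8) unfolding quasi_uniform_def by blast
  define m where "m = measure \<rho> UNIV"
  define \<kappa> where "\<kappa> = (2 / c) ^ DIM('a)"
  have m0: "0 \<le> m" and \<kappa>0: "0 \<le> \<kappa>" using c by (auto simp: m_def \<kappa>_def)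
  define C1 where "C1 = m * ((DIM('a) * D)\<^sup>2 / 2 + 4) + 2 * H"
  define C2 where "C2 = 36 * (D * \<kappa> * (DIM('a) + 1)) * (D * m) + 144 * (m + H)"
  have C2: "0 \<le> C2" using D H m0 \<kappa>0 by (simp add: C2_def)
  have W: "WFR_sq \<Omega> \<rho> (?R \<epsilon>) \<le> ennreal (C1 * \<epsilon>)" if e: "0 < \<epsilon>" "\<epsilon> \<le> 1/2" for \<epsilon>
  proof -
    have e1: "\<epsilon> < 1" using e by simp
    from mp[OF mp[OF spec[OF cpl] e(1)] e1] obtain \<gamma> \<nu> where
      g: "displacement_plan \<Omega> (D * \<epsilon>) \<gamma>" "measure \<gamma> UNIV = measure \<rho> UNIV"
       "\<nu> \<in> nonneg_measures \<Omega>" "measure \<nu> UNIV \<le> H" "joins_by \<gamma> \<nu> \<epsilon> \<rho> (?R \<epsilon>)"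
      by (elim exE conjE) (rule that)
    have gm: "measure \<gamma> UNIV = m" using g(2) by (simp add: m_def)
    have "WFR_sq \<Omega> \<rho> (?R \<epsilon>) \<le>
       ennreal (measure \<gamma> UNIV * ((DIM('a) * (D * \<epsilon>))\<^sup>2 / 2 + 4 * \<epsilon>\<^sup>2) + measure \<nu> UNIV * (2 * \<epsilon>))"
      by (rule WFR_sq_le_of_coupling[OF c\<Omega> ne g(1) _ g(3) e g(5)]) (use D e in simp)
    also have "\<dots> \<le> ennreal (C1 * \<epsilon>)"
    proof (rule ennreal_leI)
      have "\<epsilon>\<^sup>2 \<le> \<epsilon>" using e by (simp add: power2_eq_square mult_left_le)
      then have "m * (((DIM('a) * D)\<^sup>2 / 2 + 4) * \<epsilon>\<^sup>2) \<le> m * (((DIM('a) * D)\<^sup>2 / 2 + 4) * \<epsilon>)"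
        using m0 by (intro mult_left_mono) auto
      moreover have "measure \<nu> UNIV * (2 * \<epsilon>) \<le> H * (2 * \<epsilon>)" using g(4) e by (intro mult_right_mono) auto
      ultimately show "measure \<gamma> UNIV * ((DIM('a) * (D * \<epsilon>))\<^sup>2 / 2 + 4 * \<epsilon>\<^sup>2) + measure \<nu> UNIV * (2 * \<epsilon>) \<le> C1 * \<epsilon>"
        by (simp add: gm C1_def power_mult_distrib algebra_simps)
    qed
    finally show ?thesis .
  qed
  have disc: "\<exists>\<mu>. \<mu> \<in> CE_disc N (\<T> \<sigma>) (sample (\<T> \<sigma>) \<rho>) (sample (\<T> \<sigma>) (?R \<epsilon>)) \<and>
      J_time N (\<T> \<sigma>) \<mu> \<le> ennreal (C2 * (\<epsilon> + \<sigma>))"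
    if e: "0 < \<epsilon>" "\<epsilon> < 1" and N: "2 \<le> N" and \<sigma>: "\<sigma> \<in> S" for \<epsilon> N \<sigma>
  proof -
    note e1 = e(2)
    have \<sigma>0: "0 < \<sigma>" using \<sigma> assms(5) by auto
    note mesh = assms(7)[OF \<sigma>]
    have \<kappa>: "patch_vol (\<T> \<sigma>) v \<le> \<kappa> * measure lborel K" if K: "K \<in> \<T> \<sigma>" "v \<in> vertices_of K" for K v
    proof -
      obtain x r where "c * \<sigma> \<le> 2 * r" "ball x r \<subseteq> K" using qu[OF \<sigma> K(1)] by blast
      then show ?thesis unfolding \<kappa>_def by (rule patch_vol_le[OF mesh K c _ _ \<sigma>0])
    qed
    from mp[OF mp[OF spec[OF cpl] e(1)] e1] obtain \<gamma> \<nu> where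
      g: "displacement_plan \<Omega> (D * \<epsilon>) \<gamma>" "measure \<gamma> UNIV = measure \<rho> UNIV"
       "\<nu> \<in> nonneg_measures \<Omega>" "measure \<nu> UNIV \<le> H" "joins_by \<gamma> \<nu> \<epsilon> \<rho> (?R \<epsilon>)"
      by (elim exE conjE) (rule that)
    have gm: "measure \<gamma> UNIV = m" using g(2) by (simp add: m_def)
    have "\<exists>\<mu>\<in>CE_disc N (\<T> \<sigma>) (sample (\<T> \<sigma>) \<rho>) (sample (\<T> \<sigma>) (?R \<epsilon>)). J_time N (\<T> \<sigma>) \<mu> \<le>
     ennreal (36 * (D * \<epsilon> * \<kappa> * (DIM('a) + 1)) * (D * \<epsilon> * measure \<gamma> UNIV) + 144 * \<epsilon> * (measure \<gamma> UNIV + measure \<nu> UNIV))"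
      by (rule discrete_path_of_coupling[OF mesh N g(1) _ \<kappa> \<kappa>0 g(3) e g(5)]) (use D e in simp_all)
    moreover have "36 * (D * \<epsilon> * \<kappa> * (DIM('a) + 1)) * (D * \<epsilon> * measure \<gamma> UNIV) + 144 * \<epsilon> * (measure \<gamma> UNIV + measure \<nu> UNIV)
        \<le> C2 * (\<epsilon> + \<sigma>)"
    proof -
      let ?A = "36 * (D * \<kappa> * (DIM('a) + 1)) * (D * m)"
      have "\<epsilon>\<^sup>2 \<le> \<epsilon>" using e by (simp add: power2_eq_square mult_left_le)
      then have "?A * \<epsilon>\<^sup>2 \<le> ?A * \<epsilon>" using D \<kappa>0 m0 by (intro mult_left_mono) auto
      moreover have "144 * \<epsilon> * (m + measure \<nu> UNIV) \<le> 144 * \<epsilon> * (m + H)" using g(4) e by (intro mult_left_mono) auto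
      ultimately have "36 * (D * \<epsilon> * \<kappa> * (DIM('a) + 1)) * (D * \<epsilon> * m) + 144 * \<epsilon> * (m + measure \<nu> UNIV) \<le> C2 * \<epsilon>"
        by (simp add: C2_def power2_eq_square algebra_simps)
      also have "\<dots> \<le> C2 * (\<epsilon> + \<sigma>)" using C2 \<sigma>0 by (intro mult_left_mono) auto
      finally show ?thesis by (simp only: gm)
    qed
    ultimately show ?thesis by (meson ennreal_leI order.trans)
  qed
  define \<mu> where "\<mu> \<epsilon> N \<sigma> = (SOME \<mu>. \<mu> \<in> CE_disc N (\<T> \<sigma>) (sample (\<T> \<sigma>) \<rho>) (sample (\<T> \<sigma>) (?R \<epsilon>)) \<and>
      J_time N (\<T> \<sigma>) \<mu> \<le> ennreal (C2 * (\<epsilon> + \<sigma>)))" for \<epsilon> N \<sigma>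
  have \<mu>: "\<mu> \<epsilon> N \<sigma> \<in> CE_disc N (\<T> \<sigma>) (sample (\<T> \<sigma>) \<rho>) (sample (\<T> \<sigma>) (?R \<epsilon>)) \<and>
      J_time N (\<T> \<sigma>) (\<mu> \<epsilon> N \<sigma>) \<le> ennreal (C2 * (\<epsilon> + \<sigma>))"
    if "0 < \<epsilon>" "\<epsilon> < 1" "2 \<le> N" "\<sigma> \<in> S" for \<epsilon> N \<sigma>
    unfolding \<mu>_def by (rule someI_ex[OF disc[OF that]])
  show ?thesis
  proof (intro conjI exI)
    show "\<forall>\<^sub>F \<epsilon> in at_right 0. WFR_sq \<Omega> \<rho> (?R \<epsilon>) \<le> ennreal (C1 * \<epsilon>)"
      using W by (intro eventually_at_rightI[of 0 "1/2"]) auto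
    show "\<forall>\<epsilon>\<in>{0<..<1}. \<forall>N\<ge>2. \<forall>\<sigma>\<in>S. \<mu> \<epsilon> N \<sigma> \<in> CE_disc N (\<T> \<sigma>) (sample (\<T> \<sigma>) \<rho>) (sample (\<T> \<sigma>) (?R \<epsilon>))"
      using \<mu> by auto
    show "(0::real) < 1" "(0::real) < 1" by simp_all
    show "\<forall>\<epsilon>\<in>{0<..<1}. \<forall>\<sigma>\<in>S \<inter> {0<..<1}. \<forall>N\<ge>2. J_time N (\<T> \<sigma>) (\<mu> \<epsilon> N \<sigma>) \<le> ennreal (C2 * (\<epsilon> + \<sigma>))"
      using \<mu> by auto
  qed
qed

end
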